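(* Let $S^3_{8,35},\dots,S^3_{8,38}$ and $N_1,\dots,N_{15}$ be the explicit $8$-vertex complexes defined in the context. (a) $S^3_{8,i}\not\cong S^3_{8,j}$, $N_k\not\cong N_l$ and $S^3_{8,m}\not\cong N_n$ for $35\le i<j\le 38$, $1\le k<l\le 15$, $35\le m\le 38$ and $1\le n\le 15$. (b) If $M$ is an $8$-vertex neighbourly normal $3$-pseudomanifold, then $M$ is isomorphic to one of $S^3_{8,35},\dots,S^3_{8,38},N_1,\dots,N_{15}$.
   Context: All simplicial complexes are finite. A simplicial complex is a collection of non-empty finite sets closed under taking non-empty subsets. A $d$-dimensional complex is pure if every face is contained in a $d$-face; its $d$-faces are then called facets. A weak $d$-pseudomanifold is a $d$-dimensional pure complex in which each $(d-1)$-face is in exactly two facets. The link of a face $\sigma$ in $K$ is $\mathrm{lk}_K(\sigma)=\{\tau\in K:\tau\cap\sigma=\emptyset,\ \tau\cup\sigma\in K\}$. A normal $d$-pseudomanifold ($d\ge1$) is a connected weak $d$-pseudomanifold in which the links of all simplices of dimension $\le d-2$ are connected. A complex is neighbourly if every pair of its vertices forms an edge. Isomorphism ($\cong$) means a bijection of vertex sets preserving faces and non-faces. Bistellar moves on a weak $3$-pseudomanifold $M$: let $\alpha$ be a $(3-i)$-face of $M$, $i\in\{1,2\}$, such that $\mathrm{lk}_M(\alpha)$ consists of all non-empty proper subsets of a set $\beta$ with $|\beta|=i+1$ and $\beta$ is not a face of $M$. Then $\kappa_\alpha(M)$ is the weak $3$-pseudomanifold with facet set $\{\sigma:\sigma\text{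 a facet of }M,\ \alpha\not\subseteq\sigma\}\cup\{\beta\cup\alpha\setminus\{v\}:v\in\alpha\}$ (a bistellar $i$-move). A complex is identified with its set of facets, and $abcd$ denotes $\{a,b,c,d\}$ (similarly $ab$, $abc$). The complexes, all with vertex set $\{1,\dots,8\}$, are: $S^3_{8,35}=\{1234,1267,1256,1245,2345,2356,2367,3467,3456,4567,1238,1278,2378,1348,3478,1458,4578,1568,1678,5678\}$, $S^3_{8,36}=\{1234,1256,1245,1567,2345,2356,2367,3467,3456,4567,1268,1678,2678,1238,2378,1348,3478,1458,1578,4578\}$, $S^3_{8,37}=\{1234,1256,1245,1457,2345,2356,2367,3467,3456,4567,1568,1578,5678,1268,2678,1238,2378,1348,1478,3478\}$, $S^3_{8,38}=\{1234,1237,1267,1347,1567,2345,2367,3467,3456,4567,2358,2368,3568,1268,1568,1248,2458,1478,1578,4578\}$; $N_1=\{1248,1268,1348,1378,1568,1578,2358,2378,2458,2678,3468,3568,4578,4678,1247,1257,1367,1467,2347,2567,3457,3567,1236,2346,1345,1235,1456,2456\}$, $N_2=\{1248,2458,2358,3568,3468,4678,4578,1578,1568,1268,2678,2378,1378,1348,1247,2457,2357,3567,3467,1567,1267,1347\}$, $N_3=\{1248,1268,1348,1378,1568,1578,2358,2378,2458,2678,3468,3568,4578,4678,1234,2347,2456,2467,3456,3457,1235,1256,1357\}$, $N_4=\{1248,1268,1348,1378,1568,1578,2358,2378,2458,2678,3468,3568,4578,4678,1245,1256,2356,2367,3467,1347,1457\}$, $N_5=\{1258,1268,1358,1378,1468,1478,2368,2378,2458,2478,3458,3468,1257,1267,1367,1457,2357,2467,3457,3467,2356,2456,1356,1456\}$,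 $N_6=\{1358,1378,1468,1478,1568,2368,2378,2458,2478,2568,3458,3468,1235,1245,1457,1567,2357,2567,3457,1236,1246,1367,2467,3467\}$, $N_7=\{1268,1258,1358,1378,1478,1468,2378,2368,2458,2478,3468,3458,1356,1367,2357,2356,3467,3457,1256,1467,2457\}$, $N_8=\kappa_{348}(\kappa_{238}(\kappa_{56}(\kappa_{67}(N_7))))$, $N_9=\kappa_{235}(\kappa_{67}(N_7))$, $N_{10}=\kappa_{148}(\kappa_{67}(N_7))$, $N_{11}=\kappa_{348}(\kappa_{56}(N_{10}))$, $N_{12}=\kappa_{457}(\kappa_{23}(N_9))$, $N_{13}=\kappa_{567}(\kappa_{23}(N_9))$, $N_{14}=\kappa_{138}(\kappa_{57}(N_8))$, $N_{15}=\kappa_{158}(\kappa_{23}(N_9))$. *)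

theory Defs
  imports Main
begin

definition simplicial_complex :: "'a set set \<Rightarrow> bool" where
  "simplicial_complex K \<longleftrightarrow>
     finite K \<and> (\<forall>\<sigma>\<in>K. finite \<sigma> \<and> \<sigma> \<noteq> {}) \<and>
     (\<forall>\<sigma>\<in>K. \<forall>\<tau>. \<tau> \<noteq> {} \<and> \<tau> \<subseteq> \<sigma> \<longrightarrow> \<tau> \<in> K)"

definition vertices :: "'a set set \<Rightarrow> 'a set" where
  "vertices K = \<Union>K"

(* Integer-valued, so that expressions such as d - 2 are not truncated. *)
definition simplex_dim :: "'a set \<Rightarrow> int" where
  "simplex_dim \<sigma> = int (card \<sigma>) - 1"

definition faces_of_dim :: "'a set set \<Rightarrow> int \<Rightarrow> 'a set set" where
  "faces_of_dim K k = {\<sigma> \<in> K. simplex_dim \<sigma> = k}"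

definition pure_complex :: "nat \<Rightarrow> 'a set set \<Rightarrow> bool" where
  "pure_complex d K \<longleftrightarrow>
     simplicial_complex K \<and> K \<noteq> {} \<and> Max (simplex_dim ` K) = int d \<and>
     (\<forall>\<sigma>\<in>K. \<exists>\<tau>\<in>faces_of_dim K (int d). \<sigma> \<subseteq> \<tau>)"

definition weak_pseudomanifold :: "nat \<Rightarrow> 'a set set \<Rightarrow> bool" where
  "weak_pseudomanifold d K \<longleftrightarrow>
     pure_complex d K \<and>
     (\<forall>\<sigma>\<in>faces_of_dim K (int d - 1). card {\<tau> \<in> faces_of_dim K (int d). \<sigma> \<subseteq> \<tau>} = 2)"

definition link_of :: "'a set set \<Rightarrow> 'a set \<Rightarrow> 'a set set" where
  "link_of K \<sigma> = {\<tau> \<in> K. \<tau> \<inter> \<sigma> = {} \<and> \<tau> \<union> \<sigma> \<in> K}"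

(* A complex is connected if any two of its vertices are joined by an edge path. *)
definition connected_complex :: "'a set set \<Rightarrow> bool" where
  "connected_complex K \<longleftrightarrow>
     (\<forall>u\<in>vertices K. \<forall>v\<in>vertices K. (u, v) \<in> {(x, y). {x, y} \<in> K}\<^sup>*)"

definition normal_pseudomanifold :: "nat \<Rightarrow> 'a set set \<Rightarrow> bool" where
  "normal_pseudomanifold d K \<longleftrightarrow>
     1 \<le> d \<and> weak_pseudomanifold d K \<and> connected_complex K \<and>
     (\<forall>\<sigma>\<in>K. simplex_dim \<sigma> \<le> int d - 2 \<longrightarrow> connected_complex (link_of K \<sigma>))"

definition neighbourly :: "'a set set \<Rightarrow> bool" where
  "neighbourly K \<longleftrightarrow> (\<forall>u\<in>vertices K. \<forall>v\<in>vertices K. u \<noteq> v \<longrightarrow> {u, v} \<in> K)"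

definition iso_complex :: "'a set set \<Rightarrow> 'b set set \<Rightarrow> bool" where
  "iso_complex K L \<longleftrightarrow>
     (\<exists>f. bij_betw f (vertices K) (vertices L) \<and>
          (\<forall>\<sigma>. \<sigma> \<subseteq> vertices K \<longrightarrow> (\<sigma> \<in> K \<longleftrightarrow> f ` \<sigma> \<in> L)))"

(* The complex identified with the set F of its facets. *)
definition complex_of_facets :: "'a set set \<Rightarrow> 'a set set" where
  "complex_of_facets F = {\<sigma>. \<sigma> \<noteq> {} \<and> (\<exists>\<tau>\<in>F. \<sigma> \<subseteq> \<tau>)}"

definition bistellar_pair :: "'a set set \<Rightarrow> 'a set \<Rightarrow> 'a set \<Rightarrow> bool" where
  "bistellar_pair M \<alpha> \<beta> \<longleftrightarrow>
     (\<exists>i\<in>{1, 2 :: nat}. \<alpha> \<in> faces_of_dim M (3 - int i) \<and> card \<beta> = i + 1 \<and>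
        link_of M \<alpha> = {\<tau>. \<tau> \<noteq> {} \<and> \<tau> \<subset> \<beta>} \<and> \<beta> \<notin> M)"

(* The set \<beta> is determined by \<alpha>, being the vertex set of the link of \<alpha>.
   The value is meaningful only if some \<beta> with bistellar_pair M \<alpha> \<beta> exists,
   which is the case for every move used below. *)
definition kappa :: "'a set \<Rightarrow> 'a set set \<Rightarrow> 'a set set" where
  "kappa \<alpha> M =
     (let \<beta> = (THE \<beta>. bistellar_pair M \<alpha> \<beta>)
      in complex_of_facets
           ({\<sigma> \<in> faces_of_dim M 3. \<not> \<alpha> \<subseteq> \<sigma>} \<union> {(\<beta> \<union> \<alpha>) - {v} | v. v \<in> \<alpha>}))"

(* Simplices are written as numerals: digits 1248 = {1, 2, 4, 8}. *)
fun digits :: "nat \<Rightarrow> nat set" where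
  "digits n = (if n = 0 then {} else insert (n mod 10) (digits (n div 10)))"

declare digits.simps [simp del]

definition complex_of_list :: "nat list \<Rightarrow> nat set set" where
  "complex_of_list fs = complex_of_facets (digits ` set fs)"

abbreviation move :: "nat \<Rightarrow> nat set set \<Rightarrow> nat set set" where
  "move a M \<equiv> kappa (digits a) M"

definition S8_35 :: "nat set set" where
  "S8_35 = complex_of_list
     [1234, 1267, 1256, 1245, 2345, 2356, 2367, 3467, 3456, 4567, 1238,
      1278, 2378, 1348, 3478, 1458, 4578, 1568, 1678, 5678]"

definition S8_36 :: "nat set set" where
  "S8_36 = complex_of_list
     [1234, 1256, 1245, 1567, 2345, 2356, 2367, 3467, 3456, 4567, 1268,
      1678, 2678, 1238, 2378, 1348, 3478, 1458, 1578, 4578]"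

definition S8_37 :: "nat set set" where
  "S8_37 = complex_of_list
     [1234, 1256, 1245, 1457, 2345, 2356, 2367, 3467, 3456, 4567, 1568,
      1578, 5678, 1268, 2678, 1238, 2378, 1348, 1478, 3478]"

definition S8_38 :: "nat set set" where
  "S8_38 = complex_of_list
     [1234, 1237, 1267, 1347, 1567, 2345, 2367, 3467, 3456, 4567, 2358,
      2368, 3568, 1268, 1568, 1248, 2458, 1478, 1578, 4578]"

definition N8_1 :: "nat set set" where
  "N8_1 = complex_of_list
     [1248, 1268, 1348, 1378, 1568, 1578, 2358, 2378, 2458, 2678, 3468,
      3568, 4578, 4678, 1247, 1257, 1367, 1467, 2347, 2567, 3457,
      3567, 1236, 2346, 1345, 1235, 1456, 2456]"

definition N8_2 :: "nat set set" where
  "N8_2 = complex_of_list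
     [1248, 2458, 2358, 3568, 3468, 4678, 4578, 1578, 1568, 1268, 2678,
      2378, 1378, 1348, 1247, 2457, 2357, 3567, 3467, 1567, 1267, 1347]"

definition N8_3 :: "nat set set" where
  "N8_3 = complex_of_list
     [1248, 1268, 1348, 1378, 1568, 1578, 2358, 2378, 2458, 2678, 3468,
      3568, 4578, 4678, 1234, 2347, 2456, 2467, 3456, 3457, 1235,
      1256, 1357]"

definition N8_4 :: "nat set set" where
  "N8_4 = complex_of_list
     [1248, 1268, 1348, 1378, 1568, 1578, 2358, 2378, 2458, 2678, 3468,
      3568, 4578, 4678, 1245, 1256, 2356, 2367, 3467, 1347, 1457]"

definition N8_5 :: "nat set set" where
  "N8_5 = complex_of_list
     [1258, 1268, 1358, 1378, 1468, 1478, 2368, 2378, 2458, 2478, 3458,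
      3468, 1257, 1267, 1367, 1457, 2357, 2467, 3457, 3467, 2356,
      2456, 1356, 1456]"

definition N8_6 :: "nat set set" where
  "N8_6 = complex_of_list
     [1358, 1378, 1468, 1478, 1568, 2368, 2378, 2458, 2478, 2568, 3458,
      3468, 1235, 1245, 1457, 1567, 2357, 2567, 3457, 1236, 1246,
      1367, 2467, 3467]"

definition N8_7 :: "nat set set" where
  "N8_7 = complex_of_list
     [1268, 1258, 1358, 1378, 1478, 1468, 2378, 2368, 2458, 2478, 3468,
      3458, 1356, 1367, 2357, 2356, 3467, 3457, 1256, 1467, 2457]"

definition N8_8 :: "nat set set" where
  "N8_8 = move 348 (move 238 (move 56 (move 67 N8_7)))"

definition N8_9 :: "nat set set" where
  "N8_9 = move 235 (move 67 N8_7)"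

definition N8_10 :: "nat set set" where
  "N8_10 = move 148 (move 67 N8_7)"

definition N8_11 :: "nat set set" where
  "N8_11 = move 348 (move 56 N8_10)"

definition N8_12 :: "nat set set" where
  "N8_12 = move 457 (move 23 N8_9)"

definition N8_13 :: "nat set set" where
  "N8_13 = move 567 (move 23 N8_9)"

definition N8_14 :: "nat set set" where
  "N8_14 = move 138 (move 57 N8_8)"

definition N8_15 :: "nat set set" where
  "N8_15 = move 158 (move 23 N8_9)"

(* Indexed families; sphere8 is used for indices 35, ..., 38 and pseudo8 for 1, ..., 15. *)
definition sphere8 :: "nat \<Rightarrow> nat set set" where
  "sphere8 i = [S8_35, S8_36, S8_37, S8_38] ! (i - 35)"

definition pseudo8 :: "nat \<Rightarrow> nat set set" where
  "pseudo8 k =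
     [N8_1, N8_2, N8_3, N8_4, N8_5, N8_6, N8_7, N8_8, N8_9, N8_10,
      N8_11, N8_12, N8_13, N8_14, N8_15] ! (k - 1)"

end

theory Submission
  imports Defs
begin

text \<open>
  In a neighbourly normal 3-pseudomanifold on eight vertices the link of an edge is a single cycle,
  and every triangle lies in exactly two facets. Starting from one facet, such a complex is
  recovered by repeatedly choosing a triangle that lies in only one of the facets found so far and
  branching over the fourth vertex of its second facet. This search tree is small once partial
  complexes are identified up to relabelling: a partial complex that contains a relabelled copy of
  one that has already been dealt with needs no further work. The tree itself was found by an
  external search and is recorded as a certificate; the certificate checker is proved sound and is
  run by rewriting. The nineteen complexes are told apart by the number
  \<open>\<Sum>\<^sub>u (\<Sum>\<^sub>v deg(uv)\<^sup>3)\<^sup>2\<close>, where \<open>deg(uv)\<close> is the number of facets containing \<open>u\<close> and \<open>v\<close>.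
\<close>

section \<open>Local structure of normal 3-pseudomanifolds\<close>

text \<open>The unit of progress is a claim about a set of facets: every valid complex containing it
  is isomorphic to a model. Validity is stable under permutations of the eight vertices, so a
  settled claim settles all relabelled copies, which makes references sound. Apart from references
  to earlier patterns, a branch ends in one of three ways. It contains all facets of a model: then
  every vertex star is closed, and connectedness of the vertex and edge links leaves no room for
  further facets. It contains a closed vertex star whose link has at most six vertices: this is
  where neighbourliness excludes complexes. Or the link of an edge contains a closed triangle and a
  further vertex. The patterns are ordered by edge degree: once degree 6 and then degree 5 are
  settled, a later branch may stop as soon as such an edge appears, and with all degrees at most 4
  little remains.\<close>

lemma faces_of_dim_3: "faces_of_dim K 3 = {\<sigma> \<in> K. card \<sigma> = 4}"
  by (auto simp: faces_of_dim_def simplex_dim_def)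

lemma faces_of_dim_2: "faces_of_dim K 2 = {\<sigma> \<in> K. card \<sigma> = 3}"
  by (auto simp: faces_of_dim_def simplex_dim_def)

text \<open>The sets \<open>f - {v}\<close> with \<open>v \<noteq> x\<close> are the triangles of
  \<open>f\<close> through \<open>x\<close>, so for a set of tetrahedra this says that the link of
  \<open>x\<close> in them is a surface-like complex without boundary edges.\<close>

definition star_closed :: "'a \<Rightarrow> 'a set set \<Rightarrow> bool" where
  "star_closed x F \<longleftrightarrow>
     (\<forall>f\<in>F. x \<in> f \<longrightarrow> (\<forall>v\<in>f - {x}. \<exists>g\<in>F. g \<noteq> f \<and> f - {v} \<subseteq> g))"

locale normal3 =
  fixes M :: "'a set set"
  assumes normal: "normal_pseudomanifold 3 M"
begin

lemma complex: "simplicial_complex M"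
  using normal by (simp add: normal_pseudomanifold_def weak_pseudomanifold_def pure_complex_def)

lemma face_finite: "\<sigma> \<in> M \<Longrightarrow> finite \<sigma>"
  using complex by (simp add: simplicial_complex_def)

lemma face_nonempty: "\<sigma> \<in> M \<Longrightarrow> \<sigma> \<noteq> {}"
  using complex by (simp add: simplicial_complex_def)

lemma face_subset: "\<sigma> \<in> M \<Longrightarrow> \<tau> \<subseteq> \<sigma> \<Longrightarrow> \<tau> \<noteq> {} \<Longrightarrow> \<tau> \<in> M"
  using complex unfolding simplicial_complex_def by blast

lemma in_facet:
  assumes "\<sigma> \<in> M"
  obtains \<tau> where "\<tau> \<in> M" "card \<tau> = 4" "\<sigma> \<subseteq> \<tau>"
proof -
  have "\<forall>\<sigma>\<in>M. \<exists>\<tau>\<in>faces_of_dim M (int 3). \<sigma> \<subseteq> \<tau>"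
    using normal by (simp add: normal_pseudomanifold_def weak_pseudomanifold_def pure_complex_def)
  then show ?thesis using assms that by (auto simp: faces_of_dim_3)
qed

lemma two_facets:
  assumes "\<rho> \<in> M" "card \<rho> = 3"
  shows "card {\<tau> \<in> M. card \<tau> = 4 \<and> \<rho> \<subseteq> \<tau>} = 2"
proof -
  have "\<forall>\<sigma>\<in>faces_of_dim M (int 3 - 1). card {\<tau> \<in> faces_of_dim M (int 3). \<sigma> \<subseteq> \<tau>} = 2"
    using normal by (simp add: normal_pseudomanifold_def weak_pseudomanifold_def)
  then have "card {\<tau> \<in> faces_of_dim M 3. \<rho> \<subseteq> \<tau>} = 2"
    using assms by (simp add: faces_of_dim_2)
  then show ?thesis by (simp add: faces_of_dim_3 conj_assoc)
qed

lemma link_connected: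
  assumes "\<sigma> \<in> M" "card \<sigma> \<le> 2"
  shows "connected_complex (link_of M \<sigma>)"
  using normal assms by (simp add: normal_pseudomanifold_def simplex_dim_def)

text \<open>Connectedness of a link supplies only a path of vertices. It is used in this form: a set
  of link vertices that no link edge leaves is everything. The assumption \<open>closed\<close>
  covers \<open>x = y\<close> too, because the path relation in \<open>connected_complex\<close>
  relates a vertex to itself.\<close>

lemma link_subset_closed:
  assumes \<sigma>: "\<sigma> \<in> M" "card \<sigma> \<le> 2"
    and s: "s \<in> S" "s \<notin> \<sigma>" "insert s \<sigma> \<in> M"
    and closed: "\<And>x y. x \<in> S \<Longrightarrow> x \<notin> \<sigma> \<Longrightarrow> y \<notin> \<sigma> \<Longrightarrow> insert x (insert y \<sigma>) \<in> M \<Longrightarrow> y \<in> S"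
    and z: "z \<notin> \<sigma>" "insert z \<sigma> \<in> M"
  shows "z \<in> S"
proof -
  have link_vertex: "v \<in> vertices (link_of M \<sigma>)" if "v \<notin> \<sigma>" "insert v \<sigma> \<in> M" for v
  proof -
    have "{v} \<in> M" using that(2) by (rule face_subset) auto
    then have "{v} \<in> link_of M \<sigma>" using that by (simp add: link_of_def)
    then show ?thesis by (auto simp: vertices_def)
  qed
  have "(s, z) \<in> {(x, y). {x, y} \<in> link_of M \<sigma>}\<^sup>*"
    using link_connected[OF \<sigma>] link_vertex[OF s(2,3)] link_vertex[OF z]
    by (simp add: connected_complex_def)
  then show ?thesis
  proof (induction rule: rtrancl_induct)
    case base
    then show ?case using s by simp
  next
    case (step x y)
    then have "{x, y} \<in> link_of M \<sigma>" by simp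
    then have "x \<notin> \<sigma>" "y \<notin> \<sigma>" "insert x (insert y \<sigma>) \<in> M"
      by (auto simp: link_of_def)
    then show ?case using closed step.IH by blast
  qed
qed

lemma third_facet:
  assumes x: "insert x \<rho> \<in> M" "x \<notin> \<rho>" and y: "insert y \<rho> \<in> M" "y \<notin> \<rho>" and "x \<noteq> y"
    and z: "insert z \<rho> \<in> M" "z \<notin> \<rho>" and \<rho>: "card \<rho> = 3"
  shows "z = x \<or> z = y"
proof (rule ccontr)
  assume "\<not> (z = x \<or> z = y)"
  have "\<rho> \<in> M" using \<rho> by (intro face_subset[OF x(1)]) auto
  have "finite \<rho>" using \<rho> by (metis card.infinite zero_neq_numeral)
  let ?T = "{\<tau> \<in> M. card \<tau> = 4 \<and> \<rho> \<subseteq> \<tau>}"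
  have two: "card ?T = 2" using two_facets[OF \<open>\<rho> \<in> M\<close> \<rho>] .
  have "insert x \<rho> \<noteq> insert y \<rho>" "insert x \<rho> \<noteq> insert z \<rho>" "insert y \<rho> \<noteq> insert z \<rho>"
    using assms(2,4,5,7) \<open>\<not> (z = x \<or> z = y)\<close>
    by (metis insertE insertI1)+
  then have "card {insert x \<rho>, insert y \<rho>, insert z \<rho>} = 3" by simp
  moreover have "{insert x \<rho>, insert y \<rho>, insert z \<rho>} \<subseteq> ?T"
    using x y z \<rho> \<open>finite \<rho>\<close> by (simp add: subset_insertI)
  moreover have "finite ?T" by (intro card_ge_0_finite) (simp add: two)
  ultimately have "3 \<le> card ?T" by (metis (no_types, lifting) card_mono)
  then show False using two by simp
qed

lemma second_facet:
  assumes "insert x \<rho> \<in> M" "x \<notin> \<rho>" and \<rho>: "card \<rho> = 3"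
  obtains y where "y \<noteq> x" "y \<notin> \<rho>" "insert y \<rho> \<in> M"
proof -
  have "\<rho> \<in> M" using \<rho> by (intro face_subset[OF assms(1)]) auto
  have fin: "finite \<rho>" using \<rho> by (metis card.infinite zero_neq_numeral)
  let ?T = "{\<tau> \<in> M. card \<tau> = 4 \<and> \<rho> \<subseteq> \<tau>}"
  have "card ?T = 2" using two_facets[OF \<open>\<rho> \<in> M\<close> \<rho>] .
  moreover have "insert x \<rho> \<in> ?T" using assms fin by auto
  ultimately obtain \<tau> where \<tau>: "\<tau> \<in> ?T" "\<tau> \<noteq> insert x \<rho>"
    by (metis (no_types, lifting) card_2_iff insertE singletonD singletonI insertI1 insertI2)
  then have "card (\<tau> - \<rho>) = 1" using \<rho> fin by (simp add: card_Diff_subset)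
  then obtain y where "\<tau> - \<rho> = {y}" by (auto simp: card_1_singleton_iff)
  then have "\<tau> = insert y \<rho>" "y \<notin> \<rho>" using \<tau> by auto
  then have "y \<noteq> x" "insert y \<rho> \<in> M" using \<tau> by blast+
  then show ?thesis using that \<open>y \<notin> \<rho>\<close> by blast
qed

text \<open>Every vertex of \<open>S\<close> already has two neighbours inside \<open>S\<close>, and
  a third neighbour would put three facets on one triangle. So no edge of the link leaves
  \<open>S\<close>; applied to a cycle, this makes the cycle the whole link of
  \<open>uv\<close>.\<close>

lemma edge_link_subset_closed:
  assumes "u \<noteq> v" and S: "S \<noteq> {}" "u \<notin> S" "v \<notin> S"
    and two: "\<And>s. s \<in> S \<Longrightarrow> \<exists>x\<in>S. \<exists>y\<in>S. x \<noteq> y \<and> x \<noteq> s \<and> y \<noteq> s \<and> {u, v, s, x} \<in> M \<and> {u, v, s, y} \<in> M"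
    and z: "z \<noteq> u" "z \<noteq> v" "{u, v, z} \<in> M"
  shows "z \<in> S"
proof -
  obtain s where s: "s \<in> S" using S by blast
  obtain x where x: "{u, v, s, x} \<in> M" using two[OF s] by blast
  have "{u, v} \<in> M" by (rule face_subset[OF x]) auto
  moreover have "insert s {u, v} \<in> M" by (rule face_subset[OF x]) auto
  moreover have "s \<notin> {u, v}" using s S by auto
  moreover have "insert z {u, v} \<in> M" using z by (simp add: insert_commute)
  moreover have "z \<notin> {u, v}" using z by auto
  moreover have "y \<in> S" if ay: "a \<in> S" "y \<notin> {u, v}" "insert a (insert y {u, v}) \<in> M" for a y
  proof (cases "y = a")
    case False
    obtain p q where pq: "p \<in> S" "q \<in> S" "p \<noteq> q" "p \<noteq> a" "q \<noteq> a"
      "{u, v, a, p} \<in> M" "{u, v, a, q} \<in> M"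
      using two[OF ay(1)] by blast
    have "y = p \<or> y = q"
    proof (rule third_facet)
      show "insert p {u, v, a} \<in> M" "insert q {u, v, a} \<in> M" "insert y {u, v, a} \<in> M"
        using pq ay by (simp_all add: insert_commute)
      show "p \<notin> {u, v, a}" "q \<notin> {u, v, a}" "y \<notin> {u, v, a}" "p \<noteq> q"
        using pq ay False S by auto
      have "a \<noteq> u" "a \<noteq> v" using ay S by auto
      then show "card {u, v, a} = 3" using \<open>u \<noteq> v\<close> by simp
    qed
    then show ?thesis using pq by blast
  qed (use ay in simp)
  ultimately show ?thesis
    using link_subset_closed[of "{u, v}" s S z] s by (simp add: card_insert_if)
qed

text \<open>Closedness at \<open>x\<close> already places two facets of \<open>F\<close> over
  \<rho>, which is as many as \<open>M\<close> has there.\<close>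

lemma star_closed_facet:
  assumes F: "F \<subseteq> M" "\<And>f. f \<in> F \<Longrightarrow> card f = 4" and closed: "star_closed x F"
    and f: "f \<in> F" "x \<in> f" "\<rho> \<subseteq> f" "x \<in> \<rho>" "card \<rho> = 3"
    and \<tau>: "insert y \<rho> \<in> M" "y \<notin> \<rho>"
  shows "insert y \<rho> \<in> F"
proof -
  have complete: "\<exists>p. p \<notin> \<rho> \<and> g = insert p \<rho>" if "g \<in> F" "\<rho> \<subseteq> g" for g
  proof -
    have "finite \<rho>" using f(5) by (metis card.infinite zero_neq_numeral)
    then have "card (g - \<rho>) = 1" using F(2) that f by (simp add: card_Diff_subset)
    then obtain p where "g - \<rho> = {p}" by (auto simp: card_1_singleton_iff)
    then show ?thesis using that by blast
  qed
  obtain p where p: "p \<notin> \<rho>" "f = insert p \<rho>" using complete[OF f(1,3)] by blast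
  then have "p \<in> f - {x}" "f - {p} = \<rho>" using f by auto
  then obtain g where g: "g \<in> F" "g \<noteq> f" "\<rho> \<subseteq> g"
    using closed f unfolding star_closed_def by metis
  obtain q where q: "q \<notin> \<rho>" "g = insert q \<rho>" using complete[OF g(1,3)] by blast
  have "insert p \<rho> \<in> M" "insert q \<rho> \<in> M" using F(1) f(1) g(1) p(2) q(2) by blast+
  moreover have "p \<noteq> q" using g(2) p(2) q(2) by blast
  ultimately have "y = p \<or> y = q" using third_facet[of p \<rho> q y, OF _ p(1) _ q(1) _ \<tau> f(5)] by blast
  then show ?thesis using p(2) q(2) f(1) g(1) by blast
qed

text \<open>Connected links give paths of vertices and not chains of adjacent facets, so the star is
  filled in two stages. Connectedness of the link of an edge \<open>xa\<close> shows that
  \<open>F\<close> contains all facets at \<open>xa\<close> as soon as it contains one.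
  Connectedness of the link of \<open>x\<close> then carries this from one neighbour
  \<open>a\<close> to all of them.\<close>

lemma star_closed_all:
  assumes F: "F \<subseteq> M" "\<And>f. f \<in> F \<Longrightarrow> card f = 4" and closed: "star_closed x F"
    and f0: "f0 \<in> F" "x \<in> f0" and \<tau>: "\<tau> \<in> M" "card \<tau> = 4" "x \<in> \<tau>"
  shows "\<tau> \<in> F"
proof -
  have edge: "\<tau> \<in> F" if f: "f \<in> F" "x \<in> f" "a \<in> f" "a \<noteq> x" and \<tau>: "\<tau> \<in> M" "card \<tau> = 4" "x \<in> \<tau>" "a \<in> \<tau>"
    for a f \<tau>
  proof -
    define S where "S = {s. s \<notin> {x, a} \<and> (\<exists>f\<in>F. {x, a, s} \<subseteq> f)}"
    have xa: "{x, a} \<in> M" by (rule face_subset[of f]) (use f F in auto)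
    have step: "insert y {x, a, s} \<in> F" if "s \<in> S" "y \<notin> {x, a, s}" "insert y {x, a, s} \<in> M" for s y
    proof -
      obtain g where g: "g \<in> F" "{x, a, s} \<subseteq> g" using \<open>s \<in> S\<close> by (auto simp: S_def)
      have "card {x, a, s} = 3" using \<open>s \<in> S\<close> f(4) by (auto simp: S_def)
      then show ?thesis using star_closed_facet[OF F closed g(1) _ g(2)] g that by auto
    qed
    have "\<exists>s. s \<in> f \<and> s \<notin> {x, a}"
    proof (rule ccontr)
      assume "\<not> ?thesis"
      then have "f \<subseteq> {x, a}" by blast
      then have "card f \<le> 2" by (metis card_2_iff card_mono f(4) finite.emptyI finite_insert)
      then show False using F(2) f(1) by simp
    qed
    then obtain s where s: "s \<in> f" "s \<notin> {x, a}" by blast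
    have "s \<in> S" using s f by (auto simp: S_def)
    have sM: "insert s {x, a} \<in> M" by (rule face_subset[of f]) (use f F s in auto)
    have "card (\<tau> - {x, a}) = 2" using \<tau> f(4) by (simp add: card_Diff_subset)
    then obtain z w where zw: "\<tau> - {x, a} = {z, w}" "z \<noteq> w" by (auto simp: card_2_iff)
    then have \<tau>eq: "\<tau> = {x, a, z, w}" using \<tau> by auto
    have zM: "insert z {x, a} \<in> M" by (rule face_subset[OF \<tau>(1)]) (auto simp: \<tau>eq)
    have "z \<in> S"
    proof (rule link_subset_closed[OF xa _ \<open>s \<in> S\<close> s(2) sM _ _ zM])
      show "card {x, a} \<le> 2" by (simp add: card_insert_if)
      show "z \<notin> {x, a}" using zw by auto
      fix b y assume b: "b \<in> S" "b \<notin> {x, a}" "y \<notin> {x, a}" "insert b (insert y {x, a}) \<in> M"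
      show "y \<in> S"
      proof (cases "y = b")
        case False
        then have "insert y {x, a, b} \<in> F"
          using step[of b y] b by (auto simp: insert_commute)
        then have "\<exists>f\<in>F. {x, a, y} \<subseteq> f" by (rule bexI[rotated]) simp
        then show ?thesis using b(3) by (simp add: S_def)
      next
        case True
        then show ?thesis using b(1) by simp
      qed
    qed
    moreover have "w \<notin> {x, a, z}" using zw by blast
    moreover have "insert w {x, a, z} = \<tau>" using \<tau>eq by blast
    ultimately show ?thesis using step[of z w] \<tau>(1) by simp
  qed
  have other: "\<exists>a. a \<in> f \<and> a \<noteq> x" if "card f = 4" for f :: "'a set"
  proof (rule ccontr)
    assume "\<not> ?thesis"
    then have "f \<subseteq> {x}" by blast
    then have "card f \<le> 1" by (metis card.empty card_insert_disjoint card_mono empty_iff finite.emptyI finite_insert One_nat_def)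
    then show False using that by simp
  qed
  define S where "S = {a. a \<noteq> x \<and> (\<exists>f\<in>F. x \<in> f \<and> a \<in> f)}"
  obtain a where a: "a \<in> f0" "a \<noteq> x" using other F(2) f0 by blast
  obtain z where z: "z \<in> \<tau>" "z \<noteq> x" using other \<tau> by blast
  have "z \<in> S"
  proof (rule link_subset_closed[of "{x}" a S z])
    show "{x} \<in> M" "insert a {x} \<in> M" by (rule face_subset[of f0]; use f0 F a in auto)+
    show "insert z {x} \<in> M" by (rule face_subset[of \<tau>]) (use \<tau> z in auto)
    show "a \<in> S" using a f0 by (auto simp: S_def)
    fix b y assume b: "b \<in> S" "b \<notin> {x}" "y \<notin> {x}" "insert b (insert y {x}) \<in> M"
    obtain \<tau>' where \<tau>': "\<tau>' \<in> M" "card \<tau>' = 4" "insert b (insert y {x}) \<subseteq> \<tau>'"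
      using in_facet[OF b(4)] .
    obtain f where "f \<in> F" "x \<in> f" "b \<in> f" using b(1) unfolding S_def by blast
    then have "\<tau>' \<in> F" using edge[of f b \<tau>'] b(2) \<tau>' by blast
    then show "y \<in> S" using \<tau>'(3) b(3) unfolding S_def by blast
  qed (use a z in auto)
  then show ?thesis using edge z \<tau> unfolding S_def by blast
qed

end

section \<open>Relabelling of complexes\<close>

lemma simplicial_complex_image:
  assumes "simplicial_complex K"
  shows "simplicial_complex ((`) f ` K)"
  unfolding simplicial_complex_def
proof (intro conjI ballI allI impI)
  show "finite ((`) f ` K)" using assms by (simp add: simplicial_complex_def)
next
  fix \<sigma> assume "\<sigma> \<in> (`) f ` K"
  then show "finite \<sigma>" "\<sigma> \<noteq> {}" using assms by (auto simp: simplicial_complex_def)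
next
  fix \<sigma> \<tau> assume "\<sigma> \<in> (`) f ` K" and \<tau>: "\<tau> \<noteq> {} \<and> \<tau> \<subseteq> \<sigma>"
  then obtain \<rho> where \<rho>: "\<rho> \<in> K" "\<sigma> = f ` \<rho>" by blast
  then obtain \<theta> where \<theta>: "\<theta> \<subseteq> \<rho>" "\<tau> = f ` \<theta>" using \<tau> by (meson subset_image_iff)
  then have "\<theta> \<in> K" using assms \<rho>(1) \<tau> unfolding simplicial_complex_def by blast
  then show "\<tau> \<in> (`) f ` K" using \<theta> by blast
qed

lemma vertices_image: "vertices ((`) f ` K) = f ` vertices K"
  by (auto simp: vertices_def)

lemma connected_complex_image:
  assumes "connected_complex K"
  shows "connected_complex ((`) f ` K)"
proof -
  have "(f u, f v) \<in> {(x, y). {x, y} \<in> (`) f ` K}\<^sup>*" if "(u, v) \<in> {(x, y). {x, y} \<in> K}\<^sup>*" for u v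
    using that
  proof (induction rule: rtrancl_induct)
    case (step y z)
    then have "f ` {y, z} \<in> (`) f ` K" by blast
    then have "(f y, f z) \<in> {(x, y). {x, y} \<in> (`) f ` K}" by simp
    then show ?case using step.IH by (rule rtrancl_into_rtrancl[rotated])
  qed simp
  then show ?thesis using assms by (auto simp: connected_complex_def vertices_image)
qed

text \<open>Source and target types differ because three kinds of vertices meet: those of an
  arbitrary \<open>M\<close>, the eight constructors on which the search runs, and the numbers in
  the given complexes.\<close>

context
  fixes f :: "'a \<Rightarrow> 'b" and K :: "'a set set"
  assumes inj: "inj_on f (vertices K)"
begin

lemma image_subset_face_iff:
  assumes "\<sigma> \<in> K" "\<tau> \<in> K"
  shows "f ` \<sigma> \<subseteq> f ` \<tau> \<longleftrightarrow> \<sigma> \<subseteq> \<tau>"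
proof -
  have "\<sigma> \<subseteq> vertices K" "\<tau> \<subseteq> vertices K" using assms by (auto simp: vertices_def)
  then show ?thesis using inj_on_image_mem_iff[OF inj, of _ \<tau>] by blast
qed

lemma inj_on_face_image: "inj_on ((`) f) K"
  by (rule inj_onI) (metis image_subset_face_iff subset_antisym order_refl)

lemma simplex_dim_image: "\<sigma> \<in> K \<Longrightarrow> simplex_dim (f ` \<sigma>) = simplex_dim \<sigma>"
  using inj_on_subset[OF inj, of \<sigma>] by (simp add: simplex_dim_def card_image vertices_def Union_upper)

lemma faces_of_dim_image: "faces_of_dim ((`) f ` K) k = (`) f ` faces_of_dim K k"
  by (auto simp: faces_of_dim_def simplex_dim_image)

lemma link_of_image:
  assumes "simplicial_complex K" and \<sigma>: "\<sigma> \<in> K"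
  shows "link_of ((`) f ` K) (f ` \<sigma>) = (`) f ` link_of K \<sigma>"
proof -
  have V: "\<rho> \<subseteq> vertices K" if "\<rho> \<in> K" for \<rho> using that by (auto simp: vertices_def)
  have disjoint: "f ` \<tau> \<inter> f ` \<sigma> = {} \<longleftrightarrow> \<tau> \<inter> \<sigma> = {}" if "\<tau> \<in> K" for \<tau>
    using inj_on_image_Int[OF inj V[OF that] V[OF \<sigma>]] by (metis image_is_empty)
  have union: "f ` \<tau> \<union> f ` \<sigma> \<in> (`) f ` K \<longleftrightarrow> \<tau> \<union> \<sigma> \<in> K" if "\<tau> \<in> K" for \<tau>
  proof
    assume "f ` \<tau> \<union> f ` \<sigma> \<in> (`) f ` K"
    then obtain \<rho> where \<rho>: "\<rho> \<in> K" "f ` (\<tau> \<union> \<sigma>) = f ` \<rho>" by (auto simp: image_Un)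
    then have "\<tau> \<union> \<sigma> = \<rho>"
      using inj_on_image_eq_iff[OF inj, of "\<tau> \<union> \<sigma>" \<rho>] V that \<sigma> by blast
    then show "\<tau> \<union> \<sigma> \<in> K" using \<rho> by simp
  next
    assume "\<tau> \<union> \<sigma> \<in> K"
    then show "f ` \<tau> \<union> f ` \<sigma> \<in> (`) f ` K" by (metis image_Un imageI)
  qed
  have collect: "{y \<in> g ` A. P y} = g ` {x \<in> A. P (g x)}"
    for g :: "'a set \<Rightarrow> 'b set" and A P by blast
  have "link_of ((`) f ` K) (f ` \<sigma>) =
      (`) f ` {\<tau> \<in> K. f ` \<tau> \<inter> f ` \<sigma> = {} \<and> f ` \<tau> \<union> f ` \<sigma> \<in> (`) f ` K}"
    unfolding link_of_def by (rule collect)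
  also have "{\<tau> \<in> K. f ` \<tau> \<inter> f ` \<sigma> = {} \<and> f ` \<tau> \<union> f ` \<sigma> \<in> (`) f ` K} = link_of K \<sigma>"
    unfolding link_of_def by (intro Collect_cong conj_cong refl) (simp_all add: disjoint union)
  finally show ?thesis .
qed

lemma normal_pseudomanifold_image:
  assumes "normal_pseudomanifold d K"
  shows "normal_pseudomanifold d ((`) f ` K)"
proof -
  have wpm: "weak_pseudomanifold d K" and pure: "pure_complex d K" and sc: "simplicial_complex K"
    using assms by (auto simp: normal_pseudomanifold_def weak_pseudomanifold_def pure_complex_def)
  have dims: "simplex_dim ` (`) f ` K = simplex_dim ` K"
    by (simp add: image_image simplex_dim_image cong: image_cong_simp)
  have "pure_complex d ((`) f ` K)"
    unfolding pure_complex_def dims faces_of_dim_image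
  proof (intro conjI ballI)
    show "simplicial_complex ((`) f ` K)" using sc by (rule simplicial_complex_image)
    show "(`) f ` K \<noteq> {}" "Max (simplex_dim ` K) = int d"
      using pure by (simp_all add: pure_complex_def)
    fix \<sigma> assume "\<sigma> \<in> (`) f ` K"
    then obtain \<rho> where \<rho>: "\<rho> \<in> K" "\<sigma> = f ` \<rho>" by blast
    then obtain \<tau> where "\<tau> \<in> faces_of_dim K (int d)" "\<rho> \<subseteq> \<tau>"
      using pure unfolding pure_complex_def by blast
    then show "\<exists>\<tau>\<in>(`) f ` faces_of_dim K (int d). \<sigma> \<subseteq> \<tau>" using \<rho> by blast
  qed
  moreover have "card {\<tau> \<in> (`) f ` faces_of_dim K (int d). f ` \<sigma> \<subseteq> \<tau>} = 2"
    if \<sigma>: "\<sigma> \<in> faces_of_dim K (int d - 1)" for \<sigma>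
  proof -
    have "{\<tau> \<in> (`) f ` faces_of_dim K (int d). f ` \<sigma> \<subseteq> \<tau>} =
        (`) f ` {\<tau> \<in> faces_of_dim K (int d). \<sigma> \<subseteq> \<tau>}"
      using \<sigma> image_subset_face_iff by (auto simp: faces_of_dim_def)
    moreover have "inj_on ((`) f) {\<tau> \<in> faces_of_dim K (int d). \<sigma> \<subseteq> \<tau>}"
      by (rule inj_on_subset[OF inj_on_face_image]) (auto simp: faces_of_dim_def)
    ultimately show ?thesis using wpm \<sigma> by (simp add: card_image weak_pseudomanifold_def)
  qed
  moreover have "connected_complex (link_of ((`) f ` K) (f ` \<sigma>))"
    if "\<sigma> \<in> K" "simplex_dim (f ` \<sigma>) \<le> int d - 2" for \<sigma>
    using assms that sc
    by (simp add: link_of_image connected_complex_image simplex_dim_image normal_pseudomanifold_def)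
  ultimately show ?thesis
    using assms by (auto simp: normal_pseudomanifold_def weak_pseudomanifold_def
        faces_of_dim_image connected_complex_image)
qed

lemma iso_complex_image: "iso_complex K ((`) f ` K)"
proof -
  have "\<sigma> \<in> K \<longleftrightarrow> f ` \<sigma> \<in> (`) f ` K" if "\<sigma> \<subseteq> vertices K" for \<sigma>
  proof
    assume "f ` \<sigma> \<in> (`) f ` K"
    then obtain \<rho> where "\<rho> \<in> K" "f ` \<sigma> = f ` \<rho>" by blast
    moreover from this have "\<sigma> = \<rho>"
      using inj_on_image_eq_iff[OF inj that, of \<rho>] by (auto simp: vertices_def)
    ultimately show "\<sigma> \<in> K" by simp
  qed simp
  then show ?thesis
    unfolding iso_complex_def using inj by (intro exI[of _ f]) (auto simp: bij_betw_def vertices_image)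
qed

end

lemma neighbourly_image:
  assumes "neighbourly K"
  shows "neighbourly ((`) f ` K)"
  unfolding neighbourly_def vertices_image
proof (intro ballI impI)
  fix x y assume "x \<in> f ` vertices K" "y \<in> f ` vertices K" "x \<noteq> y"
  then obtain u v where "u \<in> vertices K" "v \<in> vertices K" "u \<noteq> v" "x = f u" "y = f v" by blast
  then have "{u, v} \<in> K" "{x, y} = f ` {u, v}" using assms by (auto simp: neighbourly_def)
  then show "{x, y} \<in> (`) f ` K" by blast
qed

lemma iso_complex_trans:
  assumes "iso_complex K L" "iso_complex L P"
  shows "iso_complex K P"
proof -
  obtain f where f: "bij_betw f (vertices K) (vertices L)"
    "\<And>\<sigma>. \<sigma> \<subseteq> vertices K \<Longrightarrow> \<sigma> \<in> K \<longleftrightarrow> f ` \<sigma> \<in> L"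
    using assms(1) by (auto simp: iso_complex_def)
  obtain g where g: "bij_betw g (vertices L) (vertices P)"
    "\<And>\<sigma>. \<sigma> \<subseteq> vertices L \<Longrightarrow> \<sigma> \<in> L \<longleftrightarrow> g ` \<sigma> \<in> P"
    using assms(2) by (auto simp: iso_complex_def)
  have "\<sigma> \<in> K \<longleftrightarrow> (g \<circ> f) ` \<sigma> \<in> P" if "\<sigma> \<subseteq> vertices K" for \<sigma>
  proof -
    have "f ` \<sigma> \<subseteq> vertices L" using that f(1) by (auto simp: bij_betw_def)
    then show ?thesis using f(2)[OF that] g(2) by (simp add: image_comp)
  qed
  then show ?thesis
    unfolding iso_complex_def using bij_betw_trans[OF f(1) g(1)] by (intro exI[of _ "g \<circ> f"]) simp
qed

text \<open>Converse of \<open>iso_complex_image\<close>: a face of \<open>L\<close> is the image of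
  some set of vertices of \<open>K\<close>, and the condition on non-faces forces that set to be a
  face.\<close>

lemma iso_complex_eq_image:
  assumes "iso_complex K L"
  obtains f where "inj_on f (vertices K)" "L = (`) f ` K"
proof -
  obtain f where f: "bij_betw f (vertices K) (vertices L)"
    and faces: "\<And>\<sigma>. \<sigma> \<subseteq> vertices K \<Longrightarrow> \<sigma> \<in> K \<longleftrightarrow> f ` \<sigma> \<in> L"
    using assms by (auto simp: iso_complex_def)
  have "\<tau> \<in> (`) f ` K" if "\<tau> \<in> L" for \<tau>
  proof -
    have "\<tau> \<subseteq> f ` vertices K" using that f by (auto simp: bij_betw_def vertices_def)
    then obtain \<sigma> where "\<sigma> \<subseteq> vertices K" "\<tau> = f ` \<sigma>" by (meson subset_image_iff)
    then show ?thesis using faces that by blast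
  qed
  moreover have "f ` \<sigma> \<in> L" if "\<sigma> \<in> K" for \<sigma>
    using faces[of \<sigma>] that by (auto simp: vertices_def)
  ultimately have "L = (`) f ` K" by blast
  then show ?thesis using that bij_betw_imp_inj_on[OF f] by blast
qed

text \<open>The term \<open>v = u\<close> contributes the cube of the number of facets at
  \<open>u\<close>. A nonlinear power is essential: with first powers the inner sum for a pure
  3-dimensional complex would be four times that number, whatever the distribution of these facets
  over the edges at \<open>u\<close>.\<close>

definition degree_invariant :: "'a set set \<Rightarrow> int" where
  "degree_invariant K =
     (\<Sum>u\<in>vertices K. (\<Sum>v\<in>vertices K. int (card {\<sigma> \<in> faces_of_dim K 3. {u, v} \<subseteq> \<sigma>}) ^ 3) ^ 2)"

lemma degree_invariant_iso:
  assumes "iso_complex K L"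
  shows "degree_invariant L = degree_invariant K"
proof -
  obtain f where inj: "inj_on f (vertices K)" and L: "L = (`) f ` K"
    using assms by (rule iso_complex_eq_image)
  have "card {\<sigma> \<in> faces_of_dim L 3. {f u, f v} \<subseteq> \<sigma>} = card {\<sigma> \<in> faces_of_dim K 3. {u, v} \<subseteq> \<sigma>}"
    if uv: "u \<in> vertices K" "v \<in> vertices K" for u v
  proof -
    have "f w \<in> f ` \<sigma> \<longleftrightarrow> w \<in> \<sigma>" if "\<sigma> \<in> K" "w \<in> vertices K" for w \<sigma>
      using inj_on_image_mem_iff[OF inj that(2), of \<sigma>] that by (auto simp: vertices_def)
    then have "{\<sigma> \<in> faces_of_dim L 3. {f u, f v} \<subseteq> \<sigma>} =
        (`) f ` {\<sigma> \<in> faces_of_dim K 3. {u, v} \<subseteq> \<sigma>}"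
      using uv unfolding L faces_of_dim_image[OF inj] by (auto simp: faces_of_dim_def)
    moreover have "inj_on ((`) f) {\<sigma> \<in> faces_of_dim K 3. {u, v} \<subseteq> \<sigma>}"
      by (rule inj_on_subset[OF inj_on_face_image[OF inj]]) (auto simp: faces_of_dim_def)
    ultimately show ?thesis by (simp add: card_image)
  qed
  then show ?thesis
    unfolding degree_invariant_def
    using inj by (simp add: L vertices_image sum.reindex cong: sum.cong)
qed

section \<open>A certificate checker for the search\<close>

datatype vertex = V1 | V2 | V3 | V4 | V5 | V6 | V7 | V8

text \<open>Sets of vertices are encoded as bit vectors, so that rewriting handles them in few steps.\<close>

datatype mask = Mask bool bool bool bool bool bool bool bool

fun add :: "vertex \<Rightarrow> mask \<Rightarrow> mask" where
  "add V1 (Mask a b c d e f g h) = Mask True b c d e f g h"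
| "add V2 (Mask a b c d e f g h) = Mask a True c d e f g h"
| "add V3 (Mask a b c d e f g h) = Mask a b True d e f g h"
| "add V4 (Mask a b c d e f g h) = Mask a b c True e f g h"
| "add V5 (Mask a b c d e f g h) = Mask a b c d True f g h"
| "add V6 (Mask a b c d e f g h) = Mask a b c d e True g h"
| "add V7 (Mask a b c d e f g h) = Mask a b c d e f True h"
| "add V8 (Mask a b c d e f g h) = Mask a b c d e f g True"

fun mask_list :: "vertex list \<Rightarrow> mask" where
  "mask_list [] = Mask False False False False False False False False"
| "mask_list (v # vs) = add v (mask_list vs)"

fun key :: "mask \<Rightarrow> bool list" where
  "key (Mask a b c d e f g h) = [a, b, c, d, e, f, g, h]"

section \<open>Binary tries for sets of masks\<close>

datatype trie = Empty | Full | Node trie trie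

fun lookup :: "trie \<Rightarrow> bool list \<Rightarrow> bool" where
  "lookup Empty bs = False"
| "lookup Full bs = True"
| "lookup (Node l r) [] = False"
| "lookup (Node l r) (False # bs) = lookup l bs"
| "lookup (Node l r) (True # bs) = lookup r bs"

fun insert_key :: "bool list \<Rightarrow> trie \<Rightarrow> trie" where
  "insert_key [] t = Full"
| "insert_key (b # bs) Full = Full"
| "insert_key (False # bs) Empty = Node (insert_key bs Empty) Empty"
| "insert_key (True # bs) Empty = Node Empty (insert_key bs Empty)"
| "insert_key (False # bs) (Node l r) = Node (insert_key bs l) r"
| "insert_key (True # bs) (Node l r) = Node l (insert_key bs r)"

definition has :: "trie \<Rightarrow> mask \<Rightarrow> bool" where
  "has t m = lookup t (key m)"

definition put :: "mask \<Rightarrow> trie \<Rightarrow> trie" where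
  "put m t = insert_key (key m) t"

definition verts :: "vertex list" where
  "verts = [V1, V2, V3, V4, V5, V6, V7, V8]"

fun completions :: "trie \<Rightarrow> mask \<Rightarrow> vertex list \<Rightarrow> vertex list" where
  "completions t m [] = []"
| "completions t m (v # vs) =
     (if has t (add v m) then v # completions t m vs else completions t m vs)"

fun many :: "vertex list \<Rightarrow> bool" where
  "many (v # w # vs) = True"
| "many [v] = False"
| "many [] = False"

definition saturated :: "trie \<Rightarrow> mask \<Rightarrow> bool" where
  "saturated t m = many (completions t m verts)"

fun candidates :: "trie \<Rightarrow> vertex \<Rightarrow> vertex \<Rightarrow> vertex \<Rightarrow> vertex \<Rightarrow> vertex list \<Rightarrow> vertex list" where
  "candidates t a b c x [] = []"
| "candidates t a b c x (y # ys) =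
     (if y = a \<or> y = b \<or> y = c \<or> y = x \<or>
         saturated t (mask_list [y, a, b]) \<or> saturated t (mask_list [y, a, c]) \<or>
         saturated t (mask_list [y, b, c])
      then candidates t a b c x ys else y # candidates t a b c x ys)"

text \<open>
  A certificate node refers to a state, the set of facets found so far. \<open>Split a b c\<close> branches over
  the second facet at the triangle \<open>abc\<close>, which must lie in exactly one facet of the state; there is
  one child for each fourth vertex that does not create a triangle with three facets.
  \<open>Cut u v a b c d\<close> is a contradiction: the link of \<open>uv\<close> contains the cycle \<open>abc\<close> and a further
  vertex \<open>d\<close>. \<open>Refer k\<close> with a relabelling, the list of images of \<open>V1, \<dots>, V8\<close>, points to the
  \<open>k\<close>-th pattern already dealt with, counted from \<open>0\<close>, whose relabelled copy is part of the state.
\<close>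

datatype cert =
    Split vertex vertex vertex "cert list"
  | Cut vertex vertex vertex vertex vertex vertex
  | Refer nat vertex vertex vertex vertex vertex vertex vertex vertex

fun relabel :: "vertex \<Rightarrow> vertex \<Rightarrow> vertex \<Rightarrow> vertex \<Rightarrow> vertex \<Rightarrow> vertex \<Rightarrow> vertex \<Rightarrow> vertex
    \<Rightarrow> vertex \<Rightarrow> vertex" where
  "relabel a b c d e f g h V1 = a"
| "relabel a b c d e f g h V2 = b"
| "relabel a b c d e f g h V3 = c"
| "relabel a b c d e f g h V4 = d"
| "relabel a b c d e f g h V5 = e"
| "relabel a b c d e f g h V6 = f"
| "relabel a b c d e f g h V7 = g"
| "relabel a b c d e f g h V8 = h"

text \<open>The list of fourth vertices is recomputed here and not read from the certificate.
  Children are matched with it in order, so a forgotten case makes \<open>check_all\<close>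
  fail.\<close>

fun check :: "vertex list list list \<Rightarrow> trie \<Rightarrow> cert \<Rightarrow> bool"
and check_split :: "vertex list list list \<Rightarrow> trie \<Rightarrow> vertex \<Rightarrow> vertex \<Rightarrow> vertex \<Rightarrow> vertex list
    \<Rightarrow> cert list \<Rightarrow> bool"
and check_all :: "vertex list list list \<Rightarrow> trie \<Rightarrow> mask \<Rightarrow> vertex list \<Rightarrow> cert list \<Rightarrow> bool" where
  "check ps t (Split a b c cs) =
     check_split ps t a b c (completions t (mask_list [a, b, c]) verts) cs"
| "check ps t (Cut u v a b c d) =
     (has t (mask_list [u, v, a, b]) \<and> has t (mask_list [u, v, b, c]) \<and>
      has t (mask_list [u, v, a, c]) \<and> \<not> (d = a \<or> d = b \<or> d = c) \<and>
      completions t (mask_list [u, v, d]) verts \<noteq> [])"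
| "check ps t (Refer k a b c d e f g h) =
     (mask_list [a, b, c, d, e, f, g, h] = mask_list verts \<and> k < length ps \<and>
      list_all (\<lambda>\<sigma>. has t (mask_list (map (relabel a b c d e f g h) \<sigma>))) (ps ! k))"
| "check_split ps t a b c [x] cs =
     check_all ps t (mask_list [a, b, c]) (candidates t a b c x verts) cs"
| "check_split ps t a b c [] cs = False"
| "check_split ps t a b c (x # y # xs) cs = False"
| "check_all ps t m [] [] = True"
| "check_all ps t m (y # ys) (c # cs) = (check ps (put (add y m) t) c \<and> check_all ps t m ys cs)"
| "check_all ps t m [] (c # cs) = False"
| "check_all ps t m (y # ys) [] = False"

fun trie_of :: "vertex list list \<Rightarrow> trie" where
  "trie_of [] = Empty"
| "trie_of (\<sigma> # F) = put (mask_list \<sigma>) (trie_of F)"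

definition tetrahedra :: "vertex list list \<Rightarrow> bool" where
  "tetrahedra F = list_all (\<lambda>\<sigma>. length \<sigma> = 4 \<and> distinct \<sigma>) F"

text \<open>Settled patterns are appended at the end, which keeps the positions used by
  \<open>Refer\<close> stable.\<close>

fun check_seq :: "vertex list list list \<Rightarrow> (vertex list list \<times> cert) list \<Rightarrow> bool" where
  "check_seq ps [] = True"
| "check_seq ps ((F, c) # xs) = (tetrahedra F \<and> check ps (trie_of F) c \<and> check_seq (ps @ [F]) xs)"

section \<open>Meaning of masks, tries and candidate lists\<close>

lemma UNIV_vertex: "UNIV = {V1, V2, V3, V4, V5, V6, V7, V8}"
proof (rule set_eqI)
  show "x \<in> UNIV \<longleftrightarrow> x \<in> {V1, V2, V3, V4, V5, V6, V7, V8}" for x by (cases x) simp_all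
qed

lemma set_verts: "set verts = UNIV"
  by (simp add: verts_def UNIV_vertex)

lemma distinct_verts: "distinct verts"
  by (simp add: verts_def)

instance vertex :: finite
  by standard (simp add: UNIV_vertex)

definition mask_of :: "vertex set \<Rightarrow> mask" where
  "mask_of A =
     Mask (V1 \<in> A) (V2 \<in> A) (V3 \<in> A) (V4 \<in> A) (V5 \<in> A) (V6 \<in> A) (V7 \<in> A) (V8 \<in> A)"

lemma mask_of_inject: "mask_of A = mask_of B \<longleftrightarrow> A = B"
proof
  assume eq: "mask_of A = mask_of B"
  have "x \<in> A \<longleftrightarrow> x \<in> B" for x using eq by (cases x) (simp_all add: mask_of_def)
  then show "A = B" by blast
qed simp

lemma add_mask_of: "add v (mask_of A) = mask_of (insert v A)"
  by (cases v) (simp_all add: mask_of_def)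

lemma mask_list_eq: "mask_list vs = mask_of (set vs)"
proof (induction vs)
  case (Cons v vs)
  then show ?case by (simp add: add_mask_of)
qed (simp add: mask_of_def)

lemma key_inject: "key m = key n \<longleftrightarrow> m = n"
  by (cases m; cases n) simp

lemma length_key: "length (key m) = 8"
  by (cases m) simp

text \<open>Equal lengths matter because a \<open>Full\<close> leaf answers for every extension of
  its key. The inclusion stated is the one on which soundness rests: whatever the trie reports was
  inserted.\<close>

lemma lookup_insert_key:
  "length bs = length cs \<Longrightarrow> lookup (insert_key bs t) cs \<Longrightarrow> bs = cs \<or> lookup t cs"
proof (induction bs t arbitrary: cs rule: insert_key.induct)
  case (3 bs)
  then show ?case by (cases cs; cases "hd cs") auto
next
  case (4 bs)
  then show ?case by (cases cs; cases "hd cs") auto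
next
  case (5 bs l r)
  then show ?case by (cases cs; cases "hd cs") auto
next
  case (6 bs l r)
  then show ?case by (cases cs; cases "hd cs") auto
qed auto

definition facets_of :: "trie \<Rightarrow> vertex set set" where
  "facets_of t = {A. has t (mask_of A)}"

lemma facets_of_put: "facets_of (put (mask_of A) t) \<subseteq> insert A (facets_of t)"
proof
  fix B assume "B \<in> facets_of (put (mask_of A) t)"
  then have "key (mask_of A) = key (mask_of B) \<or> lookup t (key (mask_of B))"
    by (intro lookup_insert_key) (simp_all add: facets_of_def has_def put_def length_key)
  then show "B \<in> insert A (facets_of t)"
    by (auto simp: facets_of_def has_def key_inject mask_of_inject)
qed

lemma facets_of_trie_of: "facets_of (trie_of F) \<subseteq> set ` set F"
proof (induction F)
  case (Cons \<sigma> F)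
  then show ?case using facets_of_put[of "set \<sigma>" "trie_of F"] by (auto simp: mask_list_eq)
qed (simp add: facets_of_def has_def)

lemma completions_eq:
  "completions t (mask_of A) vs = filter (\<lambda>v. insert v A \<in> facets_of t) vs"
  by (induction vs) (simp_all add: add_mask_of facets_of_def)

lemma candidates_eq:
  "candidates t a b c x ys = filter (\<lambda>y. y \<notin> {a, b, c, x} \<and>
     \<not> saturated t (mask_of {y, a, b}) \<and> \<not> saturated t (mask_of {y, a, c}) \<and>
     \<not> saturated t (mask_of {y, b, c})) ys"
  by (induction ys) (auto simp: mask_list_eq)

lemma saturated_two:
  assumes "saturated t (mask_of A)"
  obtains x y where "x \<noteq> y" "insert x A \<in> facets_of t" "insert y A \<in> facets_of t"
proof -
  define xs where "xs = completions t (mask_of A) verts"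
  have xs: "xs = filter (\<lambda>v. insert v A \<in> facets_of t) verts"
    by (simp add: xs_def completions_eq)
  have "many xs" using assms by (simp add: saturated_def xs_def)
  then obtain x y ys where "xs = x # y # ys" by (cases xs rule: many.cases) auto
  moreover have "distinct xs" using distinct_verts by (simp add: xs)
  ultimately have "x \<noteq> y" "x \<in> set xs" "y \<in> set xs" by simp_all
  then show ?thesis using that by (simp add: xs)
qed

section \<open>Valid complexes and soundness of the checker\<close>

definition valid :: "vertex set set \<Rightarrow> bool" where
  "valid M \<longleftrightarrow> normal_pseudomanifold 3 M \<and> neighbourly M \<and> vertices M = UNIV"

definition list_complex :: "vertex list list \<Rightarrow> vertex set set" where
  "list_complex F = complex_of_facets (set ` set F)"

definition isomorphic_to_some :: "vertex list list list \<Rightarrow> 'a set set \<Rightarrow> bool" where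
  "isomorphic_to_some ms M \<longleftrightarrow> (\<exists>F\<in>set ms. iso_complex M (list_complex F))"

text \<open>The invariant of the search. It also holds, with any conclusion, when no valid complex
  contains \<open>F\<close>, so contradictory patterns and models are handled alike.\<close>

definition claim :: "vertex list list list \<Rightarrow> vertex list list \<Rightarrow> bool" where
  "claim ms F \<longleftrightarrow> (\<forall>M. valid M \<and> set ` set F \<subseteq> M \<longrightarrow> isomorphic_to_some ms M)"

lemma valid_image:
  assumes "valid M" "bij p"
  shows "valid ((`) p ` M)"
  using assms normal_pseudomanifold_image[of p M 3] neighbourly_image[of M p]
  by (simp add: valid_def vertices_image bij_def)

lemma valid_normal3: "valid M \<Longrightarrow> normal3 M"
  by (simp add: valid_def normal3_def)

text \<open>The link of \<open>uv\<close> has at most six vertices and is a union of disjoint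
  cycles, so it can be disconnected only as two disjoint triangles. This is why a closed triangle
  \<open>abc\<close> is the only cycle tested. The vertex \<open>x\<close> completes a facet that
  witnesses \<open>d\<close> in the link.\<close>

lemma valid_cut:
  assumes M: "valid M"
    and facets: "{u, v, a, b} \<in> M" "{u, v, b, c} \<in> M" "{u, v, a, c} \<in> M" "{u, v, d, x} \<in> M"
    and cards: "card {u, v, a, b} = 4" "card {u, v, b, c} = 4" "card {u, v, a, c} = 4"
      "card {u, v, d, x} = 4"
    and d: "d \<notin> {a, b, c}"
  shows False
proof -
  interpret normal3 M using M by (rule valid_normal3)
  have four: "distinct [p, q, r, s]" if "card {p, q, r, s} = 4" for p q r s :: vertex
    by (rule card_distinct) (simp add: that)
  have dist: "distinct [u, v, a, b]" "distinct [u, v, b, c]" "distinct [u, v, a, c]"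
    "distinct [u, v, d, x]"
    by (rule four, rule cards)+
  have "d \<in> {a, b, c}"
  proof (rule edge_link_subset_closed[of u v])
    show "{u, v, d} \<in> M" by (rule face_subset[OF facets(4)]) auto
    fix s assume "s \<in> {a, b, c}"
    then consider "s = a" | "s = b" | "s = c" by blast
    then show "\<exists>x\<in>{a, b, c}. \<exists>y\<in>{a, b, c}. x \<noteq> y \<and> x \<noteq> s \<and> y \<noteq> s \<and>
        {u, v, s, x} \<in> M \<and> {u, v, s, y} \<in> M"
    proof cases
      case 1
      then show ?thesis using facets dist
        by (intro bexI[of _ b] bexI[of _ c]) (auto simp: insert_commute)
    next
      case 2
      then show ?thesis using facets dist
        by (intro bexI[of _ a] bexI[of _ c]) (auto simp: insert_commute)
    next
      case 3
      then show ?thesis using facets dist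
        by (intro bexI[of _ a] bexI[of _ b]) (auto simp: insert_commute)
    qed
  qed (use dist in auto)
  then show False using d by blast
qed

text \<open>Equality with the full mask says that all eight vertices occur among the images; a
  surjection of a finite set onto itself is injective.\<close>

lemma bij_relabel:
  assumes "mask_list [a, b, c, d, e, f, g, h] = mask_list verts"
  shows "bij (relabel a b c d e f g h)"
proof -
  have "set [a, b, c, d, e, f, g, h] = UNIV"
    using assms by (simp only: mask_list_eq mask_of_inject set_verts)
  then have "surj (relabel a b c d e f g h)"
    by (simp add: UNIV_vertex)
  then show ?thesis by (simp add: bij_def finite_UNIV_surj_inj)
qed

text \<open>The relabelling is undone on \<open>M\<close> instead of on \<open>F\<close>: the image
  of \<open>M\<close> under the inverse is valid, contains \<open>F\<close> literally, and is
  isomorphic to \<open>M\<close>.\<close>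

lemma check_refer:
  assumes M: "valid M" and claim: "claim ms F" and p: "bij p" and F: "(\<lambda>\<sigma>. p ` set \<sigma>) ` set F \<subseteq> M"
  shows "isomorphic_to_some ms M"
proof -
  define q where "q = inv p"
  have q: "bij q" using p by (simp add: q_def bij_imp_bij_inv)
  have "q ` p ` A = A" for A using p by (simp add: q_def image_inv_f_f bij_is_inj)
  then have "set \<sigma> \<in> (`) q ` M" if "\<sigma> \<in> set F" for \<sigma>
    using F that by (intro image_eqI[of _ _ "p ` set \<sigma>"]) auto
  then have "set ` set F \<subseteq> (`) q ` M" by blast
  then have "isomorphic_to_some ms ((`) q ` M)"
    using claim valid_image[OF M q] by (simp add: claim_def)
  moreover have "iso_complex M ((`) q ` M)"
    by (rule iso_complex_image) (use q in \<open>auto simp: bij_def intro: inj_on_subset\<close>)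
  ultimately show ?thesis unfolding isomorphic_to_some_def using iso_complex_trans by blast
qed

lemma tetrahedraD: "tetrahedra F \<Longrightarrow> \<sigma> \<in> set F \<Longrightarrow> card (set \<sigma>) = 4"
  by (simp add: tetrahedra_def list_all_iff distinct_card)

definition within :: "trie \<Rightarrow> vertex set set \<Rightarrow> bool" where
  "within t M \<longleftrightarrow> facets_of t \<subseteq> {A \<in> M. card A = 4}"

text \<open>Correctness of a split. The triangle \<open>abc\<close> has a second facet in
  \<open>M\<close>. If another triangle of that facet were saturated, the facet would be one of the
  two recorded there and hence recorded itself, although \<open>x\<close> is the only recorded
  completion of \<open>abc\<close>. So pruning never discards the true continuation.\<close>

lemma valid_second_completion:
  assumes M: "valid M" and t: "within t M" and "filter (\<lambda>v. insert v {a, b, c} \<in> facets_of t) verts = [x]"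
  obtains y where "y \<in> set (candidates t a b c x verts)" "insert y {a, b, c} \<in> M"
    "card (insert y {a, b, c}) = 4"
proof -
  interpret normal3 M using M by (rule valid_normal3)
  have tM: "A \<in> M" "card A = 4" if "A \<in> facets_of t" for A
    using t that by (auto simp: within_def)
  have "set (filter (\<lambda>v. insert v {a, b, c} \<in> facets_of t) verts) = {x}" using assms(3) by simp
  then have only: "insert v {a, b, c} \<in> facets_of t \<longleftrightarrow> v = x" for v
    by (auto simp: set_verts)
  then have x: "insert x {a, b, c} \<in> M" "card (insert x {a, b, c}) = 4" using tM by blast+
  have four: "distinct [p, q, r, s]" if "card {p, q, r, s} = 4" for p q r s :: vertex
    by (rule card_distinct) (simp add: that)
  have abc: "distinct [x, a, b, c]" using x(2) by (rule four)
  then have "card {a, b, c} = 3" "x \<notin> {a, b, c}" by auto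
  then obtain y where y: "y \<noteq> x" "y \<notin> {a, b, c}" "insert y {a, b, c} \<in> M"
    using second_facet[OF x(1)] by blast
  have unsaturated: "\<not> saturated t (mask_of \<rho>)"
    if \<rho>: "insert v \<rho> = insert y {a, b, c}" "card \<rho> = 3" "v \<notin> \<rho>" for \<rho> v
  proof
    assume "saturated t (mask_of \<rho>)"
    then obtain p q where pq: "p \<noteq> q" "insert p \<rho> \<in> facets_of t" "insert q \<rho> \<in> facets_of t"
      by (rule saturated_two)
    have "v = p \<or> v = q"
    proof (rule third_facet)
      show "insert p \<rho> \<in> M" "insert q \<rho> \<in> M" using pq tM by blast+
      \<comment> \<open>A recorded facet has four elements, so \<open>p\<close> in \<rho> would make
        it coincide with the triangle \<rho>.\<close>
      show "p \<notin> \<rho>" "q \<notin> \<rho>" using tM(2)[OF pq(2)] tM(2)[OF pq(3)] \<rho>(2) by (auto simp: insert_absorb)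
      show "insert v \<rho> \<in> M" using \<rho> y by simp
    qed (use pq \<rho> in simp_all)
    then have "insert y {a, b, c} \<in> facets_of t" using pq \<rho> by metis
    then show False using only y by blast
  qed
  have "\<not> saturated t (mask_of {y, a, b})"
    by (rule unsaturated[of c]) (use abc y in auto)
  moreover have "\<not> saturated t (mask_of {y, a, c})"
    by (rule unsaturated[of b]) (use abc y in auto)
  moreover have "\<not> saturated t (mask_of {y, b, c})"
    by (rule unsaturated[of a]) (use abc y in auto)
  ultimately have "y \<in> set (candidates t a b c x verts)"
    using y by (simp add: candidates_eq set_verts)
  moreover have "card (insert y {a, b, c}) = 4" using \<open>card {a, b, c} = 3\<close> y(2) by simp
  ultimately show ?thesis using that y by blast
qed

lemma within_put:
  assumes "within t M" "A \<in> M" "card A = 4"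
  shows "within (put (mask_of A) t) M"
  using assms facets_of_put[of A t] by (auto simp: within_def)

text \<open>For \<open>check_all\<close> the hypothesis is existential: the second facet of the
  given \<open>M\<close> singles out one child, and the conclusion for this \<open>M\<close> comes
  from that child alone. The second part carries an equation for \<open>ks\<close> so that the case
  of a single completion can be fed to \<open>valid_second_completion\<close>.\<close>

lemma check_sound:
  "check ps t ct \<Longrightarrow> \<forall>F\<in>set ps. claim ms F \<Longrightarrow> valid M \<Longrightarrow> within t M \<Longrightarrow>
     isomorphic_to_some ms M"
  "check_split ps t a b c ks cs \<Longrightarrow> \<forall>F\<in>set ps. claim ms F \<Longrightarrow> valid M \<Longrightarrow> within t M \<Longrightarrow>
     ks = completions t (mask_list [a, b, c]) verts \<Longrightarrow> isomorphic_to_some ms M"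
  "check_all ps t m ys cs \<Longrightarrow> \<forall>F\<in>set ps. claim ms F \<Longrightarrow> valid M \<Longrightarrow> within t M \<Longrightarrow>
     m = mask_of A \<Longrightarrow> \<exists>y\<in>set ys. insert y A \<in> M \<and> card (insert y A) = 4 \<Longrightarrow>
     isomorphic_to_some ms M"
proof (induction ps t ct and ps t a b c ks cs and ps t m ys cs arbitrary: and and A rule: check_check_split_check_all.induct)
  case (1 ps t a b c cs)
  then show ?case by simp
next
  case (2 ps t u v a b c d)
  have tM: "A \<in> M" "card A = 4" if "A \<in> facets_of t" for A
    using \<open>within t M\<close> that by (auto simp: within_def)
  have "completions t (mask_of {u, v, d}) verts \<noteq> []" using 2(1) by (simp add: mask_list_eq)
  then have "set (completions t (mask_of {u, v, d}) verts) \<noteq> {}" by simp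
  then obtain x where "insert x {u, v, d} \<in> facets_of t" by (auto simp: completions_eq)
  then have x: "{u, v, d, x} \<in> facets_of t" by (simp add: insert_commute)
  have abc: "{u, v, a, b} \<in> facets_of t" "{u, v, b, c} \<in> facets_of t" "{u, v, a, c} \<in> facets_of t"
    "d \<notin> {a, b, c}"
    using 2(1) by (simp_all add: mask_list_eq facets_of_def)
  have False
    by (rule valid_cut[of M u v a b c d x]) (use abc x tM \<open>valid M\<close> in \<open>blast+\<close>)
  then show ?case ..
next
  case (3 ps t k a b c d e f g h)
  then have k: "claim ms (ps ! k)" by simp
  let ?p = "relabel a b c d e f g h"
  have "?p ` set \<sigma> \<in> M" if "\<sigma> \<in> set (ps ! k)" for \<sigma>
  proof -
    have "has t (mask_list (map ?p \<sigma>))" using 3(1) that by (simp add: list_all_iff)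
    then have "?p ` set \<sigma> \<in> facets_of t" by (simp add: mask_list_eq facets_of_def)
    then show ?thesis using 3(4) by (auto simp: within_def)
  qed
  moreover have "bij ?p" using 3(1) by (intro bij_relabel) simp
  ultimately show ?case using check_refer[OF 3(3) k] by blast
next
  case (4 ps t a b c x cs)
  have "filter (\<lambda>v. insert v {a, b, c} \<in> facets_of t) verts = [x]"
    using 4(6) by (simp add: mask_list_eq completions_eq)
  then obtain y where y: "y \<in> set (candidates t a b c x verts)" "insert y {a, b, c} \<in> M"
    "card (insert y {a, b, c}) = 4"
    using valid_second_completion[OF 4(4,5)] by blast
  have "check_all ps t (mask_list [a, b, c]) (candidates t a b c x verts) cs"
    using 4(2) by (simp only: check_split.simps)
  then show ?case
    by (rule 4(1)[OF _ 4(3-5), of "{a, b, c}"]) (use y in \<open>auto simp: mask_list_eq\<close>)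
next
  case (6 ps t a b c x y xs cs)
  show ?case using 6(1) by simp
next
  case (8 ps t m y ys c cs)
  show ?case
  proof (cases "insert y A \<in> M \<and> card (insert y A) = 4")
    case True
    then have "within (put (add y m) t) M"
      using within_put[OF \<open>within t M\<close>] 8(7) by (simp add: add_mask_of)
    then show ?thesis using 8 by simp
  next
    case False
    then have "\<exists>y\<in>set ys. insert y A \<in> M \<and> card (insert y A) = 4" using 8(8) by auto
    then show ?thesis using 8(2)[OF _ 8(4-7)] 8(3) by simp
  qed
qed simp_all

text \<open>A pattern becomes available only after its own certificate has been checked, so
  references point backwards and cannot be circular.\<close>

lemma check_seq_sound:
  "check_seq ps xs \<Longrightarrow> \<forall>F\<in>set ps. claim ms F \<Longrightarrow> \<forall>(F, c)\<in>set xs. claim ms F"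
proof (induction ps xs rule: check_seq.induct)
  case (2 ps F c xs)
  have "claim ms F"
    unfolding claim_def
  proof (intro allI impI)
    fix M assume M: "valid M \<and> set ` set F \<subseteq> M"
    have "card (set \<sigma>) = 4" if "\<sigma> \<in> set F" for \<sigma>
      using 2(2) that by (intro tetrahedraD[of F]) simp_all
    then have "within (trie_of F) M"
      using M facets_of_trie_of[of F] by (force simp: within_def)
    then show "isomorphic_to_some ms M" using check_sound(1)[of ps "trie_of F" c ms M] 2 M by simp
  qed
  then show ?case using 2 by auto
qed simp

section \<open>Base cases: complete complexes and cones that miss a vertex\<close>

definition saturated_at :: "trie \<Rightarrow> vertex list list \<Rightarrow> vertex \<Rightarrow> bool" where
  "saturated_at t F x = list_all (\<lambda>\<sigma>. x \<in> set \<sigma> \<longrightarrow>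
     list_all (\<lambda>v. v = x \<or> saturated t (mask_list (removeAll v \<sigma>))) \<sigma>) F"

definition closed_list :: "vertex list list \<Rightarrow> bool" where
  "closed_list F \<longleftrightarrow> tetrahedra F \<and>
     list_all (\<lambda>x. list_ex (\<lambda>\<sigma>. x \<in> set \<sigma>) F \<and> saturated_at (trie_of F) F x) verts"

text \<open>
  The star of \<open>x\<close> is already complete but misses \<open>y\<close>, although \<open>xy\<close> has to be an edge.
\<close>

definition dead_cone :: "vertex \<Rightarrow> vertex \<Rightarrow> vertex list list \<Rightarrow> bool" where
  "dead_cone x y F \<longleftrightarrow> tetrahedra F \<and> x \<noteq> y \<and> list_ex (\<lambda>\<sigma>. x \<in> set \<sigma>) F \<and>
     saturated_at (trie_of F) F x \<and> list_all (\<lambda>\<sigma>. \<not> (x \<in> set \<sigma> \<and> y \<in> set \<sigma>)) F"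

lemma star_closed_list:
  assumes "saturated_at (trie_of F) F x"
  shows "star_closed x (set ` set F)"
  unfolding star_closed_def
proof (intro ballI impI)
  fix f v assume "f \<in> set ` set F" "x \<in> f" and v: "v \<in> f - {x}"
  then obtain \<sigma> where \<sigma>: "\<sigma> \<in> set F" "f = set \<sigma>" by blast
  then have "saturated (trie_of F) (mask_of (f - {v}))"
    using assms \<open>x \<in> f\<close> v by (auto simp: saturated_at_def list_all_iff mask_list_eq)
  then obtain p q where pq: "p \<noteq> q" "insert p (f - {v}) \<in> facets_of (trie_of F)"
    "insert q (f - {v}) \<in> facets_of (trie_of F)"
    by (rule saturated_two)
  then have F: "insert p (f - {v}) \<in> set ` set F" "insert q (f - {v}) \<in> set ` set F"
    using facets_of_trie_of[of F] by (simp_all add: subset_iff)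
  \<comment> \<open>Both sets equal to \<open>f\<close> would force
    \<open>p = v = q\<close>.\<close>
  have "insert p (f - {v}) \<noteq> f \<or> insert q (f - {v}) \<noteq> f" using pq(1) v by auto
  then show "\<exists>g\<in>set ` set F. g \<noteq> f \<and> f - {v} \<subseteq> g" using F by (metis subset_insertI)
qed

text \<open>Each vertex star of \<open>F\<close> is complete in \<open>M\<close> by
  \<open>star_closed_all\<close>, and every facet of \<open>M\<close> lies in the star of one of its
  vertices. Hence \<open>F\<close> lists all facets and \<open>M\<close> is the model itself; the
  isomorphism is the identity.\<close>

lemma claim_closed_list:
  assumes F: "F \<in> set ms" "closed_list F"
  shows "claim ms F"
  unfolding claim_def
proof (intro allI impI)
  fix M assume "valid M \<and> set ` set F \<subseteq> M"
  then have M: "valid M" "set ` set F \<subseteq> M" by simp_all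
  interpret normal3 M using M(1) by (rule valid_normal3)
  have card: "card f = 4" if "f \<in> set ` set F" for f
    using that F(2) tetrahedraD[of F] by (auto simp: closed_list_def)
  have cover: "\<exists>f\<in>set ` set F. x \<in> f" and sat: "saturated_at (trie_of F) F x" for x
    using F(2) by (auto simp: closed_list_def list_all_iff list_ex_iff set_verts)
  have "\<tau> \<in> set ` set F" if \<tau>: "\<tau> \<in> M" "card \<tau> = 4" for \<tau>
  proof -
    obtain x where x: "x \<in> \<tau>" using face_nonempty[OF \<tau>(1)] by blast
    obtain f where f: "f \<in> set ` set F" "x \<in> f" using cover by blast
    show ?thesis
      by (rule star_closed_all[OF M(2) card star_closed_list[OF sat[of x]] f \<tau> x])
  qed
  then have "\<exists>\<tau>\<in>set ` set F. \<sigma> \<subseteq> \<tau>" if "\<sigma> \<in> M" for \<sigma> using in_facet[OF that] by metis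
  then have "M = list_complex F"
    unfolding list_complex_def complex_of_facets_def using M(2) face_nonempty face_subset by blast
  then have "iso_complex M (list_complex F)"
    using iso_complex_image[of id M] by simp
  then show "isomorphic_to_some ms M" using F(1) by (auto simp: isomorphic_to_some_def)
qed

lemma claim_dead_cone:
  assumes F: "dead_cone x y F"
  shows "claim ms F"
  unfolding claim_def
proof (intro allI impI)
  fix M assume "valid M \<and> set ` set F \<subseteq> M"
  then have M: "valid M" "set ` set F \<subseteq> M" by simp_all
  interpret normal3 M using M(1) by (rule valid_normal3)
  have card: "card f = 4" if "f \<in> set ` set F" for f
    using that F tetrahedraD[of F] by (auto simp: dead_cone_def)
  obtain f where f: "f \<in> set ` set F" "x \<in> f"
    using F by (auto simp: dead_cone_def list_ex_iff)
  have sat: "saturated_at (trie_of F) F x" using F by (simp add: dead_cone_def)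
  have "{x, y} \<in> M" using M(1) F by (simp add: valid_def neighbourly_def dead_cone_def)
  then obtain \<tau> where \<tau>: "\<tau> \<in> M" "card \<tau> = 4" "{x, y} \<subseteq> \<tau>" by (rule in_facet)
  then have "\<tau> \<in> set ` set F"
    using star_closed_all[OF M(2) card star_closed_list[OF sat] f] by simp
  then have False using F \<tau>(3) by (auto simp: dead_cone_def list_all_iff)
  then show "isomorphic_to_some ms M" ..
qed

section \<open>Bistellar moves on facet lists\<close>

fun digit :: "vertex \<Rightarrow> nat" where
  "digit V1 = 1" | "digit V2 = 2" | "digit V3 = 3" | "digit V4 = 4"
| "digit V5 = 5" | "digit V6 = 6" | "digit V7 = 7" | "digit V8 = 8"

lemma inj_digit: "inj digit"
proof (rule injI)
  show "digit x = digit y \<Longrightarrow> x = y" for x y by (cases x; cases y) simp_all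
qed

definition number :: "vertex list \<Rightarrow> nat" where
  "number vs = foldl (\<lambda>n v. 10 * n + digit v) 0 vs"

text \<open>Digits run from 1 to 8. Being positive they keep the argument of \<open>digits\<close>
  nonzero even for \<open>n = 0\<close>, and being below 10 they are recovered by
  \<open>mod\<close>.\<close>

lemma digits_snoc: "digits (10 * n + digit v) = insert (digit v) (digits n)"
proof -
  have "0 < digit v \<and> digit v < 10" by (cases v) simp_all
  then show ?thesis by (subst digits.simps) simp
qed

lemma digits_number: "digits (number vs) = digit ` set vs"
proof -
  have "digits (foldl (\<lambda>n v. 10 * n + digit v) m vs) = digits m \<union> digit ` set vs" for m
  proof (induction vs arbitrary: m)
    case (Cons v vs)
    then show ?case by (simp add: digits_snoc)
  qed simp
  moreover have "digits 0 = {}" by (subst digits.simps) simp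
  ultimately show ?thesis by (simp add: number_def)
qed

lemma complex_of_facets_image:
  "complex_of_facets ((`) f ` F) = (`) f ` complex_of_facets F"
proof
  show "complex_of_facets ((`) f ` F) \<subseteq> (`) f ` complex_of_facets F"
  proof
    fix \<sigma> assume "\<sigma> \<in> complex_of_facets ((`) f ` F)"
    then obtain \<tau> where \<tau>: "\<sigma> \<noteq> {}" "\<tau> \<in> F" "\<sigma> \<subseteq> f ` \<tau>" by (auto simp: complex_of_facets_def)
    then obtain \<rho> where "\<rho> \<subseteq> \<tau>" "\<sigma> = f ` \<rho>" by (meson subset_image_iff)
    then show "\<sigma> \<in> (`) f ` complex_of_facets F" using \<tau> by (auto simp: complex_of_facets_def)
  qed
  show "(`) f ` complex_of_facets F \<subseteq> complex_of_facets ((`) f ` F)"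
    by (auto simp: complex_of_facets_def)
qed

lemma complex_of_list_number: "complex_of_list (map number F) = (`) digit ` list_complex F"
proof -
  have "digits ` set (map number F) = (`) digit ` (set ` set F)"
    by (simp add: image_image digits_number)
  then show ?thesis by (simp add: complex_of_list_def list_complex_def complex_of_facets_image)
qed

lemma simplicial_complex_list_complex: "simplicial_complex (list_complex F)"
  unfolding simplicial_complex_def list_complex_def complex_of_facets_def
proof (intro conjI ballI allI impI)
  fix \<sigma> \<tau> assume "\<sigma> \<in> {\<sigma>. \<sigma> \<noteq> {} \<and> (\<exists>\<rho>\<in>set ` set F. \<sigma> \<subseteq> \<rho>)}" "\<tau> \<noteq> {} \<and> \<tau> \<subseteq> \<sigma>"
  then show "\<tau> \<in> {\<sigma>. \<sigma> \<noteq> {} \<and> (\<exists>\<rho>\<in>set ` set F. \<sigma> \<subseteq> \<rho>)}" by (blast intro: subset_trans)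
qed simp_all

lemma facets_list_complex:
  assumes "tetrahedra F"
  shows "faces_of_dim (list_complex F) 3 = set ` set F"
proof -
  have card: "card f = 4" if "f \<in> set ` set F" for f using that tetrahedraD[OF assms] by blast
  have "\<sigma> \<in> set ` set F" if \<sigma>: "\<sigma> \<in> list_complex F" "card \<sigma> = 4" for \<sigma>
  proof -
    obtain f where f: "f \<in> set ` set F" "\<sigma> \<subseteq> f" using \<sigma>(1) by (auto simp: list_complex_def complex_of_facets_def)
    have "\<sigma> = f" by (rule card_subset_eq[OF _ f(2)]) (simp_all add: card[OF f(1)] \<sigma>(2))
    then show ?thesis using f by simp
  qed
  moreover have "f \<in> list_complex F" if "f \<in> set ` set F" for f
  proof -
    have "f \<noteq> {}" using card[OF that] by auto
    then show ?thesis using that by (auto simp: list_complex_def complex_of_facets_def)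
  qed
  ultimately show ?thesis using card by (auto simp: faces_of_dim_3)
qed

lemma bistellar_pairE:
  assumes "bistellar_pair M \<alpha> \<beta>"
  obtains i :: nat where "i \<in> {1, 2}" "\<alpha> \<in> faces_of_dim M (3 - int i)" "card \<beta> = i + 1"
    "link_of M \<alpha> = {\<tau>. \<tau> \<noteq> {} \<and> \<tau> \<subset> \<beta>}" "\<beta> \<notin> M"
  using assms unfolding bistellar_pair_def by (elim bexE conjE) (rule that)

text \<open>Since \<beta> has at least two elements, its singletons are proper subsets, and \<beta>
  is recovered as the union of the link. This evaluates the definite description in
  \<open>kappa\<close>.\<close>

lemma bistellar_pair_unique:
  assumes "bistellar_pair M \<alpha> \<beta>"
  shows "(THE \<beta>. bistellar_pair M \<alpha> \<beta>) = \<beta>"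
proof -
  have union: "\<Union>(link_of M \<alpha>) = \<beta>" if pair: "bistellar_pair M \<alpha> \<beta>" for \<beta>
  proof -
    obtain i :: nat where i: "i \<in> {1, 2}" "card \<beta> = i + 1"
      and link: "link_of M \<alpha> = {\<tau>. \<tau> \<noteq> {} \<and> \<tau> \<subset> \<beta>}"
      using pair by (rule bistellar_pairE)
    have "card \<beta> \<ge> 2" using i by auto
    have "{x} \<subset> \<beta>" if "x \<in> \<beta>" for x
    proof -
      have "\<beta> \<noteq> {x}" using \<open>card \<beta> \<ge> 2\<close> by auto
      then show ?thesis using that by blast
    qed
    then have "{x} \<in> link_of M \<alpha>" if "x \<in> \<beta>" for x using that by (simp add: link)
    moreover have "\<tau> \<subseteq> \<beta>" if "\<tau> \<in> link_of M \<alpha>" for \<tau>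
      using that by (simp add: link psubset_imp_subset)
    ultimately show ?thesis by (intro equalityI Union_least) (simp_all add: subset_iff, blast)
  qed
  show ?thesis
  proof (rule the_equality)
    fix \<gamma> assume "bistellar_pair M \<alpha> \<gamma>"
    then show "\<gamma> = \<beta>" using union[of \<gamma>] union[OF assms] by simp
  qed (rule assms)
qed

text \<open>Admissibility of a move is computed on lists of \<open>vertex\<close> and has to be
  transported along \<open>digit\<close> to the complexes on numbers.\<close>

lemma bistellar_pair_image:
  assumes "simplicial_complex K" and inj: "inj f" and pair: "bistellar_pair K \<alpha> \<beta>"
  shows "bistellar_pair ((`) f ` K) (f ` \<alpha>) (f ` \<beta>)"
proof -
  have injK: "inj_on f (vertices K)" using inj by (rule inj_on_subset) simp
  obtain i :: nat where i: "i \<in> {1, 2}" "\<alpha> \<in> faces_of_dim K (3 - int i)" "card \<beta> = i + 1"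
    and link: "link_of K \<alpha> = {\<tau>. \<tau> \<noteq> {} \<and> \<tau> \<subset> \<beta>}" and \<beta>: "\<beta> \<notin> K"
    using pair by (rule bistellar_pairE)
  have "\<alpha> \<in> K" using i(2) by (simp add: faces_of_dim_def)
  then have "link_of ((`) f ` K) (f ` \<alpha>) = (`) f ` {\<tau>. \<tau> \<noteq> {} \<and> \<tau> \<subset> \<beta>}"
    using link_of_image[OF injK assms(1)] link by simp
  also have "\<dots> = {\<tau>. \<tau> \<noteq> {} \<and> \<tau> \<subset> f ` \<beta>}"
  proof
    show "(`) f ` {\<tau>. \<tau> \<noteq> {} \<and> \<tau> \<subset> \<beta>} \<subseteq> {\<tau>. \<tau> \<noteq> {} \<and> \<tau> \<subset> f ` \<beta>}"
    proof
      fix \<rho> assume "\<rho> \<in> (`) f ` {\<tau>. \<tau> \<noteq> {} \<and> \<tau> \<subset> \<beta>}"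
      then obtain \<tau> where \<tau>: "\<tau> \<noteq> {}" "\<tau> \<subset> \<beta>" "\<rho> = f ` \<tau>" by blast
      have "f ` \<tau> \<noteq> f ` \<beta>" using \<tau>(2) inj_image_eq_iff[OF inj] by blast
      then show "\<rho> \<in> {\<tau>. \<tau> \<noteq> {} \<and> \<tau> \<subset> f ` \<beta>}" using \<tau> by auto
    qed
    show "{\<tau>. \<tau> \<noteq> {} \<and> \<tau> \<subset> f ` \<beta>} \<subseteq> (`) f ` {\<tau>. \<tau> \<noteq> {} \<and> \<tau> \<subset> \<beta>}"
    proof
      fix \<tau> assume \<tau>: "\<tau> \<in> {\<tau>. \<tau> \<noteq> {} \<and> \<tau> \<subset> f ` \<beta>}"
      then have "\<tau> \<subseteq> f ` \<beta>" by blast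
      then obtain \<rho> where "\<rho> \<subseteq> \<beta>" "\<tau> = f ` \<rho>" by (meson subset_image_iff)
      then show "\<tau> \<in> (`) f ` {\<tau>. \<tau> \<noteq> {} \<and> \<tau> \<subset> \<beta>}" using \<tau> by auto
    qed
  qed
  finally have "link_of ((`) f ` K) (f ` \<alpha>) = {\<tau>. \<tau> \<noteq> {} \<and> \<tau> \<subset> f ` \<beta>}" .
  moreover have "f ` \<beta> \<notin> (`) f ` K"
  proof
    assume "f ` \<beta> \<in> (`) f ` K"
    then obtain \<rho> where "f ` \<beta> = f ` \<rho>" "\<rho> \<in> K" by (rule imageE)
    then show False using \<beta> inj_image_eq_iff[OF inj, of \<beta> \<rho>] by simp
  qed
  moreover have "card (f ` \<beta>) = i + 1"
    using i(3) card_image[OF inj_on_subset[OF inj subset_UNIV], of \<beta>] by simp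
  moreover have "f ` \<alpha> \<in> faces_of_dim ((`) f ` K) (3 - int i)"
    using i(2) by (simp add: faces_of_dim_image[OF injK])
  ultimately show ?thesis using i(1) unfolding bistellar_pair_def by blast
qed

definition covers :: "vertex list \<Rightarrow> vertex list \<Rightarrow> bool" where
  "covers \<sigma> a = list_all (\<lambda>v. v \<in> set \<sigma>) a"

definition flip :: "vertex list \<Rightarrow> vertex list \<Rightarrow> vertex list list \<Rightarrow> vertex list list" where
  "flip a b F = filter (\<lambda>\<sigma>. \<not> covers \<sigma> a) F @ map (\<lambda>v. b @ removeAll v a) a"

text \<open>An executable form of admissibility: the star of \<alpha> is the join of \<alpha> with
  the boundary of \<beta>, and \<beta> is not a face. An edge with a triangle is a 2-move, a
  triangle with an edge a 1-move.\<close>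

definition flippable :: "vertex list \<Rightarrow> vertex list \<Rightarrow> vertex list list \<Rightarrow> bool" where
  "flippable a b F \<longleftrightarrow> tetrahedra F \<and> distinct a \<and> distinct b \<and>
     (length a = 2 \<and> length b = 3 \<or> length a = 3 \<and> length b = 2) \<and>
     list_all (\<lambda>v. v \<notin> set a) b \<and>
     list_all (\<lambda>\<sigma>. covers \<sigma> a \<longrightarrow>
       list_ex (\<lambda>x. mask_list \<sigma> = mask_list (a @ removeAll x b)) b) F \<and>
     list_all (\<lambda>x. list_ex (\<lambda>\<sigma>. mask_list \<sigma> = mask_list (a @ removeAll x b)) F) b \<and>
     list_all (\<lambda>\<sigma>. \<not> covers \<sigma> b) F"

lemma covers_iff: "covers \<sigma> a \<longleftrightarrow> set a \<subseteq> set \<sigma>"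
  by (auto simp: covers_def list_all_iff)

lemma bistellar_pair_flippable:
  assumes "flippable a b F"
  shows "bistellar_pair (list_complex F) (set a) (set b)"
proof -
  have len: "length a = 2 \<and> length b = 3 \<or> length a = 3 \<and> length b = 2"
    and dist: "distinct a" "distinct b" and disj: "set a \<inter> set b = {}"
    using assms by (auto simp: flippable_def list_all_iff)
  have star: "\<exists>x\<in>set b. f = set a \<union> (set b - {x})" if "f \<in> set ` set F" "set a \<subseteq> f" for f
    using assms that
    by (auto simp: flippable_def list_all_iff list_ex_iff covers_iff mask_list_eq mask_of_inject)
  have star': "set a \<union> (set b - {x}) \<in> set ` set F" if x: "x \<in> set b" for x
  proof -
    have "\<exists>\<sigma>\<in>set F. set \<sigma> = set a \<union> (set b - {x})"
      using assms x by (simp add: flippable_def list_all_iff list_ex_iff mask_list_eq mask_of_inject)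
    then show ?thesis by (metis imageI)
  qed
  have nb: "\<not> set b \<subseteq> f" if "f \<in> set ` set F" for f
    using assms that by (auto simp: flippable_def list_all_iff covers_iff)
  have ne: "set a \<noteq> {}" "set b \<noteq> {}" using len by auto
  have mem: "\<tau> \<in> list_complex F \<longleftrightarrow> \<tau> \<noteq> {} \<and> (\<exists>f\<in>set ` set F. \<tau> \<subseteq> f)" for \<tau>
    by (simp add: list_complex_def complex_of_facets_def)
  have link: "link_of (list_complex F) (set a) = {\<tau>. \<tau> \<noteq> {} \<and> \<tau> \<subset> set b}"
  proof (intro set_eqI iffI)
    fix \<tau> assume "\<tau> \<in> link_of (list_complex F) (set a)"
    then have \<tau>: "\<tau> \<noteq> {}" "\<tau> \<inter> set a = {}" "\<tau> \<union> set a \<in> list_complex F" by (auto simp: link_of_def mem)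
    then obtain f where f: "f \<in> set ` set F" "\<tau> \<union> set a \<subseteq> f" by (auto simp: mem)
    then obtain x where "x \<in> set b" "f = set a \<union> (set b - {x})" using star by blast
    then have "\<tau> \<subseteq> set b - {x}" using f \<tau> by blast
    then show "\<tau> \<in> {\<tau>. \<tau> \<noteq> {} \<and> \<tau> \<subset> set b}" using \<tau> \<open>x \<in> set b\<close> by blast
  next
    fix \<tau> assume \<tau>: "\<tau> \<in> {\<tau>. \<tau> \<noteq> {} \<and> \<tau> \<subset> set b}"
    then obtain x where x: "x \<in> set b" "x \<notin> \<tau>" by blast
    then have "\<tau> \<union> set a \<subseteq> set a \<union> (set b - {x})" using \<tau> by blast
    then have "\<tau> \<union> set a \<in> list_complex F" "\<tau> \<in> list_complex F" using star'[OF x(1)] \<tau> unfolding mem by blast+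
    moreover have "\<tau> \<inter> set a = {}" using \<tau> disj by blast
    ultimately show "\<tau> \<in> link_of (list_complex F) (set a)" by (simp add: link_of_def)
  qed
  have b: "set b \<notin> list_complex F" using nb by (auto simp: mem)
  have a: "set a \<in> list_complex F"
  proof -
    obtain x where "x \<in> set b" using ne(2) by (metis ex_in_conv)
    then show ?thesis unfolding mem using star' ne(1) by (meson Un_upper1)
  qed
  have cards: "card (set a) = length a" "card (set b) = length b" using dist by (simp_all add: distinct_card)
  show ?thesis
    unfolding bistellar_pair_def
  proof (intro bexI conjI)
    \<comment> \<open>The type \<open>i\<close> of the move is \<open>length b - 1\<close>: an edge
      \<alpha> goes with three points of \<beta>, a triangle with two.\<close>
    show "set a \<in> faces_of_dim (list_complex F) (3 - int (length b - 1))"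
      using len a cards(1) by (auto simp: faces_of_dim_def simplex_dim_def)
    show "card (set b) = length b - 1 + 1" using len cards(2) by auto
    show "length b - 1 \<in> {1, 2}" using len by auto
  qed (rule link b)+
qed

lemma move_flip:
  assumes M: "M = (`) digit ` list_complex F" and flip: "flippable a b F" and n: "n = number a"
  shows "move n M = (`) digit ` list_complex (flip a b F)"
proof -
  have tet: "tetrahedra F" using flip by (simp add: flippable_def)
  have inj: "inj_on digit (vertices (list_complex F))" using inj_digit by (rule inj_on_subset) simp
  have pair: "bistellar_pair M (digit ` set a) (digit ` set b)"
    unfolding M by (rule bistellar_pair_image[OF simplicial_complex_list_complex inj_digit bistellar_pair_flippable[OF flip]])
  have facets: "faces_of_dim M 3 = (`) digit ` set ` set F"
    unfolding M faces_of_dim_image[OF inj] by (simp add: facets_list_complex[OF tet])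
  have "{\<sigma> \<in> (`) digit ` set ` set F. \<not> digit ` set a \<subseteq> \<sigma>} =
      (`) digit ` set ` {\<sigma> \<in> set F. \<not> set a \<subseteq> set \<sigma>}"
    by (auto simp: inj_image_subset_iff[OF inj_digit])
  moreover have "{(digit ` set b \<union> digit ` set a) - {v} | v. v \<in> digit ` set a} =
      (`) digit ` set ` set (map (\<lambda>v. b @ removeAll v a) a)"
  proof -
    have "(digit ` set b \<union> digit ` set a) - {digit v} = digit ` set (b @ removeAll v a)"
      if "v \<in> set a" for v
    proof -
      \<comment> \<open>Disjointness of \<open>a\<close> and \<open>b\<close> makes removing
        \<open>v\<close> from the union the same as removing it from \<open>a\<close>, which is what
        \<open>flip\<close> does.\<close>
      have "v \<notin> set b" using flip that by (auto simp: flippable_def list_all_iff)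
      then show ?thesis using inj_digit by (auto simp: inj_eq)
    qed
    then have "(\<lambda>v. (digit ` set b \<union> digit ` set a) - {digit v}) ` set a =
        (\<lambda>v. digit ` set (b @ removeAll v a)) ` set a" by (rule image_cong[OF refl])
    then show ?thesis by (auto simp: image_image setcompr_eq_image)
  qed
  ultimately have "{\<sigma> \<in> faces_of_dim M 3. \<not> digit ` set a \<subseteq> \<sigma>} \<union>
      {(digit ` set b \<union> digit ` set a) - {v} | v. v \<in> digit ` set a} =
      (`) digit ` set ` set (flip a b F)"
    unfolding facets by (simp add: flip_def covers_iff image_Un)
  then show ?thesis
    unfolding kappa_def n digits_number bistellar_pair_unique[OF pair] Let_def
    by (simp add: list_complex_def complex_of_facets_image)
qed

section \<open>The degree invariant computed on facet lists\<close>

fun edge_degree :: "vertex list list \<Rightarrow> vertex \<Rightarrow> vertex \<Rightarrow> int" where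
  "edge_degree [] u v = 0"
| "edge_degree (\<sigma> # F) u v =
     (if u \<in> set \<sigma> \<and> v \<in> set \<sigma> then edge_degree F u v + 1 else edge_degree F u v)"

definition list_invariant :: "vertex list list \<Rightarrow> int" where
  "list_invariant F =
     sum_list (map (\<lambda>u. (sum_list (map (\<lambda>v. edge_degree F u v ^ 3) verts)) ^ 2) verts)"

text \<open>Distinct masks exclude that one facet is listed twice with its vertices in different
  orders; the list count would count it twice, the set once.\<close>

lemma edge_degree_eq:
  "distinct (map mask_list F) \<Longrightarrow> edge_degree F u v = int (card {\<sigma> \<in> set ` set F. {u, v} \<subseteq> \<sigma>})"
proof (induction F)
  case (Cons \<sigma> F)
  have new: "set \<sigma> \<notin> set ` set F"
    using Cons.prems by (auto simp: mask_list_eq)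
  have "{\<tau> \<in> set ` set (\<sigma> # F). {u, v} \<subseteq> \<tau>} = (if u \<in> set \<sigma> \<and> v \<in> set \<sigma>
      then insert (set \<sigma>) {\<tau> \<in> set ` set F. {u, v} \<subseteq> \<tau>} else {\<tau> \<in> set ` set F. {u, v} \<subseteq> \<tau>})"
    by auto
  then show ?case using Cons new by simp
qed simp

lemma degree_invariant_list_complex:
  assumes F: "tetrahedra F" "distinct (map mask_list F)" "vertices (list_complex F) = UNIV"
  shows "degree_invariant (list_complex F) = list_invariant F"
proof -
  have "sum_list (map g verts) = (\<Sum>v\<in>UNIV. g v)" for g :: "vertex \<Rightarrow> int"
    using distinct_verts by (simp add: sum_list_distinct_conv_sum_set set_verts)
  then show ?thesis
    by (simp add: degree_invariant_def list_invariant_def F(3) facets_list_complex[OF F(1)] edge_degree_eq[OF F(2)])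
qed

section \<open>The nineteen complexes\<close>

definition facets_S8_35 :: "vertex list list" where
  "facets_S8_35 =
     [[V1, V2, V3, V4], [V1, V2, V6, V7], [V1, V2, V5, V6], [V1, V2, V4, V5],
     [V2, V3, V4, V5], [V2, V3, V5, V6], [V2, V3, V6, V7], [V3, V4, V6, V7],
     [V3, V4, V5, V6], [V4, V5, V6, V7], [V1, V2, V3, V8], [V1, V2, V7, V8],
     [V2, V3, V7, V8], [V1, V3, V4, V8], [V3, V4, V7, V8], [V1, V4, V5, V8],
     [V4, V5, V7, V8], [V1, V5, V6, V8], [V1, V6, V7, V8], [V5, V6, V7, V8]]"

definition facets_S8_36 :: "vertex list list" where
  "facets_S8_36 =
     [[V1, V2, V3, V4], [V1, V2, V5, V6], [V1, V2, V4, V5], [V1, V5, V6, V7],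
     [V2, V3, V4, V5], [V2, V3, V5, V6], [V2, V3, V6, V7], [V3, V4, V6, V7],
     [V3, V4, V5, V6], [V4, V5, V6, V7], [V1, V2, V6, V8], [V1, V6, V7, V8],
     [V2, V6, V7, V8], [V1, V2, V3, V8], [V2, V3, V7, V8], [V1, V3, V4, V8],
     [V3, V4, V7, V8], [V1, V4, V5, V8], [V1, V5, V7, V8], [V4, V5, V7, V8]]"

definition facets_S8_37 :: "vertex list list" where
  "facets_S8_37 =
     [[V1, V2, V3, V4], [V1, V2, V5, V6], [V1, V2, V4, V5], [V1, V4, V5, V7],
     [V2, V3, V4, V5], [V2, V3, V5, V6], [V2, V3, V6, V7], [V3, V4, V6, V7],
     [V3, V4, V5, V6], [V4, V5, V6, V7], [V1, V5, V6, V8], [V1, V5, V7, V8],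
     [V5, V6, V7, V8], [V1, V2, V6, V8], [V2, V6, V7, V8], [V1, V2, V3, V8],
     [V2, V3, V7, V8], [V1, V3, V4, V8], [V1, V4, V7, V8], [V3, V4, V7, V8]]"

definition facets_S8_38 :: "vertex list list" where
  "facets_S8_38 =
     [[V1, V2, V3, V4], [V1, V2, V3, V7], [V1, V2, V6, V7], [V1, V3, V4, V7],
     [V1, V5, V6, V7], [V2, V3, V4, V5], [V2, V3, V6, V7], [V3, V4, V6, V7],
     [V3, V4, V5, V6], [V4, V5, V6, V7], [V2, V3, V5, V8], [V2, V3, V6, V8],
     [V3, V5, V6, V8], [V1, V2, V6, V8], [V1, V5, V6, V8], [V1, V2, V4, V8],
     [V2, V4, V5, V8], [V1, V4, V7, V8], [V1, V5, V7, V8], [V4, V5, V7, V8]]"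

definition facets_N8_1 :: "vertex list list" where
  "facets_N8_1 =
     [[V1, V2, V4, V8], [V1, V2, V6, V8], [V1, V3, V4, V8], [V1, V3, V7, V8],
     [V1, V5, V6, V8], [V1, V5, V7, V8], [V2, V3, V5, V8], [V2, V3, V7, V8],
     [V2, V4, V5, V8], [V2, V6, V7, V8], [V3, V4, V6, V8], [V3, V5, V6, V8],
     [V4, V5, V7, V8], [V4, V6, V7, V8], [V1, V2, V4, V7], [V1, V2, V5, V7],
     [V1, V3, V6, V7], [V1, V4, V6, V7], [V2, V3, V4, V7], [V2, V5, V6, V7],
     [V3, V4, V5, V7], [V3, V5, V6, V7], [V1, V2, V3, V6], [V2, V3, V4, V6],
     [V1, V3, V4, V5], [V1, V2, V3, V5], [V1, V4, V5, V6], [V2, V4, V5, V6]]"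

definition facets_N8_2 :: "vertex list list" where
  "facets_N8_2 =
     [[V1, V2, V4, V8], [V2, V4, V5, V8], [V2, V3, V5, V8], [V3, V5, V6, V8],
     [V3, V4, V6, V8], [V4, V6, V7, V8], [V4, V5, V7, V8], [V1, V5, V7, V8],
     [V1, V5, V6, V8], [V1, V2, V6, V8], [V2, V6, V7, V8], [V2, V3, V7, V8],
     [V1, V3, V7, V8], [V1, V3, V4, V8], [V1, V2, V4, V7], [V2, V4, V5, V7],
     [V2, V3, V5, V7], [V3, V5, V6, V7], [V3, V4, V6, V7], [V1, V5, V6, V7],
     [V1, V2, V6, V7], [V1, V3, V4, V7]]"

definition facets_N8_3 :: "vertex list list" where
  "facets_N8_3 =
     [[V1, V2, V4, V8], [V1, V2, V6, V8], [V1, V3, V4, V8], [V1, V3, V7, V8],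
     [V1, V5, V6, V8], [V1, V5, V7, V8], [V2, V3, V5, V8], [V2, V3, V7, V8],
     [V2, V4, V5, V8], [V2, V6, V7, V8], [V3, V4, V6, V8], [V3, V5, V6, V8],
     [V4, V5, V7, V8], [V4, V6, V7, V8], [V1, V2, V3, V4], [V2, V3, V4, V7],
     [V2, V4, V5, V6], [V2, V4, V6, V7], [V3, V4, V5, V6], [V3, V4, V5, V7],
     [V1, V2, V3, V5], [V1, V2, V5, V6], [V1, V3, V5, V7]]"

definition facets_N8_4 :: "vertex list list" where
  "facets_N8_4 =
     [[V1, V2, V4, V8], [V1, V2, V6, V8], [V1, V3, V4, V8], [V1, V3, V7, V8],
     [V1, V5, V6, V8], [V1, V5, V7, V8], [V2, V3, V5, V8], [V2, V3, V7, V8],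
     [V2, V4, V5, V8], [V2, V6, V7, V8], [V3, V4, V6, V8], [V3, V5, V6, V8],
     [V4, V5, V7, V8], [V4, V6, V7, V8], [V1, V2, V4, V5], [V1, V2, V5, V6],
     [V2, V3, V5, V6], [V2, V3, V6, V7], [V3, V4, V6, V7], [V1, V3, V4, V7],
     [V1, V4, V5, V7]]"

definition facets_N8_5 :: "vertex list list" where
  "facets_N8_5 =
     [[V1, V2, V5, V8], [V1, V2, V6, V8], [V1, V3, V5, V8], [V1, V3, V7, V8],
     [V1, V4, V6, V8], [V1, V4, V7, V8], [V2, V3, V6, V8], [V2, V3, V7, V8],
     [V2, V4, V5, V8], [V2, V4, V7, V8], [V3, V4, V5, V8], [V3, V4, V6, V8],
     [V1, V2, V5, V7], [V1, V2, V6, V7], [V1, V3, V6, V7], [V1, V4, V5, V7],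
     [V2, V3, V5, V7], [V2, V4, V6, V7], [V3, V4, V5, V7], [V3, V4, V6, V7],
     [V2, V3, V5, V6], [V2, V4, V5, V6], [V1, V3, V5, V6], [V1, V4, V5, V6]]"

definition facets_N8_6 :: "vertex list list" where
  "facets_N8_6 =
     [[V1, V3, V5, V8], [V1, V3, V7, V8], [V1, V4, V6, V8], [V1, V4, V7, V8],
     [V1, V5, V6, V8], [V2, V3, V6, V8], [V2, V3, V7, V8], [V2, V4, V5, V8],
     [V2, V4, V7, V8], [V2, V5, V6, V8], [V3, V4, V5, V8], [V3, V4, V6, V8],
     [V1, V2, V3, V5], [V1, V2, V4, V5], [V1, V4, V5, V7], [V1, V5, V6, V7],
     [V2, V3, V5, V7], [V2, V5, V6, V7], [V3, V4, V5, V7], [V1, V2, V3, V6],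
     [V1, V2, V4, V6], [V1, V3, V6, V7], [V2, V4, V6, V7], [V3, V4, V6, V7]]"

definition facets_N8_7 :: "vertex list list" where
  "facets_N8_7 =
     [[V1, V2, V6, V8], [V1, V2, V5, V8], [V1, V3, V5, V8], [V1, V3, V7, V8],
     [V1, V4, V7, V8], [V1, V4, V6, V8], [V2, V3, V7, V8], [V2, V3, V6, V8],
     [V2, V4, V5, V8], [V2, V4, V7, V8], [V3, V4, V6, V8], [V3, V4, V5, V8],
     [V1, V3, V5, V6], [V1, V3, V6, V7], [V2, V3, V5, V7], [V2, V3, V5, V6],
     [V3, V4, V6, V7], [V3, V4, V5, V7], [V1, V2, V5, V6], [V1, V4, V6, V7],
     [V2, V4, V5, V7]]"

text \<open>The second argument of \<open>flip\<close> is the vertex set of the link of the first.\<close>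

definition facets_N8_8 :: "vertex list list" where
  "facets_N8_8 =
     flip [V3, V4, V8] [V5, V6] (flip [V2, V3, V8] [V6, V7] (flip [V5, V6] [V1, V2, V3]
     (flip [V6, V7] [V1, V3, V4] facets_N8_7)))"

definition facets_N8_9 :: "vertex list list" where
  "facets_N8_9 =
     flip [V2, V3, V5] [V6, V7] (flip [V6, V7] [V1, V3, V4] facets_N8_7)"

definition facets_N8_10 :: "vertex list list" where
  "facets_N8_10 =
     flip [V1, V4, V8] [V6, V7] (flip [V6, V7] [V1, V3, V4] facets_N8_7)"

definition facets_N8_11 :: "vertex list list" where
  "facets_N8_11 =
     flip [V3, V4, V8] [V5, V6] (flip [V5, V6] [V1, V2, V3] facets_N8_10)"

definition facets_N8_12 :: "vertex list list" where
  "facets_N8_12 =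
     flip [V4, V5, V7] [V2, V3] (flip [V2, V3] [V6, V7, V8] facets_N8_9)"

definition facets_N8_13 :: "vertex list list" where
  "facets_N8_13 =
     flip [V5, V6, V7] [V2, V3] (flip [V2, V3] [V6, V7, V8] facets_N8_9)"

definition facets_N8_14 :: "vertex list list" where
  "facets_N8_14 =
     flip [V1, V3, V8] [V5, V7] (flip [V5, V7] [V2, V3, V4] facets_N8_8)"

definition facets_N8_15 :: "vertex list list" where
  "facets_N8_15 =
     flip [V1, V5, V8] [V2, V3] (flip [V2, V3] [V6, V7, V8] facets_N8_9)"

definition models :: "vertex list list list" where
  "models =
     [facets_S8_35, facets_S8_36, facets_S8_37, facets_S8_38, facets_N8_1, facets_N8_2, facets_N8_3, facets_N8_4, facets_N8_5, facets_N8_6, facets_N8_7,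
     facets_N8_8, facets_N8_9, facets_N8_10, facets_N8_11, facets_N8_12, facets_N8_13, facets_N8_14, facets_N8_15]"

lemma S8_35_eq: "S8_35 = (`) digit ` list_complex facets_S8_35"
  unfolding complex_of_list_number[symmetric] S8_35_def facets_S8_35_def by (simp add: number_def)

lemma S8_36_eq: "S8_36 = (`) digit ` list_complex facets_S8_36"
  unfolding complex_of_list_number[symmetric] S8_36_def facets_S8_36_def by (simp add: number_def)

lemma S8_37_eq: "S8_37 = (`) digit ` list_complex facets_S8_37"
  unfolding complex_of_list_number[symmetric] S8_37_def facets_S8_37_def by (simp add: number_def)

lemma S8_38_eq: "S8_38 = (`) digit ` list_complex facets_S8_38"
  unfolding complex_of_list_number[symmetric] S8_38_def facets_S8_38_def by (simp add: number_def)

lemma N8_1_eq: "N8_1 = (`) digit ` list_complex facets_N8_1"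
  unfolding complex_of_list_number[symmetric] N8_1_def facets_N8_1_def by (simp add: number_def)

lemma N8_2_eq: "N8_2 = (`) digit ` list_complex facets_N8_2"
  unfolding complex_of_list_number[symmetric] N8_2_def facets_N8_2_def by (simp add: number_def)

lemma N8_3_eq: "N8_3 = (`) digit ` list_complex facets_N8_3"
  unfolding complex_of_list_number[symmetric] N8_3_def facets_N8_3_def by (simp add: number_def)

lemma N8_4_eq: "N8_4 = (`) digit ` list_complex facets_N8_4"
  unfolding complex_of_list_number[symmetric] N8_4_def facets_N8_4_def by (simp add: number_def)

lemma N8_5_eq: "N8_5 = (`) digit ` list_complex facets_N8_5"
  unfolding complex_of_list_number[symmetric] N8_5_def facets_N8_5_def by (simp add: number_def)

lemma N8_6_eq: "N8_6 = (`) digit ` list_complex facets_N8_6"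
  unfolding complex_of_list_number[symmetric] N8_6_def facets_N8_6_def by (simp add: number_def)

lemma N8_7_eq: "N8_7 = (`) digit ` list_complex facets_N8_7"
  unfolding complex_of_list_number[symmetric] N8_7_def facets_N8_7_def by (simp add: number_def)

text \<open>\<open>move_flip\<close> applies once per move, from the outermost inwards to
  \<open>N8_7\<close>. The goals left for \<open>code_simp\<close> are the instances of
  \<open>flippable\<close>, so every move in the definition is verified to be admissible.\<close>

lemma N8_8_eq: "N8_8 = (`) digit ` list_complex facets_N8_8"
  unfolding N8_8_def facets_N8_8_def
  by (intro move_flip N8_7_eq; (simp add: number_def; fail)?; (code_simp; fail)?)

lemma N8_9_eq: "N8_9 = (`) digit ` list_complex facets_N8_9"
  unfolding N8_9_def facets_N8_9_def
  by (intro move_flip N8_7_eq; (simp add: number_def; fail)?; (code_simp; fail)?)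

lemma N8_10_eq: "N8_10 = (`) digit ` list_complex facets_N8_10"
  unfolding N8_10_def facets_N8_10_def
  by (intro move_flip N8_7_eq; (simp add: number_def; fail)?; (code_simp; fail)?)

lemma N8_11_eq: "N8_11 = (`) digit ` list_complex facets_N8_11"
  unfolding N8_11_def facets_N8_11_def
  by (intro move_flip N8_10_eq; (simp add: number_def; fail)?; (code_simp; fail)?)

lemma N8_12_eq: "N8_12 = (`) digit ` list_complex facets_N8_12"
  unfolding N8_12_def facets_N8_12_def
  by (intro move_flip N8_9_eq; (simp add: number_def; fail)?; (code_simp; fail)?)

lemma N8_13_eq: "N8_13 = (`) digit ` list_complex facets_N8_13"
  unfolding N8_13_def facets_N8_13_def
  by (intro move_flip N8_9_eq; (simp add: number_def; fail)?; (code_simp; fail)?)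

lemma N8_14_eq: "N8_14 = (`) digit ` list_complex facets_N8_14"
  unfolding N8_14_def facets_N8_14_def
  by (intro move_flip N8_8_eq; (simp add: number_def; fail)?; (code_simp; fail)?)

lemma N8_15_eq: "N8_15 = (`) digit ` list_complex facets_N8_15"
  unfolding N8_15_def facets_N8_15_def
  by (intro move_flip N8_9_eq; (simp add: number_def; fail)?; (code_simp; fail)?)

section \<open>Certificates\<close>

text \<open>The five cones are built over the connected closed surfaces with at most six vertices:
  here the boundary of a tetrahedron, then the triangular bipyramid, the stacked six-vertex sphere,
  the six-vertex projective plane and the octahedron. In a neighbourly complex on eight vertices
  every vertex link has seven vertices.\<close>

definition cone_1 :: "vertex list list" where
  "cone_1 =
     [[V1, V2, V3, V4], [V1, V2, V4, V5], [V2, V3, V4, V5], [V1, V3, V4, V5]]"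

definition cone_2 :: "vertex list list" where
  "cone_2 =
     [[V1, V2, V3, V4], [V1, V2, V4, V5], [V2, V3, V4, V5], [V1, V3, V4, V6],
     [V1, V4, V5, V6], [V3, V4, V5, V6]]"

definition cone_3 :: "vertex list list" where
  "cone_3 =
     [[V1, V2, V7, V8], [V1, V2, V3, V8], [V2, V3, V6, V8], [V2, V6, V7, V8],
     [V1, V3, V7, V8], [V3, V4, V6, V8], [V3, V4, V7, V8], [V4, V6, V7, V8]]"

definition cone_4 :: "vertex list list" where
  "cone_4 =
     [[V1, V2, V3, V4], [V1, V2, V3, V8], [V2, V3, V4, V5], [V2, V3, V5, V6],
     [V2, V3, V6, V8], [V1, V3, V4, V6], [V1, V3, V5, V6], [V1, V3, V5, V8],
     [V3, V4, V5, V8], [V3, V4, V6, V8]]"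

definition cone_5 :: "vertex list list" where
  "cone_5 =
     [[V1, V2, V4, V5], [V1, V2, V5, V6], [V2, V3, V4, V5], [V2, V3, V5, V6],
     [V1, V4, V5, V7], [V1, V5, V6, V7], [V3, V4, V5, V7], [V3, V5, V6, V7]]"

definition cones :: "(vertex \<times> vertex \<times> vertex list list) list" where
  "cones =
     [(V4, V6, cone_1), (V4, V7, cone_2), (V8, V5, cone_3), (V3, V7, cone_4), (V5, V8,
     cone_5)]"

section \<open>Edges of degree 6: patterns 1 to 14\<close>

definition pattern_1 :: "vertex list list" where
  "pattern_1 =
     [[V1, V2, V3, V4], [V1, V2, V4, V5], [V1, V2, V5, V6], [V1, V2, V6, V7],
     [V1, V2, V7, V8], [V1, V2, V3, V8], [V2, V3, V4, V5], [V2, V3, V5, V6],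
     [V2, V3, V6, V8]]"

text \<open>In the link of \<open>V2\<close> the star of \<open>V1\<close> is a hexagon on
  \<open>V3\<close> to \<open>V8\<close>, whose outside has to be filled. The first split leaves the
  fourth vertex \<open>V4\<close>, cut at once because the link of the edge 24 is closed by 1, 3, 5,
  or \<open>V8\<close>, which fills the hexagon with the zigzag of diagonals 35, 36, 68.\<close>

definition cert_1 :: cert where
  "cert_1 =
     Split V2 V6 V7 [Cut V2 V4 V1 V3 V5 V6, Split V1 V3 V4 [Refer 19 V1 V2 V3 V4 V5 V6 V7
     V8, Split V1 V4 V5 [Split V1 V6 V7 [Split V1 V3 V8 [Cut V1 V5 V2 V4 V6 V3, Split V3 V5
     V6 [Refer 20 V1 V2 V3 V4 V5 V6 V7 V8, Split V3 V6 V8 [Split V3 V4 V5 [Split V3 V4 V8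
     [Split V6 V7 V8 [Refer 21 V1 V2 V3 V4 V5 V6 V7 V8, Split V4 V5 V6 [Split V4 V5 V7
     [Refer 13 V1 V5 V3 V8 V4 V2 V7 V6]]]], Split V3 V7 V8 [Split V6 V7 V8 [Split V5 V6 V7
     [Split V4 V5 V8 [Refer 13 V1 V8 V6 V5 V7 V2 V4 V3]], Refer 21 V2 V1 V8 V5 V4 V3 V6
     V7]]]], Cut V3 V6 V2 V5 V8 V1]], Refer 19 V1 V2 V6 V7 V8 V3 V4 V5], Split V1 V4 V6
     [Split V1 V5 V6 [Split V1 V7 V8 [Split V1 V5 V7 [Split V3 V4 V5 [Refer 21 V6 V2 V3 V7
     V8 V4 V1 V5, Split V3 V5 V7 [Split V3 V6 V8 [Split V6 V7 V8 [Split V5 V7 V8 [Refer 18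
     V5 V7 V3 V2 V8 V4 V6 V1], Cut V5 V6 V1 V2 V3 V7]]]]], Split V1 V3 V5 [Split V3 V4 V5
     [Split V3 V5 V8 [Split V3 V6 V8 [Split V3 V4 V7 [Split V6 V7 V8 [Refer 15 V2 V7 V3 V5
     V8 V6 V4 V1]], Refer 21 V6 V2 V7 V5 V4 V1 V3 V8]], Split V4 V5 V7 [Cut V5 V6 V1 V2 V3
     V4, Split V3 V6 V8 [Refer 22 V1 V2 V3 V4 V5 V6 V7 V8, Split V3 V4 V6 [Split V3 V4 V8
     [Refer 16 V2 V7 V3 V5 V8 V6 V4 V1]]]]]]], Split V1 V3 V6 [Split V1 V7 V8 [Split V3 V5
     V6 [Refer 21 V8 V1 V6 V5 V7 V4 V2 V3, Split V3 V4 V6 [Split V6 V7 V8 [Refer 21 V3 V2 V6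
     V5 V4 V7 V1 V8]]]]]], Split V1 V4 V7 [Split V1 V6 V7 [Split V1 V5 V6 [Split V1 V3 V8
     [Split V1 V5 V7 [Split V3 V5 V6 [Cut V3 V5 V2 V4 V6 V1, Split V3 V4 V5 [Split V3 V6 V8
     [Split V6 V7 V8 [Split V4 V5 V7 [Refer 6 V7 V5 V6 V3 V8 V4 V2 V1]]]], Cut V3 V6 V2 V5
     V8 V1]]]], Cut V1 V6 V2 V5 V7 V3]]], Split V1 V4 V6 [Split V1 V4 V8 [Split V1 V5 V6
     [Split V1 V3 V8 [Split V3 V4 V5 [Split V3 V5 V8 [Split V4 V5 V8 [Cut V5 V6 V1 V2 V3 V4,
     Split V6 V7 V8 [Split V3 V4 V6 [Refer 14 V5 V2 V3 V7 V6 V4 V8 V1]]]], Refer 21 V6 V2 V3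
     V8 V7 V4 V1 V5]], Split V1 V3 V8 [Split V3 V5 V6 [Refer 21 V8 V1 V6 V5 V7 V4 V2 V3,
     Split V3 V4 V6 [Split V6 V7 V8 [Split V3 V4 V5 [Split V4 V5 V8 [Refer 12 V2 V4 V6 V8 V5
     V3 V7 V1], Cut V3 V8 V1 V2 V6 V4]]]]]]], Split V1 V5 V6 [Split V1 V6 V7 [Refer 19 V1 V2
     V6 V7 V8 V3 V4 V5], Cut V1 V6 V2 V5 V7 V3, Cut V1 V8 V4 V5 V6 V2]]], Split V1 V4 V5
     [Split V1 V4 V7 [Split V1 V7 V8 [Split V3 V4 V5 [Refer 20 V2 V1 V4 V5 V6 V3 V7 V8,
     Split V4 V5 V6 [Refer 21 V2 V3 V5 V6 V8 V7 V1 V4, Split V4 V5 V7 [Split V4 V6 V7 [Split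
     V3 V7 V8 [Split V3 V5 V6 [Refer 3 V1 V4 V5 V6 V8 V3 V2 V7]]]]], Split V3 V4 V7 [Split
     V3 V4 V8 [Split V3 V7 V8 [Split V3 V5 V6 [Split V6 V7 V8 [Split V4 V5 V6 [Refer 14 V8
     V5 V3 V1 V4 V7 V2 V6]]]]], Split V3 V6 V8 [Split V6 V7 V8 [Refer 21 V2 V6 V8 V3 V5 V4
     V1 V7, Split V4 V5 V6 [Split V4 V5 V8 [Refer 2 V7 V6 V5 V4 V1 V2 V3 V8]]]]]], Cut V1 V5
     V2 V4 V6 V7], Split V1 V4 V6 [Split V1 V6 V7 [Split V1 V6 V8 [Split V3 V5 V6 [Refer 20
     V2 V1 V4 V5 V6 V3 V7 V8, Split V3 V4 V5 [Split V6 V7 V8 [Refer 21 V3 V2 V6 V4 V5 V7 V1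
     V8, Split V4 V5 V6 [Split V4 V5 V7 [Refer 18 V8 V4 V6 V2 V5 V7 V3 V1]]], Cut V3 V8 V1
     V2 V6 V4]]]]]], Split V1 V6 V7 [Split V1 V7 V8 [Split V1 V5 V6 [Split V1 V3 V8 [Split
     V3 V4 V5 [Refer 20 V1 V2 V3 V4 V5 V7 V6 V8, Split V4 V5 V7 [Cut V5 V6 V1 V2 V3 V4,
     Split V3 V6 V8 [Split V3 V4 V7 [Split V6 V7 V8 [Refer 12 V5 V7 V3 V2 V8 V4 V6 V1]],
     Refer 21 V5 V1 V3 V8 V4 V7 V2 V6]]]], Split V1 V3 V8 [Split V3 V5 V6 [Split V3 V6 V7
     [Split V6 V7 V8 [Split V5 V6 V8 [Split V4 V5 V7 [Refer 14 V8 V2 V6 V4 V3 V7 V5 V1]],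
     Refer 21 V3 V2 V6 V5 V4 V7 V1 V8]], Split V3 V4 V5 [Refer 20 V1 V2 V3 V4 V5 V7 V6 V8,
     Cut V3 V8 V1 V2 V6 V4]]]]], Split V1 V7 V8 [Split V3 V4 V5 [Split V3 V4 V7 [Split V3 V6
     V8 [Refer 20 V2 V1 V7 V8 V3 V6 V4 V5], Split V3 V4 V6 [Split V6 V7 V8 [Refer 21 V1 V2
     V3 V4 V5 V6 V7 V8, Split V4 V5 V6 [Split V4 V5 V7 [Refer 1 V6 V2 V1 V7 V8 V3 V4
     V5]]]]], Refer 20 V1 V2 V3 V4 V5 V7 V6 V8, Split V3 V4 V7 [Split V3 V4 V8 [Split V3 V7
     V8 [Split V3 V5 V6 [Split V6 V7 V8 [Split V5 V7 V8 [Refer 15 V4 V2 V7 V8 V1 V5 V6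
     V3]]]]], Split V3 V6 V8 [Split V6 V7 V8 [Split V4 V5 V7 [Split V4 V5 V8 [Refer 2 V6 V2
     V1 V7 V8 V3 V4 V5]], Refer 21 V1 V7 V5 V3 V4 V8 V2 V6]]]]], Cut V1 V7 V2 V6 V8 V3],
     Split V1 V4 V7 [Split V1 V4 V8 [Split V1 V5 V6 [Split V1 V6 V8 [Split V1 V7 V8 [Split
     V1 V3 V7 [Split V3 V4 V5 [Split V6 V7 V8 [Split V4 V5 V8 [Refer 7 V3 V4 V8 V2 V5 V7 V6
     V1], Cut V5 V6 V1 V2 V3 V7], Cut V3 V8 V1 V2 V6 V4]]]], Cut V1 V8 V4 V5 V6 V2]], Split
     V1 V6 V7 [Split V1 V3 V8 [Split V1 V3 V6 [Split V3 V4 V5 [Split V3 V5 V8 [Split V3 V6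
     V7 [Refer 21 V5 V1 V3 V8 V4 V7 V2 V6]], Refer 21 V6 V2 V3 V8 V7 V4 V1 V5]], Split V1 V5
     V8 [Split V3 V5 V6 [Split V3 V6 V7 [Split V6 V7 V8 [Refer 21 V2 V8 V6 V3 V5 V4 V1 V7,
     Split V4 V5 V6 [Split V4 V5 V8 [Refer 16 V2 V4 V6 V8 V5 V3 V7 V1]]]], Split V3 V4 V5
     [Split V6 V7 V8 [Split V5 V6 V8 [Split V5 V6 V7 [Refer 15 V2 V4 V6 V8 V5 V3 V7 V1]],
     Refer 22 V1 V2 V6 V5 V3 V8 V4 V7], Cut V3 V8 V1 V2 V6 V4]]]], Split V1 V3 V7 [Split V1
     V5 V8 [Split V3 V4 V5 [Cut V3 V5 V2 V4 V6 V1, Split V3 V5 V6 [Split V4 V5 V8 [Split V5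
     V6 V7 [Split V6 V7 V8 [Refer 12 V3 V6 V1 V4 V8 V2 V7 V5]], Refer 21 V2 V3 V5 V8 V6 V7
     V1 V4]], Split V3 V5 V6 [Split V3 V6 V8 [Split V3 V4 V7 [Split V6 V7 V8 [Refer 15 V4 V6
     V1 V5 V7 V8 V2 V3]], Refer 21 V1 V5 V7 V8 V4 V3 V2 V6]]]]]]]], Split V1 V4 V5 [Split V1
     V4 V8 [Split V1 V6 V8 [Refer 19 V1 V2 V6 V7 V8 V3 V4 V5], Split V1 V4 V6 [Split V3 V4
     V5 [Refer 20 V2 V1 V4 V5 V6 V3 V7 V8, Split V3 V4 V8 [Split V3 V4 V7 [Split V3 V5 V6
     [Split V6 V7 V8 [Split V4 V5 V6 [Split V4 V5 V7 [Refer 15 V7 V2 V4 V5 V1 V8 V3 V6]]]]],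
     Split V4 V6 V7 [Split V3 V5 V6 [Refer 21 V1 V2 V6 V7 V8 V3 V4 V5, Split V3 V7 V8 [Split
     V6 V7 V8 [Refer 2 V3 V2 V1 V4 V5 V6 V7 V8]]]]], Split V3 V6 V8 [Refer 21 V1 V4 V8 V6 V7
     V5 V2 V3, Split V3 V5 V8 [Split V4 V7 V8 [Split V4 V5 V6 [Split V3 V6 V7 [Refer 1 V3 V2
     V1 V4 V5 V6 V7 V8]]]]]]]], Split V1 V4 V8 [Split V1 V4 V7 [Split V1 V7 V8 [Split V1 V6
     V8 [Split V3 V6 V8 [Split V6 V7 V8 [Split V3 V4 V5 [Refer 21 V1 V8 V4 V5 V7 V6 V2 V3,
     Split V3 V4 V6 [Split V5 V6 V7 [Refer 15 V7 V3 V1 V8 V4 V5 V2 V6]]]], Split V6 V7 V8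
     [Split V3 V4 V8 [Refer 21 V1 V4 V8 V6 V7 V5 V2 V3, Split V5 V7 V8 [Split V3 V4 V5
     [Refer 12 V6 V3 V1 V7 V5 V2 V4 V8]]]], Cut V6 V8 V2 V3 V7 V1]]]], Split V1 V6 V7 [Cut
     V1 V3 V2 V4 V8 V6, Split V3 V4 V5 [Split V3 V4 V8 [Refer 21 V1 V8 V4 V5 V7 V6 V2 V3,
     Split V3 V4 V6 [Split V3 V6 V8 [Refer 21 V6 V2 V7 V4 V5 V1 V3 V8]]], Split V3 V4 V8
     [Split V3 V4 V7 [Split V3 V5 V6 [Refer 23 V1 V2 V3 V4 V5 V6 V7 V8]], Refer 21 V2 V5 V3
     V8 V6 V7 V1 V4], Split V3 V6 V8 [Refer 21 V1 V4 V8 V6 V7 V5 V2 V3, Split V3 V5 V8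
     [Split V4 V7 V8 [Refer 21 V2 V3 V5 V7 V6 V8 V1 V4]]]]]], Split V1 V7 V8 [Split V1 V5 V6
     [Cut V1 V3 V2 V4 V8 V5, Split V3 V4 V5 [Split V3 V4 V8 [Refer 21 V1 V8 V4 V5 V7 V6 V2
     V3, Split V3 V4 V6 [Split V3 V6 V8 [Split V5 V7 V8 [Split V5 V6 V7 [Refer 2 V6 V5 V4 V3
     V2 V1 V8 V7]]]]], Split V3 V4 V8 [Split V3 V4 V7 [Split V3 V5 V6 [Split V6 V7 V8 [Split
     V4 V5 V8 [Refer 3 V2 V3 V4 V5 V7 V8 V1 V6]]]], Split V3 V6 V8 [Split V3 V7 V8 [Split V6
     V7 V8 [Split V4 V5 V8 [Split V5 V6 V7 [Refer 14 V7 V4 V8 V2 V3 V6 V1 V5]]]], Split V5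
     V7 V8 [Refer 21 V2 V1 V5 V7 V6 V8 V3 V4]]], Refer 20 V1 V2 V3 V4 V5 V8 V6 V7]], Refer
     19 V1 V2 V6 V7 V8 V3 V4 V5]]]]"

definition pattern_2 :: "vertex list list" where
  "pattern_2 =
     [[V1, V2, V3, V4], [V1, V2, V4, V5], [V1, V2, V5, V6], [V1, V2, V6, V7],
     [V1, V2, V7, V8], [V1, V2, V3, V8], [V2, V3, V4, V5], [V2, V3, V5, V6],
     [V2, V3, V7, V8]]"

text \<open>The first split has the single continuation 2367, and the hexagon in the link of
  \<open>V2\<close> is filled by the fan of diagonals 35, 36, 37 at \<open>V3\<close>.\<close>

definition cert_2 :: cert where
  "cert_2 =
     Split V2 V3 V6 [Split V1 V3 V4 [Refer 19 V1 V2 V3 V4 V5 V6 V7 V8, Split V1 V4 V5 [Split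
     V1 V6 V7 [Split V1 V3 V8 [Cut V1 V5 V2 V4 V6 V3, Refer 20 V1 V6 V2 V7 V3 V8 V4 V5],
     Split V1 V3 V6 [Split V3 V5 V6 [Refer 20 V1 V2 V3 V4 V5 V6 V7 V8, Cut V3 V6 V2 V5 V7
     V1, Split V3 V6 V7 [Split V3 V4 V5 [Split V3 V7 V8 [Split V4 V5 V6 [Refer 21 V2 V1 V5
     V7 V8 V6 V3 V4, Split V4 V5 V7 [Split V6 V7 V8 [Refer 13 V4 V2 V6 V8 V1 V5 V7 V3]]]],
     Split V3 V7 V8 [Split V4 V5 V6 [Split V6 V7 V8 [Split V4 V5 V8 [Refer 10 V1 V5 V3 V7 V4
     V2 V8 V6]], Refer 21 V1 V2 V6 V8 V7 V3 V4 V5]]]]]]], Split V1 V4 V6 [Split V1 V5 V6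
     [Split V1 V7 V8 [Refer 19 V1 V2 V7 V8 V3 V4 V5 V6, Split V1 V3 V5 [Split V3 V4 V5
     [Split V3 V5 V8 [Refer 20 V1 V2 V7 V8 V3 V5 V4 V6], Split V4 V5 V7 [Cut V5 V6 V1 V2 V3
     V4, Split V3 V7 V8 [Refer 21 V2 V1 V3 V4 V6 V5 V7 V8, Split V3 V4 V6 [Split V4 V7 V8
     [Refer 15 V5 V7 V3 V2 V8 V4 V6 V1]]]]]]], Split V1 V3 V6 [Split V1 V7 V8 [Split V3 V5
     V6 [Split V3 V6 V7 [Split V4 V5 V7 [Refer 21 V2 V3 V5 V7 V8 V6 V1 V4, Split V4 V5 V6
     [Split V6 V7 V8 [Refer 13 V4 V2 V6 V8 V3 V5 V7 V1]]]], Cut V3 V6 V2 V5 V7 V1, Split V3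
     V6 V7 [Split V3 V4 V5 [Refer 21 V2 V5 V3 V6 V8 V7 V1 V4, Split V3 V7 V8 [Split V4 V5 V7
     [Refer 11 V2 V5 V3 V7 V4 V6 V8 V1]]]]]]]], Split V1 V4 V7 [Split V1 V6 V7 [Split V1 V5
     V6 [Split V1 V3 V8 [Split V1 V5 V7 [Split V3 V5 V6 [Cut V3 V5 V2 V4 V6 V1, Split V3 V4
     V5 [Split V3 V7 V8 [Split V3 V4 V6 [Refer 5 V6 V5 V7 V2 V4 V8 V3 V1]]]]]]], Cut V1 V6
     V2 V5 V7 V3]]], Split V1 V4 V6 [Split V1 V4 V8 [Split V1 V5 V6 [Split V1 V3 V8 [Split
     V3 V4 V5 [Split V3 V5 V8 [Split V3 V6 V7 [Refer 21 V5 V2 V3 V4 V8 V7 V1 V6]], Refer 21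
     V6 V2 V3 V8 V7 V4 V1 V5]], Split V1 V3 V8 [Split V3 V5 V6 [Split V3 V6 V7 [Split V4 V5
     V8 [Refer 21 V3 V2 V6 V8 V7 V1 V4 V5, Split V4 V5 V6 [Split V5 V6 V8 [Refer 10 V2 V4 V6
     V8 V5 V3 V7 V1]]]], Cut V3 V6 V2 V5 V7 V1, Split V3 V6 V7 [Split V3 V4 V5 [Split V3 V7
     V8 [Split V4 V5 V8 [Refer 11 V2 V5 V1 V7 V4 V6 V8 V3]], Refer 23 V1 V2 V3 V4 V5 V6 V8
     V7]]]]]], Split V1 V5 V6 [Split V1 V6 V7 [Split V1 V3 V8 [Split V3 V4 V5 [Split V3 V5
     V8 [Split V3 V6 V7 [Split V4 V5 V8 [Cut V5 V6 V1 V2 V3 V4, Split V6 V7 V8 [Refer 15 V5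
     V7 V1 V2 V8 V4 V6 V3]]]], Refer 21 V6 V2 V3 V8 V7 V4 V1 V5]]], Cut V1 V6 V2 V5 V7 V3,
     Cut V1 V8 V4 V5 V6 V2]]], Split V1 V4 V5 [Split V1 V4 V7 [Split V1 V7 V8 [Refer 19 V1
     V2 V7 V8 V3 V4 V5 V6, Cut V1 V5 V2 V4 V6 V7], Split V1 V4 V6 [Split V1 V6 V7 [Split V1
     V6 V8 [Split V3 V5 V6 [Refer 20 V2 V1 V4 V5 V6 V3 V7 V8, Split V4 V5 V6 [Cut V6 V7 V1
     V2 V3 V4, Split V3 V4 V5 [Split V3 V7 V8 [Split V4 V5 V8 [Refer 15 V7 V5 V1 V2 V4 V8 V6
     V3]], Refer 21 V1 V2 V6 V8 V7 V3 V4 V5]]]]]]], Split V1 V6 V7 [Split V1 V7 V8 [Split V1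
     V5 V6 [Refer 20 V1 V5 V2 V6 V3 V7 V4 V8, Split V1 V3 V8 [Split V3 V5 V6 [Split V3 V6 V8
     [Split V3 V4 V7 [Split V4 V5 V7 [Cut V6 V7 V1 V2 V3 V4, Split V4 V5 V6 [Refer 15 V7 V5
     V3 V2 V4 V8 V6 V1]]]], Refer 21 V7 V2 V3 V8 V4 V5 V1 V6]]]], Split V1 V7 V8 [Refer 19
     V1 V2 V7 V8 V3 V4 V5 V6], Cut V1 V7 V2 V6 V8 V3], Split V1 V4 V7 [Split V1 V4 V8 [Split
     V1 V5 V6 [Split V1 V6 V8 [Split V1 V7 V8 [Split V1 V3 V7 [Split V3 V4 V5 [Cut V3 V7 V1
     V4 V5 V2, Split V3 V5 V7 [Split V3 V6 V7 [Split V3 V6 V8 [Refer 5 V8 V5 V6 V4 V2 V7 V3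
     V1]]]]]]], Cut V1 V8 V4 V5 V6 V2]], Split V1 V6 V7 [Split V1 V3 V8 [Split V1 V3 V6
     [Refer 20 V1 V5 V2 V6 V3 V7 V4 V8], Split V1 V5 V8 [Split V3 V5 V6 [Split V3 V6 V8
     [Split V3 V4 V7 [Refer 21 V6 V2 V3 V4 V5 V8 V1 V7]], Refer 21 V7 V2 V3 V8 V4 V5 V1
     V6]]], Split V1 V3 V7 [Split V1 V5 V8 [Split V3 V4 V5 [Cut V3 V5 V2 V4 V6 V1, Cut V3 V7
     V1 V4 V5 V2, Split V3 V5 V6 [Refer 20 V2 V1 V5 V6 V7 V3 V4 V8]]]]]]], Split V1 V4 V5
     [Split V1 V4 V8 [Split V1 V6 V8 [Split V3 V4 V5 [Refer 20 V2 V1 V4 V5 V6 V3 V7 V8,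
     Split V3 V4 V8 [Split V3 V4 V7 [Split V3 V5 V6 [Split V3 V7 V8 [Split V4 V5 V6 [Split
     V6 V7 V8 [Refer 16 V5 V1 V3 V7 V2 V4 V8 V6]]]]], Split V3 V6 V7 [Split V4 V5 V6 [Refer
     21 V1 V2 V6 V7 V8 V3 V4 V5, Split V4 V5 V7 [Split V6 V7 V8 [Refer 2 V4 V3 V2 V1 V8 V7
     V6 V5]]]]], Split V3 V7 V8 [Split V3 V5 V6 [Split V4 V5 V6 [Split V6 V7 V8 [Split V4 V5
     V8 [Refer 2 V8 V3 V2 V1 V4 V5 V6 V7]], Refer 21 V2 V3 V5 V6 V7 V8 V1 V4]], Refer 20 V2
     V1 V6 V7 V8 V3 V4 V5]]], Split V1 V4 V6 [Split V3 V4 V5 [Refer 20 V2 V1 V4 V5 V6 V3 V7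
     V8, Split V3 V4 V8 [Split V3 V4 V7 [Split V3 V5 V6 [Split V3 V7 V8 [Split V4 V5 V6
     [Split V4 V5 V7 [Refer 18 V8 V1 V3 V5 V2 V7 V6 V4]]]]], Refer 20 V1 V2 V7 V8 V3 V4 V5
     V6], Split V3 V7 V8 [Split V3 V5 V6 [Split V4 V5 V6 [Refer 21 V3 V2 V7 V4 V8 V1 V5 V6,
     Split V5 V6 V7 [Split V4 V7 V8 [Refer 1 V5 V4 V1 V2 V3 V8 V7 V6]]]], Split V3 V5 V8
     [Split V4 V5 V6 [Split V4 V5 V8 [Split V6 V7 V8 [Refer 0 V4 V1 V2 V3 V8 V7 V6 V5]],
     Refer 21 V1 V2 V6 V8 V7 V3 V4 V5]]]]]], Split V1 V4 V8 [Split V1 V4 V7 [Split V1 V7 V8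
     [Split V1 V6 V8 [Split V3 V4 V5 [Split V3 V4 V8 [Split V3 V6 V7 [Split V4 V6 V7 [Split
     V5 V6 V8 [Refer 16 V5 V3 V1 V7 V2 V4 V8 V6]]], Split V3 V4 V6 [Split V4 V5 V7 [Split V4
     V5 V6 [Refer 18 V5 V2 V4 V8 V3 V6 V7 V1]]]], Split V3 V4 V8 [Split V3 V4 V7 [Split V3
     V5 V6 [Split V3 V7 V8 [Refer 17 V6 V5 V1 V7 V8 V2 V4 V3]]], Split V3 V6 V7 [Split V4 V6
     V7 [Split V5 V7 V8 [Refer 15 V6 V3 V1 V8 V2 V5 V4 V7]]]], Split V3 V7 V8 [Split V3 V5
     V6 [Split V4 V5 V7 [Split V5 V6 V8 [Refer 15 V6 V3 V1 V4 V2 V7 V8 V5]]], Split V3 V5 V8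
     [Split V5 V7 V8 [Split V6 V7 V8 [Refer 18 V7 V2 V8 V4 V3 V6 V5 V1]]]]]]]], Split V1 V6
     V7 [Cut V1 V3 V2 V4 V8 V6, Split V3 V4 V5 [Split V3 V4 V8 [Split V3 V6 V7 [Split V4 V5
     V7 [Refer 21 V3 V2 V6 V7 V8 V1 V4 V5, Split V4 V5 V6 [Split V5 V6 V7 [Refer 2 V4 V1 V2
     V3 V8 V7 V6 V5]]]], Refer 20 V1 V2 V7 V8 V3 V4 V5 V6], Split V3 V4 V8 [Split V3 V4 V7
     [Split V3 V5 V6 [Split V3 V7 V8 [Split V4 V7 V8 [Split V5 V6 V7 [Refer 15 V6 V1 V3 V8
     V2 V5 V4 V7]]]]], Refer 21 V2 V5 V3 V8 V6 V7 V1 V4], Split V3 V7 V8 [Split V3 V5 V6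
     [Refer 20 V2 V1 V5 V6 V7 V3 V4 V8], Split V3 V5 V8 [Split V4 V5 V7 [Split V4 V5 V8
     [Split V6 V7 V8 [Refer 1 V4 V1 V2 V3 V8 V7 V6 V5]], Refer 21 V2 V3 V5 V7 V6 V8 V1
     V4]]]]]], Split V1 V7 V8 [Split V1 V5 V6 [Cut V1 V3 V2 V4 V8 V5, Split V3 V4 V5 [Split
     V3 V4 V8 [Split V3 V6 V7 [Split V4 V5 V8 [Refer 21 V2 V1 V5 V6 V7 V8 V3 V4, Split V4 V5
     V6 [Split V6 V7 V8 [Refer 2 V8 V1 V2 V3 V4 V5 V6 V7]]]], Split V3 V4 V6 [Split V4 V5 V8
     [Split V5 V6 V7 [Split V4 V7 V8 [Refer 1 V8 V1 V2 V3 V4 V5 V6 V7]], Refer 21 V2 V3 V7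
     V5 V6 V4 V1 V8]]], Split V3 V4 V8 [Split V3 V4 V7 [Split V3 V5 V6 [Split V3 V7 V8
     [Split V4 V5 V8 [Split V5 V6 V7 [Refer 15 V6 V1 V3 V4 V2 V7 V8 V5]]]]], Split V3 V6 V7
     [Refer 20 V2 V1 V5 V6 V7 V3 V4 V8]], Refer 20 V1 V2 V3 V4 V5 V8 V6 V7]], Split V1 V5 V8
     [Split V3 V4 V5 [Split V3 V4 V8 [Split V3 V6 V7 [Refer 20 V2 V1 V6 V7 V8 V3 V4 V5],
     Split V3 V4 V6 [Split V4 V5 V8 [Refer 21 V3 V2 V6 V8 V7 V1 V4 V5, Split V6 V7 V8 [Split
     V4 V5 V6 [Refer 0 V1 V2 V3 V4 V5 V6 V7 V8]]]]], Split V3 V4 V8 [Split V3 V4 V7 [Split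
     V3 V5 V6 [Split V3 V7 V8 [Split V4 V5 V8 [Split V6 V7 V8 [Refer 18 V7 V2 V8 V4 V1 V6 V5
     V3]]]]], Split V3 V6 V7 [Split V4 V5 V8 [Split V4 V5 V7 [Split V6 V7 V8 [Refer 1 V4 V3
     V2 V1 V8 V7 V6 V5]], Refer 21 V2 V1 V5 V7 V6 V8 V3 V4]]], Refer 20 V1 V2 V3 V4 V5 V8 V6
     V7]]]]]]"

definition pattern_3 :: "vertex list list" where
  "pattern_3 =
     [[V1, V2, V3, V4], [V1, V2, V4, V5], [V1, V2, V5, V6], [V1, V2, V6, V7],
     [V1, V2, V7, V8], [V1, V2, V3, V8], [V2, V3, V4, V5], [V2, V3, V5, V6]]"

definition cert_3 :: cert where
  "cert_3 =
     Split V2 V3 V8 [Refer 24 V1 V2 V3 V4 V5 V6 V7 V8, Refer 25 V1 V2 V3 V4 V5 V6 V7 V8]"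

text \<open>The remaining way to triangulate the hexagon by diagonals: a central triangle 357. The
  star of \<open>V2\<close> is complete, and the last two facets belong to the star of
  \<open>V1\<close>.\<close>

definition pattern_4 :: "vertex list list" where
  "pattern_4 =
     [[V1, V2, V3, V4], [V1, V2, V4, V5], [V1, V2, V5, V6], [V1, V2, V6, V7],
     [V1, V2, V7, V8], [V1, V2, V3, V8], [V2, V3, V4, V5], [V2, V5, V6, V7],
     [V2, V3, V5, V7], [V2, V3, V7, V8], [V1, V3, V4, V6], [V1, V4, V5, V7]]"

definition cert_4 :: cert where
  "cert_4 =
     Split V1 V4 V6 [Split V1 V5 V6 [Split V1 V7 V8 [Refer 19 V1 V2 V7 V8 V3 V4 V5 V6, Split
     V1 V3 V5 [Split V3 V5 V7 [Cut V3 V5 V2 V4 V7 V1, Cut V5 V7 V2 V3 V6 V1, Refer 20 V1 V2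
     V7 V8 V3 V5 V4 V6]]], Split V1 V3 V6 [Split V1 V7 V8 [Split V5 V6 V7 [Cut V5 V7 V2 V3
     V6 V1, Split V3 V5 V7 [Split V3 V4 V5 [Refer 21 V2 V3 V5 V7 V8 V6 V1 V4, Split V3 V6 V8
     [Split V4 V5 V6 [Refer 14 V6 V7 V1 V3 V2 V4 V8 V5]]]], Split V3 V5 V7 [Split V3 V7 V8
     [Split V3 V4 V6 [Split V6 V7 V8 [Refer 14 V6 V5 V1 V3 V2 V8 V4 V7]], Refer 21 V2 V3 V7
     V5 V4 V6 V1 V8]]]]]], Split V1 V4 V7 [Split V1 V6 V7 [Split V1 V5 V6 [Split V1 V3 V8
     [Split V1 V5 V7 [Split V3 V4 V5 [Split V3 V5 V8 [Split V5 V6 V7 [Split V3 V6 V7 [Split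
     V4 V6 V7 [Refer 6 V8 V3 V6 V5 V7 V2 V4 V1]]]], Split V5 V6 V7 [Split V4 V5 V8 [Split V3
     V4 V6 [Split V3 V7 V8 [Refer 6 V6 V7 V4 V3 V5 V2 V8 V1]]], Split V4 V5 V7 [Split V3 V7
     V8 [Split V3 V4 V8 [Refer 6 V4 V5 V8 V7 V3 V2 V6 V1]]]]]]]], Cut V1 V6 V2 V5 V7 V3]]]"

text \<open>The hexagon in the link of \<open>V2\<close> is completed by a Moebius band to a
  projective plane with seven vertices. \<open>pattern_6\<close> has the same star of
  \<open>V2\<close> and differs only in the second facet at the triangle 134.\<close>

definition pattern_5 :: "vertex list list" where
  "pattern_5 =
     [[V1, V2, V3, V4], [V1, V2, V4, V5], [V1, V2, V5, V6], [V1, V2, V6, V7],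
     [V1, V2, V7, V8], [V1, V2, V3, V8], [V2, V3, V4, V5], [V2, V5, V6, V8],
     [V2, V3, V5, V7], [V2, V5, V7, V8], [V2, V3, V6, V8], [V2, V3, V6, V7],
     [V1, V3, V4, V6]]"

definition cert_5 :: cert where
  "cert_5 =
     Split V1 V4 V5 [Split V1 V6 V7 [Split V1 V3 V8 [Cut V1 V5 V2 V4 V6 V3, Split V3 V5 V7
     [Split V3 V7 V8 [Split V3 V4 V6 [Split V5 V7 V8 [Split V4 V5 V6 [Refer 18 V7 V5 V3 V1
     V4 V8 V6 V2], Cut V6 V7 V1 V2 V3 V5]]], Refer 21 V6 V1 V3 V5 V4 V8 V2 V7]], Split V1 V3
     V6 [Split V5 V6 V8 [Split V6 V7 V8 [Split V3 V4 V6 [Split V3 V4 V5 [Split V4 V5 V8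
     [Refer 15 V8 V4 V2 V1 V5 V7 V3 V6], Cut V3 V8 V1 V2 V6 V4]]], Refer 21 V3 V1 V6 V5 V4
     V7 V2 V8]]], Split V1 V4 V6 [Split V1 V5 V6 [Split V3 V4 V5 [Cut V3 V6 V1 V4 V5 V2, Cut
     V3 V5 V2 V4 V7 V1, Split V1 V7 V8 [Split V1 V5 V7 [Split V3 V5 V6 [Split V3 V6 V7
     [Split V3 V4 V8 [Split V5 V7 V8 [Refer 6 V4 V5 V1 V2 V7 V8 V6 V3]]]]], Split V1 V3 V5
     [Split V5 V6 V8 [Split V3 V5 V7 [Split V3 V6 V8 [Split V4 V5 V7 [Refer 6 V4 V1 V3 V2 V6
     V7 V8 V5]]]]]]], Split V1 V3 V6 [Split V1 V7 V8 [Refer 21 V7 V5 V1 V3 V4 V6 V2 V8]]],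
     Split V1 V4 V7 [Split V1 V6 V7 [Split V1 V5 V6 [Split V1 V3 V8 [Split V1 V5 V7 [Split
     V5 V7 V8 [Split V3 V5 V8 [Split V3 V6 V8 [Refer 6 V4 V3 V5 V2 V8 V6 V7 V1]]]]]], Cut V1
     V6 V2 V5 V7 V3]]], Split V1 V4 V6 [Split V1 V4 V8 [Split V1 V5 V6 [Split V1 V3 V8
     [Split V3 V4 V5 [Cut V3 V6 V1 V4 V5 V2, Cut V3 V5 V2 V4 V7 V1, Cut V5 V8 V1 V3 V4 V2]],
     Split V1 V3 V8 [Split V5 V7 V8 [Cut V3 V8 V1 V2 V6 V5, Split V3 V4 V5 [Cut V5 V6 V1 V2
     V8 V3, Split V3 V6 V7 [Refer 12 V6 V4 V2 V8 V7 V3 V5 V1]]]]]], Split V1 V5 V6 [Split V1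
     V6 V7 [Split V6 V7 V8 [Cut V3 V6 V2 V7 V8 V1, Cut V6 V8 V1 V4 V7 V2, Cut V5 V8 V2 V6 V7
     V1]], Cut V1 V6 V2 V5 V7 V3, Cut V1 V8 V4 V5 V6 V2]]]"

definition pattern_6 :: "vertex list list" where
  "pattern_6 =
     [[V1, V2, V3, V4], [V1, V2, V4, V5], [V1, V2, V5, V6], [V1, V2, V6, V7],
     [V1, V2, V7, V8], [V1, V2, V3, V8], [V2, V3, V4, V5], [V2, V5, V6, V8],
     [V2, V3, V5, V7], [V2, V5, V7, V8], [V2, V3, V6, V8], [V2, V3, V6, V7],
     [V1, V3, V4, V8]]"

definition cert_6 :: cert where
  "cert_6 =
     Split V1 V4 V5 [Split V1 V4 V8 [Split V1 V6 V8 [Split V5 V6 V8 [Cut V6 V8 V2 V3 V5 V1,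
     Split V3 V6 V8 [Split V3 V4 V5 [Split V4 V5 V8 [Split V3 V7 V8 [Refer 16 V6 V4 V2 V7 V5
     V1 V3 V8]], Refer 21 V2 V3 V5 V6 V7 V8 V1 V4]], Split V3 V6 V8 [Split V3 V4 V5 [Refer
     21 V2 V5 V3 V8 V7 V6 V1 V4, Split V3 V4 V6 [Split V5 V6 V7 [Refer 16 V8 V4 V2 V7 V3 V1
     V5 V6]]]]]], Split V1 V4 V6 [Split V3 V4 V5 [Split V5 V6 V8 [Split V3 V6 V7 [Split V3
     V4 V8 [Split V3 V5 V8 [Refer 18 V8 V1 V3 V5 V4 V7 V6 V2]]], Split V3 V5 V6 [Split V4 V6
     V7 [Split V3 V6 V8 [Refer 15 V7 V4 V2 V5 V1 V8 V3 V6]]]], Split V3 V4 V8 [Split V3 V4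
     V7 [Split V4 V5 V6 [Split V4 V5 V7 [Refer 17 V7 V8 V2 V6 V5 V1 V3 V4]]], Split V5 V7 V8
     [Split V3 V7 V8 [Split V4 V6 V7 [Refer 16 V8 V4 V2 V6 V1 V3 V5 V7]]]], Split V3 V6 V8
     [Split V5 V7 V8 [Split V4 V5 V6 [Split V3 V5 V6 [Refer 18 V6 V1 V5 V3 V4 V7 V8 V2]]],
     Split V3 V5 V8 [Split V4 V7 V8 [Split V5 V6 V8 [Refer 15 V7 V4 V2 V3 V1 V6 V5
     V8]]]]]]], Split V1 V4 V8 [Split V1 V4 V7 [Split V1 V7 V8 [Split V1 V6 V8 [Split V3 V5
     V7 [Split V3 V6 V8 [Split V3 V4 V7 [Refer 18 V8 V3 V1 V5 V4 V6 V7 V2], Cut V7 V8 V1 V2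
     V5 V3], Cut V5 V6 V1 V2 V8 V3]]]], Split V1 V6 V7 [Cut V1 V3 V2 V4 V8 V6, Split V3 V5
     V7 [Split V5 V7 V8 [Split V3 V6 V7 [Split V3 V4 V8 [Split V6 V7 V8 [Refer 15 V6 V4 V2
     V5 V3 V8 V1 V7]], Refer 21 V1 V5 V7 V3 V4 V8 V2 V6]], Split V5 V7 V8 [Split V3 V4 V5
     [Split V5 V6 V8 [Split V3 V6 V8 [Refer 12 V7 V4 V2 V6 V8 V1 V3 V5]], Refer 21 V2 V3 V5
     V7 V6 V8 V1 V4]], Cut V5 V7 V2 V3 V8 V1]]], Split V1 V7 V8 [Split V1 V5 V6 [Cut V1 V3
     V2 V4 V8 V5, Split V5 V6 V8 [Split V4 V5 V8 [Refer 20 V1 V2 V3 V4 V5 V8 V6 V7], Split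
     V3 V6 V8 [Split V3 V4 V5 [Refer 21 V2 V1 V5 V6 V7 V8 V3 V4, Split V5 V6 V7 [Split V3 V4
     V6 [Refer 18 V7 V3 V5 V1 V4 V6 V8 V2]]], Cut V7 V8 V1 V2 V5 V3]]], Split V1 V5 V8
     [Split V5 V7 V8 [Split V4 V5 V8 [Refer 20 V1 V2 V3 V4 V5 V8 V6 V7], Split V3 V4 V5 [Cut
     V5 V6 V1 V2 V8 V3, Split V3 V6 V8 [Split V6 V7 V8 [Split V3 V4 V7 [Refer 15 V6 V4 V2 V1
     V3 V7 V5 V8]], Refer 21 V5 V1 V8 V3 V4 V7 V2 V6]]]]]]"

text \<open>Up to reflection of the hexagon the second facet at 234 has two positions: its fourth
  vertex is next to the edge 34 on the cycle, as here, or one step further, as in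
  \<open>pattern_13\<close>.\<close>

definition pattern_7 :: "vertex list list" where
  "pattern_7 =
     [[V1, V2, V3, V4], [V1, V2, V4, V5], [V1, V2, V5, V6], [V1, V2, V6, V7],
     [V1, V2, V7, V8], [V1, V2, V3, V8], [V2, V3, V4, V5]]"

definition cert_7 :: cert where
  "cert_7 =
     Split V2 V5 V6 [Refer 26 V1 V2 V3 V4 V5 V6 V7 V8, Split V2 V3 V5 [Split V2 V3 V7 [Split
     V1 V3 V4 [Refer 19 V1 V2 V3 V4 V5 V6 V7 V8, Split V1 V4 V5 [Split V1 V6 V7 [Split V1 V3
     V8 [Cut V1 V5 V2 V4 V6 V3, Refer 19 V1 V2 V7 V8 V3 V4 V5 V6], Split V1 V3 V6 [Split V3
     V4 V5 [Refer 20 V1 V2 V3 V4 V5 V6 V7 V8, Split V3 V4 V6 [Split V3 V7 V8 [Refer 20 V1 V2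
     V7 V8 V3 V6 V4 V5], Split V3 V4 V7 [Split V4 V5 V6 [Refer 21 V1 V6 V4 V3 V8 V7 V2 V5,
     Split V4 V5 V7 [Split V6 V7 V8 [Refer 2 V5 V6 V1 V2 V7 V8 V3 V4]]]]], Split V3 V4 V6
     [Split V3 V4 V8 [Split V3 V6 V8 [Split V3 V6 V7 [Split V4 V5 V6 [Split V6 V7 V8 [Refer
     16 V4 V2 V6 V8 V1 V5 V7 V3]]]]], Split V3 V7 V8 [Split V4 V5 V6 [Split V4 V5 V8 [Split
     V6 V7 V8 [Refer 2 V7 V6 V1 V2 V5 V4 V3 V8]], Refer 21 V2 V1 V5 V8 V7 V6 V3 V4]]]]]],
     Refer 27 V1 V2 V3 V4 V5 V6 V7 V8, Split V1 V4 V6 [Split V1 V4 V8 [Split V1 V5 V6 [Split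
     V1 V3 V8 [Split V3 V4 V5 [Split V3 V5 V7 [Split V5 V6 V7 [Refer 21 V2 V7 V5 V3 V8 V4 V1
     V6, Split V4 V7 V8 [Split V4 V5 V6 [Refer 14 V4 V3 V1 V7 V2 V6 V8 V5]]]], Cut V3 V5 V2
     V4 V7 V1, Split V3 V5 V7 [Split V3 V7 V8 [Refer 21 V2 V7 V3 V5 V6 V4 V1 V8, Split V4 V6
     V7 [Split V3 V4 V8 [Refer 14 V4 V5 V1 V7 V2 V8 V6 V3]]]]]], Split V1 V3 V8 [Split V3 V4
     V5 [Split V4 V5 V8 [Split V5 V6 V7 [Split V4 V6 V7 [Split V3 V6 V7 [Refer 12 V4 V2 V6
     V8 V3 V5 V7 V1]]], Split V4 V5 V6 [Split V5 V6 V8 [Split V3 V7 V8 [Refer 11 V4 V3 V1 V7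
     V2 V6 V8 V5]]]], Split V3 V4 V6 [Split V5 V6 V7 [Split V3 V6 V7 [Split V4 V7 V8 [Refer
     11 V8 V3 V1 V5 V2 V6 V4 V7]]], Split V3 V4 V7 [Split V4 V5 V8 [Split V4 V5 V7 [Refer 12
     V8 V2 V4 V6 V7 V3 V5 V1]]]], Split V3 V4 V6 [Split V3 V4 V8 [Split V3 V6 V8 [Split V5
     V6 V7 [Refer 11 V4 V5 V1 V7 V2 V8 V6 V3]]], Split V3 V7 V8 [Split V4 V7 V8 [Split V5 V7
     V8 [Refer 12 V4 V2 V8 V6 V5 V3 V7 V1]]]]]]]], Split V1 V5 V6 [Split V1 V6 V7 [Split V1
     V3 V8 [Split V3 V4 V5 [Split V3 V5 V7 [Split V5 V6 V7 [Split V4 V5 V8 [Split V6 V7 V8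
     [Refer 16 V3 V7 V1 V4 V8 V2 V6 V5]], Refer 21 V1 V6 V8 V3 V4 V5 V2 V7]], Cut V3 V5 V2
     V4 V7 V1, Split V3 V5 V7 [Split V3 V7 V8 [Split V3 V4 V6 [Split V6 V7 V8 [Refer 16 V5
     V7 V1 V4 V6 V2 V8 V3]], Refer 21 V1 V8 V6 V5 V4 V3 V2 V7]]]]], Cut V1 V6 V2 V5 V7 V3,
     Cut V1 V8 V4 V5 V6 V2]]], Split V1 V4 V5 [Split V1 V4 V7 [Split V1 V7 V8 [Refer 19 V1
     V2 V7 V8 V3 V4 V5 V6, Cut V1 V5 V2 V4 V6 V7], Split V1 V4 V6 [Split V1 V6 V7 [Split V1
     V6 V8 [Split V3 V5 V7 [Split V3 V7 V8 [Split V5 V6 V7 [Refer 21 V1 V6 V4 V3 V8 V7 V2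
     V5, Split V4 V7 V8 [Split V4 V5 V6 [Refer 16 V3 V5 V1 V8 V4 V2 V6 V7]]]], Split V3 V7
     V8 [Split V3 V4 V5 [Refer 21 V1 V4 V6 V7 V8 V3 V2 V5, Split V3 V6 V8 [Split V4 V5 V6
     [Refer 16 V7 V5 V1 V8 V6 V2 V4 V3]]]], Cut V3 V7 V2 V5 V8 V1]]]]], Split V3 V5 V7 [Cut
     V1 V7 V3 V4 V5 V2, Refer 20 V1 V2 V3 V4 V5 V7 V6 V8, Cut V5 V7 V2 V3 V6 V1, Cut V3 V7
     V2 V5 V8 V1], Refer 27 V1 V2 V5 V4 V3 V8 V7 V6], Split V1 V4 V5 [Split V1 V4 V8 [Split
     V1 V6 V8 [Split V3 V4 V5 [Split V5 V6 V7 [Refer 21 V1 V4 V6 V7 V8 V3 V2 V5, Split V3 V5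
     V6 [Split V3 V6 V8 [Refer 21 V2 V5 V3 V8 V7 V6 V1 V4]]], Split V3 V4 V8 [Split V3 V4 V7
     [Split V3 V7 V8 [Refer 21 V2 V7 V3 V4 V5 V6 V1 V8]], Refer 21 V1 V8 V4 V5 V6 V7 V2 V3],
     Split V3 V7 V8 [Refer 21 V1 V4 V8 V7 V6 V5 V2 V3, Split V3 V5 V8 [Split V5 V6 V8 [Refer
     21 V2 V3 V5 V6 V7 V8 V1 V4]]]]], Split V1 V4 V6 [Split V3 V4 V5 [Split V5 V6 V7 [Refer
     21 V1 V4 V6 V7 V8 V3 V2 V5, Split V3 V5 V6 [Split V3 V5 V8 [Split V3 V4 V8 [Split V4 V7
     V8 [Refer 2 V3 V4 V1 V2 V5 V6 V7 V8]]]]], Split V3 V4 V8 [Split V3 V4 V7 [Split V5 V6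
     V7 [Split V3 V6 V7 [Split V4 V7 V8 [Split V4 V5 V6 [Refer 16 V6 V2 V4 V8 V1 V5 V3
     V7]]]]], Refer 21 V1 V8 V4 V5 V6 V7 V2 V3], Split V3 V7 V8 [Refer 21 V1 V4 V8 V7 V6 V5
     V2 V3, Split V3 V5 V8 [Split V3 V5 V6 [Split V4 V5 V6 [Split V4 V6 V7 [Refer 2 V5 V4 V1
     V2 V3 V8 V7 V6]]]]]]]], Split V1 V4 V8 [Split V1 V4 V7 [Split V1 V7 V8 [Split V1 V6 V8
     [Split V5 V6 V7 [Cut V5 V7 V2 V3 V6 V1, Split V3 V5 V7 [Split V3 V4 V5 [Split V5 V6 V8
     [Split V3 V4 V8 [Refer 16 V7 V3 V1 V6 V8 V2 V4 V5]], Refer 21 V1 V4 V8 V7 V6 V5 V2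
     V3]], Split V3 V5 V7 [Split V3 V7 V8 [Refer 21 V1 V8 V4 V5 V6 V7 V2 V3, Split V4 V6 V7
     [Split V3 V4 V8 [Refer 16 V5 V3 V1 V6 V4 V2 V8 V7]]]]]]]], Split V1 V6 V7 [Cut V1 V3 V2
     V4 V8 V6, Refer 19 V1 V2 V5 V6 V7 V3 V4 V8]], Split V1 V7 V8 [Split V1 V5 V6 [Cut V1 V3
     V2 V4 V8 V5, Refer 19 V1 V2 V5 V6 V7 V3 V4 V8], Split V1 V5 V8 [Split V3 V4 V5 [Split
     V3 V4 V8 [Split V3 V7 V8 [Split V3 V6 V8 [Split V5 V6 V7 [Split V4 V5 V8 [Split V6 V7
     V8 [Refer 16 V4 V2 V8 V6 V1 V3 V7 V5]]]], Split V5 V6 V8 [Refer 21 V2 V1 V5 V6 V7 V8 V3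
     V4]], Split V3 V4 V6 [Split V3 V6 V7 [Split V6 V7 V8 [Split V5 V6 V8 [Refer 2 V7 V8 V1
     V2 V3 V4 V5 V6]]]]], Split V3 V4 V8 [Split V3 V4 V7 [Split V3 V7 V8 [Split V5 V6 V7
     [Split V4 V5 V8 [Refer 2 V3 V8 V1 V2 V7 V6 V5 V4]]]], Refer 21 V1 V8 V4 V5 V6 V7 V2
     V3], Refer 20 V1 V2 V3 V4 V5 V8 V6 V7]]]]]], Refer 25 V1 V2 V5 V4 V3 V8 V7 V6], Split
     V2 V3 V5 [Split V2 V5 V8 [Split V2 V3 V8 [Split V2 V3 V7 [Split V1 V3 V4 [Refer 19 V1
     V2 V3 V4 V5 V6 V7 V8, Refer 28 V1 V2 V3 V4 V5 V6 V7 V8, Refer 28 V3 V2 V1 V4 V5 V7 V6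
     V8, Refer 29 V1 V2 V3 V4 V5 V6 V7 V8]]]], Refer 24 V1 V2 V5 V4 V3 V8 V7 V6]]"

text \<open>Seven-vertex projective planes again: in patterns 8, 9, 10 and 12 the link of
  \<open>V2\<close> is such a surface, completed by the facets other than the last one
  listed.\<close>

definition pattern_8 :: "vertex list list" where
  "pattern_8 =
     [[V1, V2, V3, V4], [V1, V2, V4, V5], [V1, V2, V5, V6], [V1, V2, V6, V7],
     [V1, V2, V7, V8], [V1, V2, V3, V8], [V2, V3, V4, V6], [V2, V4, V5, V7],
     [V2, V4, V6, V7], [V2, V3, V5, V6], [V2, V3, V7, V8], [V2, V3, V5, V7],
     [V1, V3, V4, V5]]"

definition cert_8 :: cert where
  "cert_8 =
     Split V1 V5 V6 [Split V1 V3 V8 [Split V1 V6 V7 [Cut V1 V4 V2 V3 V5 V6, Split V3 V4 V6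
     [Split V3 V6 V8 [Refer 20 V1 V2 V7 V8 V3 V6 V4 V5], Split V4 V6 V7 [Cut V5 V6 V1 V2 V3
     V4, Split V3 V7 V8 [Refer 21 V2 V1 V3 V4 V5 V6 V7 V8, Split V3 V4 V5 [Split V4 V7 V8
     [Refer 18 V5 V7 V3 V1 V8 V4 V6 V2]]]]]], Refer 19 V1 V2 V7 V8 V3 V4 V5 V6], Split V1 V3
     V5 [Split V1 V3 V7 [Refer 19 V1 V2 V7 V8 V3 V4 V5 V6], Split V1 V5 V7 [Split V3 V5 V7
     [Cut V5 V7 V2 V3 V4 V1, Cut V3 V5 V2 V6 V7 V1, Refer 20 V1 V2 V7 V8 V3 V5 V4 V6]]],
     Split V1 V3 V5 [Split V1 V5 V8 [Split V1 V3 V8 [Split V1 V3 V7 [Split V3 V5 V6 [Cut V3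
     V6 V2 V4 V5 V1, Split V3 V4 V6 [Split V3 V7 V8 [Split V3 V4 V5 [Split V4 V5 V7 [Refer 6
     V8 V7 V1 V2 V5 V4 V6 V3]]]]]]]], Split V1 V7 V8 [Cut V1 V4 V2 V3 V5 V7, Split V3 V5 V6
     [Split V3 V5 V7 [Split V4 V5 V7 [Refer 21 V1 V3 V5 V7 V8 V6 V2 V4, Split V6 V7 V8
     [Split V4 V5 V6 [Refer 15 V4 V8 V2 V3 V7 V6 V1 V5]]]], Cut V3 V5 V2 V6 V7 V1, Split V3
     V5 V7 [Split V3 V4 V6 [Refer 21 V1 V5 V3 V6 V8 V7 V2 V4, Split V3 V7 V8 [Split V4 V6 V7
     [Refer 12 V5 V8 V2 V4 V6 V1 V7 V3]]]]]]]]"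

definition pattern_9 :: "vertex list list" where
  "pattern_9 =
     [[V1, V2, V3, V4], [V1, V2, V4, V5], [V1, V2, V5, V6], [V1, V2, V6, V7],
     [V1, V2, V7, V8], [V1, V2, V3, V8], [V2, V3, V4, V6], [V2, V4, V5, V7],
     [V2, V4, V6, V7], [V2, V3, V5, V6], [V2, V5, V7, V8], [V2, V3, V5, V8],
     [V1, V3, V4, V5]]"

definition cert_9 :: cert where
  "cert_9 =
     Split V1 V5 V6 [Split V1 V3 V8 [Split V1 V6 V7 [Cut V1 V4 V2 V3 V5 V6, Split V3 V4 V6
     [Split V3 V6 V8 [Split V5 V7 V8 [Refer 21 V5 V2 V3 V6 V4 V1 V7 V8, Split V3 V7 V8
     [Split V3 V5 V8 [Refer 16 V1 V7 V3 V5 V8 V6 V4 V2]]]], Split V4 V6 V7 [Cut V5 V6 V1 V2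
     V3 V4, Split V5 V7 V8 [Split V3 V4 V5 [Split V3 V4 V8 [Refer 15 V1 V7 V3 V5 V8 V6 V4
     V2]], Refer 21 V1 V6 V8 V5 V3 V4 V2 V7]]]], Split V1 V3 V6 [Split V3 V4 V6 [Refer 21 V5
     V1 V3 V4 V8 V7 V2 V6, Split V3 V6 V7 [Split V3 V5 V8 [Split V4 V5 V7 [Cut V5 V6 V1 V2
     V3 V4, Split V6 V7 V8 [Refer 15 V5 V7 V3 V1 V8 V4 V6 V2]]]]]]], Split V1 V3 V5 [Split
     V1 V3 V7 [Split V4 V5 V7 [Cut V3 V5 V1 V4 V7 V2, Split V5 V7 V8 [Refer 20 V2 V1 V7 V8
     V3 V5 V4 V6], Cut V5 V7 V2 V4 V8 V1]], Split V1 V5 V7 [Refer 20 V1 V7 V2 V8 V5 V3 V4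
     V6]], Split V1 V3 V5 [Split V1 V5 V8 [Split V1 V3 V8 [Split V1 V3 V7 [Split V4 V5 V7
     [Cut V3 V5 V1 V4 V7 V2, Split V3 V5 V7 [Split V3 V4 V6 [Split V3 V5 V8 [Split V5 V6 V8
     [Refer 6 V4 V2 V3 V1 V6 V7 V8 V5]]]]]]]], Split V1 V7 V8 [Cut V1 V4 V2 V3 V5 V7, Split
     V3 V5 V6 [Refer 21 V8 V1 V5 V6 V7 V4 V2 V3, Split V3 V4 V5 [Split V5 V7 V8 [Refer 21 V3
     V2 V5 V6 V4 V7 V1 V8]]]]]]"

definition pattern_10 :: "vertex list list" where
  "pattern_10 =
     [[V1, V2, V3, V4], [V1, V2, V4, V5], [V1, V2, V5, V6], [V1, V2, V6, V7],
     [V1, V2, V7, V8], [V1, V2, V3, V8], [V2, V3, V4, V6], [V2, V4, V5, V7],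
     [V2, V4, V6, V7], [V2, V3, V5, V6], [V2, V5, V7, V8], [V2, V3, V5, V8],
     [V1, V3, V4, V8]]"

definition cert_10 :: cert where
  "cert_10 =
     Split V1 V4 V5 [Split V1 V4 V8 [Split V1 V6 V8 [Split V3 V4 V6 [Split V4 V6 V7 [Split
     V4 V5 V7 [Split V3 V4 V8 [Split V5 V7 V8 [Refer 14 V5 V6 V2 V8 V1 V3 V7 V4]], Refer 21
     V1 V6 V8 V5 V3 V4 V2 V7]], Cut V4 V6 V2 V3 V7 V1, Split V4 V6 V7 [Split V3 V5 V6 [Split
     V6 V7 V8 [Split V3 V5 V8 [Refer 14 V5 V4 V2 V8 V1 V7 V3 V6]], Refer 21 V1 V4 V8 V5 V7
     V6 V2 V3]]]], Split V1 V4 V6 [Split V3 V4 V6 [Refer 21 V7 V1 V4 V3 V8 V5 V2 V6, Split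
     V4 V5 V6 [Split V4 V7 V8 [Refer 21 V6 V1 V4 V5 V3 V8 V2 V7]]]]], Split V1 V4 V8 [Split
     V1 V4 V7 [Split V1 V7 V8 [Refer 21 V6 V4 V1 V8 V3 V5 V2 V7]], Split V1 V6 V7 [Cut V1 V3
     V2 V4 V8 V6, Split V4 V6 V7 [Split V4 V7 V8 [Split V5 V7 V8 [Refer 21 V5 V2 V3 V4 V6 V1
     V7 V8, Split V3 V6 V7 [Split V3 V5 V8 [Refer 16 V1 V3 V7 V5 V8 V4 V6 V2]]]], Split V3
     V4 V6 [Cut V4 V5 V1 V2 V7 V3, Split V5 V7 V8 [Split V5 V6 V7 [Split V6 V7 V8 [Refer 15
     V1 V3 V7 V5 V8 V4 V6 V2]], Refer 22 V1 V2 V7 V6 V4 V5 V3 V8]]]]], Split V1 V7 V8 [Split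
     V1 V5 V6 [Cut V1 V3 V2 V4 V8 V5, Split V4 V5 V7 [Split V5 V6 V7 [Split V3 V5 V8 [Refer
     21 V7 V2 V5 V4 V6 V3 V1 V8]], Refer 21 V8 V1 V5 V4 V3 V6 V2 V7]], Split V1 V5 V8 [Split
     V5 V7 V8 [Cut V5 V8 V2 V3 V7 V1, Split V3 V5 V8 [Split V3 V4 V8 [Refer 21 V1 V4 V8 V5
     V7 V6 V2 V3, Split V6 V7 V8 [Split V3 V4 V6 [Refer 11 V1 V4 V8 V6 V3 V5 V7 V2]]]],
     Split V3 V5 V8 [Split V3 V4 V6 [Refer 21 V1 V8 V4 V6 V7 V5 V2 V3, Split V5 V6 V7 [Split
     V3 V4 V5 [Refer 13 V3 V1 V5 V7 V8 V4 V6 V2]]]]]]]]"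

text \<open>The link of \<open>V2\<close> is the seven-vertex torus, in which any two of the seven
  vertices are adjacent.\<close>

definition pattern_11 :: "vertex list list" where
  "pattern_11 =
     [[V1, V2, V3, V4], [V1, V2, V4, V5], [V1, V2, V5, V6], [V1, V2, V6, V7],
     [V1, V2, V7, V8], [V1, V2, V3, V8], [V2, V3, V4, V6], [V2, V4, V5, V7],
     [V2, V4, V6, V8], [V2, V4, V7, V8], [V2, V3, V6, V7], [V2, V5, V6, V8],
     [V2, V3, V5, V8], [V2, V3, V5, V7], [V1, V3, V4, V5]]"

definition cert_11 :: cert where
  "cert_11 =
     Split V1 V5 V6 [Split V3 V4 V6 [Cut V3 V5 V1 V4 V6 V2, Cut V3 V6 V2 V4 V7 V1, Split V1
     V3 V8 [Split V3 V6 V7 [Split V3 V5 V8 [Split V5 V6 V8 [Split V1 V6 V8 [Split V4 V5 V7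
     [Refer 6 V7 V5 V6 V3 V8 V4 V1 V2]]]]], Split V1 V3 V6 [Split V3 V5 V6 [Split V3 V5 V7
     [Split V3 V4 V8 [Refer 5 V6 V5 V7 V1 V4 V8 V3 V2]]]]]], Split V1 V3 V5 [Split V1 V3 V7
     [Split V4 V5 V7 [Split V3 V6 V7 [Split V3 V7 V8 [Split V3 V4 V5 [Split V4 V5 V6 [Refer
     6 V6 V7 V4 V3 V5 V1 V8 V2]]], Split V4 V6 V7 [Split V3 V4 V6 [Split V5 V6 V8 [Refer 6
     V8 V3 V6 V5 V7 V1 V4 V2]]]], Split V5 V6 V7 [Split V3 V7 V8 [Split V3 V5 V8 [Split V3
     V6 V8 [Refer 6 V4 V5 V8 V7 V3 V1 V6 V2]]]]]], Split V1 V5 V7 [Split V5 V6 V8 [Split V5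
     V7 V8 [Split V3 V5 V7 [Split V3 V4 V5 [Refer 5 V6 V3 V8 V4 V1 V7 V5 V2]]], Cut V5 V7 V1
     V6 V8 V2]]], Split V1 V3 V5 [Split V1 V5 V8 [Split V1 V3 V8 [Split V1 V3 V7 [Split V3
     V5 V8 [Split V5 V7 V8 [Split V3 V4 V6 [Refer 6 V4 V3 V5 V1 V8 V6 V7 V2]]]]]], Split V1
     V7 V8 [Cut V1 V4 V2 V3 V5 V7, Split V4 V6 V8 [Cut V3 V8 V1 V2 V5 V4, Split V3 V6 V7
     [Split V4 V5 V7 [Refer 7 V3 V1 V6 V4 V5 V8 V7 V2], Cut V5 V6 V1 V2 V8 V3]]]]]"

definition pattern_12 :: "vertex list list" where
  "pattern_12 =
     [[V1, V2, V3, V4], [V1, V2, V4, V5], [V1, V2, V5, V6], [V1, V2, V6, V7],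
     [V1, V2, V7, V8], [V1, V2, V3, V8], [V2, V3, V4, V6], [V2, V4, V5, V8],
     [V2, V4, V6, V7], [V2, V4, V7, V8], [V2, V5, V6, V8], [V2, V3, V6, V8],
     [V1, V3, V4, V6]]"

definition cert_12 :: cert where
  "cert_12 =
     Split V1 V4 V5 [Split V1 V6 V7 [Split V1 V3 V8 [Cut V1 V5 V2 V4 V6 V3, Split V4 V6 V7
     [Split V4 V5 V8 [Cut V3 V4 V1 V2 V6 V5, Split V5 V6 V8 [Split V3 V6 V7 [Split V3 V7 V8
     [Refer 12 V1 V8 V6 V4 V7 V3 V5 V2]], Refer 21 V1 V2 V6 V7 V3 V8 V4 V5]], Split V4 V5 V6
     [Refer 20 V2 V1 V4 V5 V6 V8 V3 V7]]], Split V1 V3 V6 [Refer 20 V1 V4 V2 V3 V6 V8 V5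
     V7]], Split V1 V4 V6 [Split V4 V7 V8 [Cut V3 V4 V1 V2 V6 V7, Split V1 V5 V6 [Split V3
     V6 V8 [Split V1 V7 V8 [Split V1 V5 V7 [Split V5 V7 V8 [Refer 12 V6 V8 V1 V4 V5 V3 V7
     V2]], Refer 21 V6 V2 V4 V5 V3 V8 V1 V7], Cut V6 V7 V1 V2 V4 V3], Split V1 V3 V6 [Refer
     20 V1 V4 V2 V3 V6 V8 V5 V7]]], Split V1 V4 V7 [Split V3 V6 V8 [Cut V1 V6 V3 V4 V8 V2,
     Cut V6 V8 V2 V3 V5 V1, Cut V7 V8 V1 V2 V4 V3]]], Split V1 V4 V6 [Split V1 V4 V8 [Refer
     20 V1 V6 V2 V7 V4 V8 V3 V5], Split V4 V6 V8 [Split V1 V6 V8 [Cut V1 V6 V3 V4 V8 V2, Cut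
     V1 V8 V4 V5 V6 V2, Cut V6 V8 V1 V4 V7 V2]]]]"

definition pattern_13 :: "vertex list list" where
  "pattern_13 =
     [[V1, V2, V3, V4], [V1, V2, V4, V5], [V1, V2, V5, V6], [V1, V2, V6, V7],
     [V1, V2, V7, V8], [V1, V2, V3, V8], [V2, V3, V4, V6]]"

definition cert_13 :: cert where
  "cert_13 =
     Split V2 V4 V5 [Refer 26 V1 V2 V6 V5 V4 V3 V8 V7, Split V2 V4 V6 [Split V2 V5 V6 [Split
     V2 V7 V8 [Split V2 V5 V7 [Split V1 V3 V4 [Refer 31 V1 V2 V3 V4 V5 V6 V7 V8, Refer 31 V3
     V2 V1 V4 V6 V5 V7 V8, Split V1 V4 V5 [Split V1 V4 V7 [Split V1 V7 V8 [Refer 19 V1 V2 V7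
     V8 V3 V4 V5 V6, Cut V1 V5 V2 V4 V6 V7], Split V1 V4 V6 [Split V1 V6 V7 [Split V4 V5 V6
     [Cut V3 V6 V2 V4 V5 V1, Cut V4 V7 V2 V5 V6 V1, Cut V4 V6 V1 V5 V8 V2]]]], Split V3 V5
     V7 [Cut V1 V7 V3 V4 V5 V2, Split V4 V6 V7 [Refer 21 V5 V1 V7 V6 V8 V3 V2 V4, Split V3
     V4 V7 [Split V1 V3 V7 [Split V1 V7 V8 [Split V5 V6 V7 [Split V1 V5 V6 [Split V1 V3 V8
     [Split V3 V4 V6 [Refer 6 V8 V1 V3 V2 V6 V5 V4 V7]]]]]]]], Cut V3 V7 V2 V5 V8 V1], Split
     V1 V4 V7 [Split V1 V4 V8 [Split V1 V5 V6 [Split V1 V6 V8 [Split V1 V7 V8 [Split V1 V3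
     V7 [Split V3 V4 V6 [Split V4 V5 V7 [Split V3 V4 V7 [Refer 6 V8 V3 V7 V2 V4 V6 V5
     V1]]]]]], Cut V1 V8 V4 V5 V6 V2]], Split V3 V7 V8 [Cut V4 V7 V1 V3 V8 V2, Cut V3 V7 V2
     V5 V8 V1, Split V1 V6 V7 [Split V3 V5 V7 [Split V4 V6 V7 [Split V1 V3 V8 [Split V1 V3
     V6 [Split V3 V4 V6 [Split V3 V4 V5 [Refer 6 V8 V1 V7 V2 V4 V5 V6 V3]]], Cut V3 V6 V1 V7
     V8 V2]]], Split V1 V3 V7 [Split V3 V4 V7 [Split V4 V5 V7 [Split V1 V5 V8 [Split V6 V7
     V8 [Split V3 V5 V6 [Refer 6 V8 V3 V1 V2 V5 V6 V4 V7]]]]]]]]]], Refer 29 V1 V2 V3 V8 V7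
     V6 V5 V4]], Split V2 V3 V5 [Split V1 V3 V4 [Refer 32 V1 V2 V3 V4 V5 V6 V7 V8, Split V1
     V4 V5 [Split V1 V6 V7 [Split V1 V3 V8 [Cut V1 V5 V2 V4 V6 V3, Split V4 V6 V7 [Refer 21
     V3 V1 V6 V7 V8 V5 V2 V4, Split V4 V5 V6 [Split V4 V5 V7 [Cut V3 V4 V1 V2 V6 V5, Split
     V3 V7 V8 [Split V3 V5 V6 [Refer 14 V4 V1 V6 V8 V3 V5 V7 V2]]]]]], Split V1 V3 V6 [Split
     V4 V6 V7 [Refer 21 V3 V1 V6 V7 V8 V5 V2 V4, Split V4 V5 V6 [Split V3 V6 V8 [Refer 21 V4
     V1 V6 V5 V7 V8 V2 V3]]]]], Split V1 V4 V6 [Refer 21 V3 V6 V1 V5 V8 V7 V2 V4, Split V1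
     V4 V7 [Split V4 V6 V7 [Split V1 V6 V7 [Split V1 V5 V6 [Split V1 V3 V8 [Split V1 V5 V7
     [Split V3 V5 V6 [Split V5 V7 V8 [Refer 6 V4 V2 V7 V5 V6 V3 V8 V1]]]]], Cut V1 V6 V2 V5
     V7 V3]]]], Split V1 V4 V6 [Split V1 V4 V8 [Split V4 V5 V7 [Cut V3 V4 V1 V2 V6 V5, Refer
     21 V6 V1 V4 V5 V3 V8 V2 V7]], Split V1 V5 V6 [Split V1 V6 V7 [Split V1 V3 V8 [Refer 21
     V4 V6 V1 V8 V7 V5 V2 V3]], Cut V1 V6 V2 V5 V7 V3, Cut V1 V8 V4 V5 V6 V2]]], Split V1 V4
     V5 [Split V1 V4 V7 [Split V1 V7 V8 [Split V3 V4 V6 [Refer 21 V7 V1 V4 V3 V8 V5 V2 V6,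
     Split V4 V5 V6 [Split V3 V5 V6 [Cut V6 V7 V1 V2 V4 V3, Split V3 V7 V8 [Split V4 V5 V7
     [Refer 14 V6 V1 V4 V8 V7 V5 V3 V2]]]]], Cut V1 V5 V2 V4 V6 V7], Split V1 V4 V6 [Split
     V1 V6 V7 [Split V4 V5 V6 [Cut V3 V6 V2 V4 V5 V1, Cut V4 V7 V2 V5 V6 V1, Cut V4 V6 V1 V5
     V8 V2]]]], Split V4 V6 V7 [Refer 21 V5 V1 V7 V6 V8 V3 V2 V4, Split V3 V4 V7 [Split V3
     V4 V6 [Cut V4 V5 V1 V2 V7 V3, Split V1 V7 V8 [Split V1 V6 V7 [Split V5 V7 V8 [Split V3
     V5 V8 [Refer 15 V5 V3 V7 V1 V8 V6 V4 V2]]], Cut V7 V8 V1 V2 V5 V3, Cut V1 V7 V2 V6 V8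
     V3]]]], Split V1 V4 V7 [Split V1 V4 V8 [Split V1 V5 V6 [Split V1 V6 V8 [Split V1 V7 V8
     [Split V1 V3 V7 [Split V3 V4 V6 [Split V4 V5 V7 [Split V3 V5 V8 [Refer 6 V6 V2 V3 V5 V4
     V7 V8 V1]]]]]], Cut V1 V8 V4 V5 V6 V2]], Split V1 V6 V7 [Split V1 V3 V8 [Split V1 V3 V6
     [Split V3 V4 V6 [Refer 21 V5 V1 V3 V4 V8 V7 V2 V6, Cut V3 V8 V1 V2 V5 V4]], Split V1 V5
     V8 [Split V3 V4 V6 [Cut V3 V6 V2 V4 V5 V1, Split V4 V5 V7 [Split V3 V5 V6 [Refer 13 V3
     V5 V1 V7 V8 V6 V4 V2]], Split V3 V5 V6 [Split V4 V6 V7 [Cut V4 V7 V2 V5 V6 V1, Split V4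
     V5 V7 [Split V3 V4 V8 [Split V5 V7 V8 [Refer 9 V4 V6 V2 V8 V7 V3 V1 V5]]]]]]]], Split
     V1 V3 V7 [Split V1 V5 V8 [Split V3 V5 V6 [Split V3 V5 V7 [Split V4 V6 V7 [Split V5 V7
     V8 [Split V4 V5 V8 [Refer 6 V6 V2 V7 V1 V4 V3 V8 V5]]]], Cut V5 V7 V1 V3 V6 V2]]]]]],
     Refer 33 V1 V2 V3 V4 V5 V6 V7 V8]]], Split V2 V3 V6 [Split V2 V7 V8 [Split V1 V3 V4
     [Refer 33 V1 V2 V4 V5 V6 V7 V8 V3, Split V1 V4 V5 [Split V1 V6 V7 [Split V1 V3 V8 [Cut
     V1 V5 V2 V4 V6 V3, Split V4 V6 V7 [Refer 21 V3 V1 V6 V7 V8 V5 V2 V4, Split V4 V5 V6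
     [Split V3 V6 V8 [Refer 21 V4 V2 V6 V7 V5 V8 V1 V3]]]], Split V1 V3 V6 [Refer 20 V1 V4
     V2 V3 V6 V8 V5 V7]], Split V1 V4 V6 [Refer 21 V3 V6 V1 V5 V8 V7 V2 V4, Split V1 V4 V7
     [Split V4 V6 V7 [Split V1 V6 V7 [Split V1 V5 V6 [Split V1 V3 V8 [Split V3 V6 V8 [Split
     V5 V7 V8 [Split V1 V5 V7 [Refer 6 V5 V2 V8 V6 V7 V4 V3 V1]]]]], Cut V1 V6 V2 V5 V7
     V3]]]], Split V1 V4 V6 [Split V1 V4 V8 [Split V4 V5 V7 [Cut V3 V4 V1 V2 V6 V5, Refer 21
     V6 V1 V4 V5 V3 V8 V2 V7]], Split V1 V5 V6 [Split V1 V6 V7 [Split V1 V3 V8 [Split V4 V6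
     V7 [Split V4 V6 V8 [Split V3 V6 V8 [Split V5 V7 V8 [Split V3 V5 V6 [Refer 6 V7 V2 V8 V1
     V5 V4 V3 V6]]]], Cut V6 V8 V1 V4 V7 V2]]], Cut V1 V6 V2 V5 V7 V3, Cut V1 V8 V4 V5 V6
     V2]]], Split V1 V4 V5 [Split V1 V4 V7 [Split V1 V7 V8 [Split V3 V4 V6 [Split V5 V6 V8
     [Split V4 V5 V7 [Refer 22 V1 V2 V4 V3 V6 V7 V8 V5, Split V3 V4 V7 [Split V3 V4 V5
     [Refer 16 V1 V8 V4 V6 V3 V7 V5 V2]]], Cut V6 V7 V1 V2 V4 V5], Split V4 V5 V6 [Split V4
     V5 V7 [Split V3 V4 V8 [Split V3 V7 V8 [Refer 15 V1 V8 V4 V6 V3 V7 V5 V2]], Refer 21 V1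
     V6 V4 V7 V3 V8 V2 V5]]], Cut V1 V5 V2 V4 V6 V7], Split V1 V4 V6 [Split V1 V6 V7 [Split
     V1 V6 V8 [Split V3 V4 V6 [Split V4 V6 V7 [Split V4 V5 V7 [Split V5 V6 V8 [Split V3 V6
     V7 [Refer 6 V5 V2 V4 V1 V7 V8 V3 V6]]]], Cut V4 V6 V2 V3 V7 V1]]]]], Split V4 V6 V7
     [Refer 21 V5 V1 V7 V6 V8 V3 V2 V4, Split V3 V4 V7 [Split V3 V4 V6 [Cut V4 V5 V1 V2 V7
     V3, Split V6 V7 V8 [Cut V1 V7 V2 V6 V8 V3, Split V1 V7 V8 [Refer 21 V6 V2 V8 V7 V5 V1
     V4 V3]]]]], Split V1 V4 V7 [Split V1 V4 V8 [Split V1 V5 V6 [Split V1 V6 V8 [Split V1 V7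
     V8 [Split V1 V3 V7 [Split V3 V4 V6 [Split V4 V6 V8 [Split V4 V5 V7 [Refer 6 V7 V2 V4 V6
     V5 V8 V3 V1]]]]]], Cut V1 V8 V4 V5 V6 V2]], Split V1 V6 V7 [Split V1 V3 V8 [Split V1 V3
     V6 [Split V3 V4 V6 [Split V3 V6 V8 [Split V4 V6 V7 [Cut V4 V7 V2 V5 V6 V1, Split V4 V5
     V7 [Split V5 V7 V8 [Split V5 V6 V8 [Refer 9 V4 V8 V1 V6 V7 V5 V2 V3]]]]], Split V4 V5
     V7 [Split V5 V6 V8 [Refer 13 V4 V6 V1 V8 V3 V7 V5 V2]], Cut V3 V6 V2 V4 V8 V1]], Split
     V1 V5 V8 [Split V3 V4 V6 [Cut V5 V6 V1 V2 V8 V3, Refer 21 V8 V2 V6 V7 V5 V4 V1 V3]]],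
     Split V1 V3 V7 [Split V5 V6 V7 [Cut V5 V7 V1 V3 V6 V2, Cut V4 V7 V2 V5 V6 V1, Cut V5 V8
     V2 V6 V7 V1]]]]], Split V1 V4 V5 [Split V1 V4 V8 [Split V1 V6 V8 [Split V4 V6 V7 [Cut
     V4 V6 V2 V3 V7 V1, Split V3 V4 V6 [Refer 20 V2 V1 V4 V3 V8 V6 V5 V7], Cut V6 V8 V1 V4
     V7 V2]], Split V1 V4 V6 [Split V3 V4 V6 [Split V5 V6 V8 [Split V4 V5 V7 [Split V3 V4 V8
     [Split V3 V5 V8 [Refer 15 V6 V8 V4 V1 V3 V5 V7 V2]], Refer 21 V6 V1 V4 V5 V3 V8 V2 V7],
     Cut V6 V7 V1 V2 V4 V5], Refer 20 V2 V1 V4 V3 V8 V6 V5 V7]]], Split V1 V4 V8 [Split V1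
     V4 V7 [Split V1 V7 V8 [Refer 21 V6 V4 V1 V8 V3 V5 V2 V7]], Split V1 V6 V7 [Cut V1 V3 V2
     V4 V8 V6, Split V4 V6 V7 [Split V4 V7 V8 [Split V3 V6 V8 [Split V3 V7 V8 [Split V5 V6
     V7 [Refer 14 V5 V1 V7 V3 V4 V6 V8 V2]], Refer 21 V1 V2 V8 V7 V5 V6 V4 V3]], Split V3 V4
     V6 [Cut V4 V5 V1 V2 V7 V3, Refer 20 V2 V1 V4 V3 V8 V6 V5 V7]]]], Split V1 V7 V8 [Split
     V1 V5 V6 [Cut V1 V3 V2 V4 V8 V5, Split V4 V5 V7 [Split V5 V6 V7 [Split V4 V6 V7 [Split
     V3 V4 V8 [Split V5 V6 V8 [Refer 14 V7 V1 V5 V3 V8 V6 V4 V2]], Cut V7 V8 V1 V2 V5 V4]],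
     Refer 21 V8 V1 V5 V4 V3 V6 V2 V7]], Split V1 V5 V8 [Split V3 V6 V8 [Refer 20 V2 V1 V4
     V3 V8 V6 V5 V7, Split V4 V6 V7 [Split V5 V7 V8 [Split V3 V4 V8 [Split V3 V4 V7 [Refer
     15 V6 V4 V8 V1 V3 V7 V5 V2]], Refer 21 V6 V1 V8 V7 V3 V4 V2 V5], Cut V5 V6 V1 V2 V8
     V4]]]]]]]]], Split V2 V4 V7 [Split V2 V6 V7 [Split V2 V5 V6 [Split V2 V3 V8 [Split V2
     V5 V7 [Split V1 V3 V4 [Refer 34 V1 V2 V3 V4 V5 V6 V7 V8, Refer 34 V4 V2 V1 V3 V6 V8 V7
     V5, Split V1 V4 V5 [Split V1 V4 V7 [Split V1 V7 V8 [Split V3 V4 V6 [Split V4 V6 V8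
     [Split V4 V5 V7 [Split V3 V6 V7 [Split V5 V6 V8 [Refer 6 V8 V6 V7 V4 V3 V5 V1 V2]]]],
     Cut V4 V7 V1 V3 V6 V2, Cut V4 V6 V2 V3 V8 V1], Cut V1 V5 V2 V4 V6 V7], Split V1 V4 V6
     [Split V1 V6 V7 [Split V1 V6 V8 [Split V3 V4 V6 [Split V3 V6 V8 [Split V4 V5 V7 [Refer
     6 V5 V4 V6 V1 V3 V7 V8 V2]]]]]]], Split V3 V5 V7 [Cut V1 V7 V3 V4 V5 V2, Cut V3 V7 V2
     V5 V6 V1, Split V4 V7 V8 [Split V3 V6 V7 [Split V1 V7 V8 [Split V1 V3 V8 [Split V3 V4
     V8 [Split V1 V5 V6 [Refer 6 V6 V1 V3 V7 V8 V5 V4 V2]]]]], Split V3 V4 V7 [Split V1 V3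
     V7 [Split V1 V6 V7 [Split V5 V7 V8 [Refer 5 V3 V1 V6 V4 V5 V8 V7 V2]]]]]], Split V1 V4
     V7 [Split V1 V4 V8 [Split V1 V5 V6 [Split V1 V6 V8 [Split V1 V7 V8 [Split V1 V3 V7
     [Split V3 V4 V6 [Split V3 V6 V7 [Split V5 V6 V8 [Split V4 V5 V7 [Split V4 V7 V8 [Split
     V3 V5 V8 [Refer 4 V1 V2 V7 V4 V6 V8 V5 V3]]]]], Cut V3 V6 V2 V4 V7 V1]]]], Cut V1 V8 V4
     V5 V6 V2]], Split V1 V6 V7 [Split V3 V4 V7 [Split V1 V3 V8 [Split V1 V3 V6 [Split V3 V4
     V5 [Split V4 V5 V8 [Refer 6 V8 V1 V5 V3 V4 V7 V6 V2]]], Split V1 V5 V8 [Split V4 V6 V8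
     [Split V4 V5 V8 [Refer 6 V6 V3 V8 V4 V1 V7 V5 V2]]]]], Split V1 V3 V7 [Split V1 V5 V8
     [Split V4 V5 V7 [Split V3 V4 V7 [Split V4 V6 V8 [Refer 6 V6 V5 V7 V1 V4 V8 V3
     V2]]]]]]]], Refer 34 V3 V2 V4 V1 V8 V5 V7 V6]]]], Cut V2 V6 V1 V5 V7 V3]]], Split V2 V4
     V6 [Split V2 V4 V8 [Split V2 V5 V6 [Split V2 V3 V8 [Split V1 V3 V4 [Split V1 V5 V6
     [Split V1 V3 V8 [Split V1 V6 V7 [Cut V1 V4 V2 V3 V5 V6, Split V3 V4 V6 [Split V3 V6 V8
     [Split V4 V7 V8 [Refer 21 V1 V2 V8 V3 V5 V4 V6 V7, Split V3 V7 V8 [Split V3 V4 V5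
     [Refer 14 V5 V1 V3 V7 V6 V4 V8 V2]]]], Split V4 V6 V7 [Cut V5 V6 V1 V2 V3 V4, Refer 20
     V2 V1 V6 V7 V8 V4 V3 V5]]], Split V1 V3 V6 [Split V3 V4 V6 [Refer 21 V5 V1 V3 V4 V8 V7
     V2 V6, Split V3 V6 V7 [Split V3 V5 V8 [Refer 21 V6 V1 V3 V8 V7 V4 V2 V5]]]]], Split V1
     V3 V5 [Split V1 V3 V7 [Split V3 V5 V6 [Split V3 V5 V8 [Split V4 V5 V8 [Split V5 V6 V7
     [Split V4 V7 V8 [Refer 14 V4 V3 V2 V7 V1 V6 V8 V5]], Refer 21 V1 V3 V7 V4 V6 V5 V2
     V8]], Split V3 V5 V8 [Split V3 V4 V6 [Refer 21 V1 V5 V7 V4 V8 V3 V2 V6, Split V3 V7 V8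
     [Split V4 V6 V7 [Refer 14 V4 V5 V2 V7 V1 V8 V6 V3]]]], Cut V3 V5 V2 V6 V8 V1]], Split
     V1 V5 V7 [Split V4 V5 V8 [Split V5 V7 V8 [Split V3 V5 V6 [Refer 21 V8 V1 V5 V6 V7 V4 V2
     V3]], Refer 21 V3 V1 V5 V4 V6 V7 V2 V8]]], Split V1 V3 V5 [Split V1 V5 V8 [Split V1 V3
     V8 [Split V3 V4 V5 [Cut V3 V6 V2 V4 V5 V1, Cut V3 V5 V1 V4 V7 V2, Cut V5 V8 V2 V3 V4
     V1]]], Split V1 V7 V8 [Cut V1 V4 V2 V3 V5 V7, Split V4 V5 V8 [Split V4 V7 V8 [Cut V3 V8
     V1 V2 V5 V4, Refer 20 V2 V1 V6 V7 V8 V4 V3 V5], Split V5 V6 V8 [Split V4 V6 V7 [Split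
     V5 V6 V7 [Split V3 V4 V5 [Refer 14 V3 V1 V5 V7 V8 V4 V6 V2]], Refer 21 V1 V2 V8 V5 V3
     V4 V6 V7]]]]]], Refer 32 V4 V2 V6 V3 V1 V5 V8 V7, Split V1 V4 V5 [Split V1 V4 V7 [Split
     V1 V7 V8 [Split V3 V4 V6 [Refer 21 V7 V1 V4 V3 V8 V5 V2 V6, Split V4 V5 V6 [Split V4 V7
     V8 [Refer 21 V6 V2 V4 V3 V5 V8 V1 V7]]], Cut V1 V5 V2 V4 V6 V7], Split V1 V4 V6 [Split
     V1 V6 V7 [Split V1 V6 V8 [Split V4 V5 V8 [Split V4 V6 V8 [Split V4 V6 V7 [Split V3 V5
     V6 [Split V3 V4 V7 [Refer 6 V5 V2 V6 V1 V3 V8 V7 V4]]]], Cut V4 V6 V1 V5 V8 V2]]]]],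
     Split V1 V6 V7 [Split V1 V7 V8 [Split V1 V5 V6 [Split V1 V3 V8 [Split V3 V4 V6 [Refer
     21 V5 V1 V3 V4 V8 V7 V2 V6, Cut V3 V8 V1 V2 V5 V4]], Split V1 V3 V8 [Split V3 V4 V6
     [Cut V3 V6 V2 V4 V5 V1, Split V4 V7 V8 [Split V3 V5 V6 [Refer 13 V3 V7 V2 V5 V4 V6 V8
     V1]], Split V3 V5 V6 [Split V4 V6 V7 [Split V4 V7 V8 [Split V3 V5 V8 [Split V4 V5 V8
     [Refer 9 V3 V5 V2 V7 V6 V8 V1 V4]]], Cut V4 V7 V2 V6 V8 V1]]]]]], Split V1 V7 V8 [Split
     V4 V6 V7 [Split V4 V7 V8 [Split V5 V6 V7 [Refer 21 V1 V5 V7 V4 V8 V3 V2 V6, Split V3 V7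
     V8 [Split V3 V5 V6 [Refer 11 V4 V3 V7 V5 V6 V1 V8 V2]]]], Split V4 V7 V8 [Split V3 V4
     V6 [Refer 21 V1 V7 V5 V3 V8 V4 V2 V6, Split V3 V5 V8 [Split V4 V5 V6 [Refer 13 V3 V7 V2
     V5 V1 V8 V6 V4]]]], Cut V4 V7 V2 V6 V8 V1]], Cut V1 V7 V2 V6 V8 V3], Split V1 V4 V7
     [Split V1 V4 V8 [Split V4 V7 V8 [Split V4 V6 V8 [Split V1 V5 V6 [Split V1 V6 V8 [Split
     V1 V7 V8 [Split V3 V5 V8 [Split V1 V3 V7 [Refer 6 V5 V2 V8 V4 V3 V6 V7 V1]]]], Cut V1
     V8 V4 V5 V6 V2]]]], Split V4 V6 V7 [Split V1 V6 V7 [Refer 21 V8 V2 V4 V3 V5 V6 V1 V7,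
     Split V1 V3 V7 [Split V1 V5 V8 [Refer 21 V7 V4 V1 V3 V6 V5 V2 V8]]], Cut V4 V5 V1 V2 V8
     V6]]], Refer 32 V1 V2 V8 V3 V4 V5 V6 V7]], Split V2 V3 V8 [Split V1 V3 V4 [Split V1 V5
     V6 [Split V1 V3 V8 [Split V1 V6 V7 [Cut V1 V4 V2 V3 V5 V6, Split V3 V4 V6 [Refer 21 V8
     V2 V6 V5 V7 V4 V1 V3, Split V3 V5 V6 [Split V6 V7 V8 [Split V4 V7 V8 [Cut V3 V8 V1 V2
     V6 V4, Split V3 V4 V5 [Refer 12 V1 V4 V6 V8 V5 V3 V7 V2]]]]]], Split V1 V3 V6 [Split V3
     V4 V6 [Split V3 V6 V8 [Split V4 V5 V8 [Refer 21 V8 V2 V6 V3 V7 V1 V4 V5, Split V4 V5 V6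
     [Split V5 V6 V8 [Refer 10 V1 V4 V6 V8 V5 V3 V7 V2]]]], Split V3 V6 V8 [Split V3 V4 V5
     [Split V4 V5 V8 [Split V3 V7 V8 [Refer 11 V1 V5 V2 V7 V4 V6 V8 V3]], Refer 23 V1 V2 V8
     V4 V5 V6 V3 V7]], Cut V3 V6 V2 V4 V8 V1]]], Split V1 V3 V5 [Split V1 V3 V7 [Split V3 V4
     V6 [Split V4 V5 V8 [Split V5 V6 V7 [Split V4 V6 V7 [Split V3 V6 V7 [Refer 12 V4 V1 V6
     V8 V3 V5 V7 V2]]], Split V4 V5 V6 [Split V5 V6 V8 [Split V3 V7 V8 [Refer 11 V4 V3 V2 V7
     V1 V6 V8 V5]]]], Split V3 V4 V5 [Split V4 V7 V8 [Split V5 V6 V7 [Split V3 V7 V8 [Refer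
     11 V8 V3 V2 V5 V1 V6 V4 V7]]], Split V3 V4 V7 [Split V3 V6 V8 [Split V5 V6 V7 [Refer 11
     V4 V5 V2 V7 V1 V8 V6 V3]]]], Split V3 V4 V5 [Split V3 V4 V8 [Split V4 V5 V8 [Split V4
     V5 V7 [Refer 12 V8 V1 V4 V6 V7 V3 V5 V2]]], Split V3 V7 V8 [Split V4 V7 V8 [Split V5 V7
     V8 [Refer 12 V4 V1 V8 V6 V5 V3 V7 V2]]]]]], Split V1 V5 V7 [Split V4 V5 V8 [Split V5 V6
     V8 [Split V3 V4 V6 [Split V3 V4 V8 [Split V3 V6 V8 [Refer 10 V1 V4 V8 V6 V3 V5 V7 V2]],
     Refer 21 V6 V2 V8 V5 V7 V1 V4 V3]], Cut V5 V8 V2 V4 V6 V1, Split V5 V6 V8 [Split V3 V4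
     V5 [Refer 23 V1 V2 V6 V4 V3 V8 V5 V7, Split V3 V4 V6 [Split V5 V6 V7 [Refer 11 V1 V3 V2
     V7 V4 V8 V6 V5]]]]]]], Split V1 V3 V5 [Split V1 V5 V8 [Split V1 V3 V8 [Split V1 V3 V7
     [Split V3 V4 V6 [Cut V5 V6 V1 V2 V8 V3, Split V4 V5 V8 [Cut V3 V8 V1 V2 V6 V4, Split V3
     V4 V5 [Refer 12 V6 V4 V1 V8 V7 V3 V5 V2]]]]]], Split V1 V7 V8 [Cut V1 V4 V2 V3 V5 V7,
     Split V4 V5 V8 [Refer 21 V6 V2 V8 V3 V7 V4 V1 V5, Split V3 V5 V8 [Split V6 V7 V8 [Split
     V4 V6 V7 [Split V3 V4 V5 [Refer 12 V1 V4 V8 V6 V3 V5 V7 V2], Cut V5 V6 V1 V2 V8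
     V4]]]]]]], Refer 35 V1 V2 V3 V4 V5 V6 V7 V8, Split V1 V4 V5 [Split V1 V4 V7 [Split V1
     V7 V8 [Split V3 V4 V6 [Split V5 V6 V8 [Split V4 V5 V8 [Refer 21 V1 V2 V6 V3 V7 V8 V4
     V5, Split V3 V4 V7 [Split V3 V7 V8 [Refer 12 V6 V8 V4 V1 V3 V5 V7 V2]]], Cut V6 V7 V1
     V2 V4 V5], Split V4 V5 V6 [Refer 20 V2 V1 V4 V5 V6 V8 V3 V7]], Cut V1 V5 V2 V4 V6 V7],
     Split V1 V4 V6 [Split V5 V6 V8 [Cut V6 V8 V2 V3 V5 V1, Cut V4 V6 V1 V5 V8 V2, Cut V7 V8
     V1 V2 V4 V5]]], Split V1 V6 V7 [Split V1 V7 V8 [Split V1 V5 V6 [Split V1 V3 V8 [Split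
     V3 V4 V6 [Split V3 V6 V8 [Split V4 V6 V7 [Split V4 V5 V8 [Split V4 V7 V8 [Split V5 V6
     V8 [Refer 8 V1 V4 V8 V6 V2 V7 V5 V3]]], Cut V4 V7 V2 V6 V8 V1]], Split V4 V7 V8 [Split
     V5 V6 V8 [Refer 10 V3 V7 V2 V5 V4 V6 V8 V1]], Cut V3 V6 V2 V4 V8 V1]], Split V1 V3 V8
     [Split V3 V4 V6 [Cut V5 V6 V1 V2 V8 V3, Refer 21 V8 V2 V6 V7 V5 V4 V1 V3]]]], Split V1
     V7 V8 [Split V4 V6 V7 [Split V4 V7 V8 [Split V5 V6 V7 [Split V5 V6 V8 [Split V3 V7 V8
     [Refer 11 V4 V3 V2 V5 V6 V1 V8 V7]], Refer 23 V1 V2 V8 V4 V5 V6 V7 V3]], Split V4 V7 V8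
     [Split V3 V4 V6 [Split V4 V5 V8 [Split V5 V6 V8 [Refer 10 V1 V6 V4 V8 V5 V7 V3 V2]],
     Refer 21 V6 V2 V8 V7 V5 V1 V4 V3]], Cut V4 V7 V2 V6 V8 V1]], Cut V1 V7 V2 V6 V8 V3],
     Split V1 V4 V7 [Split V1 V4 V8 [Split V5 V6 V8 [Cut V1 V8 V4 V5 V6 V2, Cut V6 V8 V2 V3
     V5 V1, Cut V6 V7 V1 V2 V4 V5]], Split V4 V6 V7 [Split V1 V6 V7 [Refer 21 V8 V2 V4 V3 V5
     V6 V1 V7, Split V1 V3 V7 [Split V1 V5 V8 [Split V5 V6 V8 [Split V3 V6 V7 [Refer 12 V8
     V6 V1 V4 V3 V5 V7 V2], Cut V7 V8 V1 V2 V4 V5]]]], Cut V4 V5 V1 V2 V8 V6]]], Refer 35 V4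
     V2 V3 V1 V5 V8 V7 V6]]]], Split V2 V5 V6 [Split V2 V6 V7 [Split V2 V3 V8 [Split V1 V3
     V4 [Split V1 V5 V6 [Split V1 V3 V8 [Split V1 V6 V7 [Cut V1 V4 V2 V3 V5 V6, Refer 19 V1
     V2 V6 V7 V8 V3 V4 V5], Split V1 V3 V6 [Split V3 V4 V6 [Split V6 V7 V8 [Split V3 V5 V8
     [Refer 21 V6 V1 V3 V8 V7 V4 V2 V5, Split V3 V4 V5 [Split V4 V7 V8 [Refer 15 V5 V7 V2 V1
     V8 V4 V6 V3]]], Cut V5 V6 V1 V2 V3 V7], Split V3 V6 V7 [Refer 20 V1 V2 V6 V7 V8 V3 V4
     V5]]]], Split V1 V3 V5 [Split V1 V3 V7 [Split V3 V5 V6 [Split V3 V5 V8 [Split V4 V5 V8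
     [Refer 21 V1 V3 V5 V8 V7 V6 V2 V4, Split V6 V7 V8 [Split V4 V5 V6 [Refer 16 V3 V7 V2 V4
     V8 V1 V6 V5]]]], Split V3 V5 V8 [Split V3 V4 V6 [Split V6 V7 V8 [Split V3 V4 V8 [Refer
     16 V5 V7 V2 V4 V6 V1 V8 V3]], Refer 21 V1 V5 V3 V6 V7 V8 V2 V4]], Cut V3 V5 V2 V6 V8
     V1]], Split V1 V5 V7 [Split V4 V5 V8 [Split V5 V7 V8 [Refer 20 V1 V2 V6 V7 V8 V5 V3
     V4], Split V6 V7 V8 [Cut V3 V8 V1 V2 V5 V6, Split V3 V5 V6 [Refer 21 V8 V1 V5 V6 V7 V4
     V2 V3, Split V3 V4 V5 [Split V4 V6 V7 [Refer 15 V3 V7 V2 V1 V6 V4 V8 V5]]]]]]], Split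
     V1 V3 V5 [Split V1 V5 V8 [Split V1 V3 V8 [Split V3 V4 V5 [Cut V3 V6 V2 V4 V5 V1, Cut V3
     V5 V1 V4 V7 V2, Cut V5 V8 V2 V3 V4 V1]]], Split V1 V7 V8 [Cut V1 V4 V2 V3 V5 V7, Refer
     19 V1 V2 V6 V7 V8 V3 V4 V5]]], Split V1 V4 V5 [Split V1 V6 V7 [Split V1 V3 V8 [Cut V1
     V5 V2 V4 V6 V3, Split V4 V6 V8 [Refer 21 V3 V1 V6 V8 V7 V5 V2 V4, Split V4 V5 V6 [Split
     V3 V6 V7 [Split V4 V5 V8 [Cut V3 V4 V1 V2 V6 V5, Split V3 V7 V8 [Refer 18 V4 V8 V6 V1
     V7 V5 V3 V2]]]]]], Refer 19 V1 V2 V6 V7 V8 V3 V4 V5], Split V1 V4 V6 [Split V1 V5 V6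
     [Split V4 V6 V8 [Cut V5 V6 V1 V2 V3 V4, Split V4 V5 V8 [Cut V3 V4 V1 V2 V6 V5, Split V1
     V7 V8 [Split V1 V5 V7 [Split V5 V7 V8 [Refer 18 V3 V8 V1 V6 V7 V5 V4 V2]], Refer 21 V2
     V6 V8 V5 V3 V4 V1 V7]]], Split V1 V3 V6 [Split V1 V7 V8 [Split V4 V6 V8 [Split V6 V7 V8
     [Split V3 V5 V6 [Split V3 V5 V8 [Split V4 V6 V7 [Refer 6 V7 V1 V8 V2 V5 V4 V3 V6]]]],
     Cut V6 V8 V2 V4 V7 V1]]]], Split V1 V4 V7 [Split V1 V6 V7 [Split V1 V5 V6 [Split V1 V3
     V8 [Split V1 V5 V7 [Split V4 V5 V8 [Split V5 V6 V8 [Split V3 V5 V6 [Refer 6 V7 V6 V8 V2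
     V5 V3 V4 V1]]]]]], Cut V1 V6 V2 V5 V7 V3]]], Split V1 V4 V6 [Split V1 V4 V8 [Split V4
     V6 V8 [Refer 20 V1 V2 V6 V7 V8 V4 V3 V5]], Refer 21 V3 V6 V1 V5 V7 V8 V2 V4]], Split V1
     V4 V5 [Split V1 V4 V7 [Split V1 V7 V8 [Split V3 V4 V6 [Split V4 V6 V8 [Split V4 V5 V8
     [Refer 21 V1 V6 V4 V8 V7 V3 V2 V5, Split V3 V7 V8 [Split V3 V4 V5 [Refer 15 V5 V7 V2 V6
     V8 V3 V1 V4]]]], Split V4 V6 V8 [Split V3 V5 V6 [Split V6 V7 V8 [Split V3 V5 V8 [Refer
     12 V4 V7 V2 V5 V3 V1 V8 V6]], Refer 21 V1 V4 V6 V3 V7 V8 V2 V5]], Cut V4 V6 V2 V3 V8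
     V1], Cut V1 V5 V2 V4 V6 V7], Split V1 V4 V6 [Split V1 V6 V7 [Split V1 V6 V8 [Split V3
     V4 V6 [Cut V3 V6 V2 V4 V5 V1, Split V3 V5 V6 [Split V6 V7 V8 [Split V4 V5 V6 [Split V4
     V5 V8 [Refer 6 V7 V8 V1 V2 V4 V5 V3 V6]]]]]]]]], Split V1 V6 V7 [Split V1 V7 V8 [Split
     V1 V5 V6 [Split V1 V3 V8 [Split V3 V4 V6 [Split V4 V5 V8 [Cut V5 V6 V1 V2 V3 V4, Split
     V6 V7 V8 [Refer 12 V3 V7 V2 V5 V4 V6 V8 V1]], Cut V3 V8 V1 V2 V5 V4]], Split V1 V3 V8
     [Split V6 V7 V8 [Cut V3 V6 V1 V7 V8 V2, Cut V6 V8 V2 V4 V7 V1, Cut V5 V8 V1 V6 V7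
     V2]]]], Split V1 V7 V8 [Split V3 V4 V6 [Split V3 V4 V7 [Split V4 V5 V8 [Split V5 V6 V7
     [Split V3 V5 V8 [Refer 15 V4 V7 V2 V6 V1 V3 V8 V5]]], Split V3 V4 V5 [Split V4 V5 V7
     [Split V6 V7 V8 [Refer 16 V5 V7 V2 V3 V1 V6 V8 V4]]]], Split V4 V6 V7 [Split V6 V7 V8
     [Split V3 V5 V6 [Split V4 V5 V6 [Refer 18 V5 V1 V6 V8 V7 V4 V3 V2]]], Split V5 V6 V7
     [Split V4 V5 V7 [Split V3 V7 V8 [Refer 17 V4 V5 V2 V3 V8 V1 V6 V7]]]], Split V3 V4 V7
     [Split V3 V4 V8 [Split V3 V7 V8 [Split V3 V5 V6 [Refer 15 V4 V7 V2 V8 V1 V5 V6 V3]]],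
     Split V3 V5 V8 [Split V4 V5 V8 [Split V6 V7 V8 [Refer 18 V3 V1 V8 V6 V7 V4 V5 V2]]]]]],
     Cut V1 V7 V2 V6 V8 V3], Split V1 V4 V7 [Split V1 V4 V8 [Split V1 V5 V6 [Split V1 V6 V8
     [Split V1 V7 V8 [Split V1 V3 V7 [Split V3 V4 V6 [Split V3 V6 V8 [Split V3 V5 V8 [Refer
     6 V7 V8 V6 V2 V3 V5 V4 V1]]]]]], Cut V1 V8 V4 V5 V6 V2]], Split V1 V6 V7 [Split V1 V3
     V8 [Split V1 V3 V6 [Refer 21 V4 V8 V1 V6 V7 V3 V2 V5], Split V1 V5 V8 [Split V4 V6 V8
     [Split V3 V5 V6 [Split V6 V7 V8 [Split V3 V5 V8 [Split V4 V7 V8 [Refer 6 V7 V1 V6 V2 V3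
     V4 V5 V8]]]], Cut V6 V8 V2 V4 V7 V1]]], Split V1 V3 V7 [Split V1 V5 V8 [Split V4 V6 V8
     [Cut V3 V8 V1 V2 V5 V4, Split V3 V5 V6 [Cut V4 V5 V1 V2 V8 V3, Split V4 V6 V7 [Refer 18
     V5 V6 V1 V8 V7 V3 V4 V2]]]]]]]], Refer 31 V1 V2 V8 V3 V4 V5 V6 V7]]], Cut V2 V6 V1 V5
     V7 V3, Cut V2 V8 V4 V5 V6 V1]]]"

definition pattern_14 :: "vertex list list" where
  "pattern_14 =
     [[V1, V2, V3, V4], [V1, V2, V4, V5], [V1, V2, V5, V6], [V1, V2, V6, V7],
     [V1, V2, V7, V8], [V1, V2, V3, V8]]"

text \<open>The last two relabellings exchange \<open>V3\<close> with \<open>V4\<close>,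
  \<open>V5\<close> with \<open>V8\<close> and \<open>V6\<close> with \<open>V7\<close>. This
  reflects the hexagon and takes the fourth vertices 7 and 8 back to 6 and 5.\<close>

definition cert_14 :: cert where
  "cert_14 =
     Split V2 V3 V4 [Refer 30 V1 V2 V3 V4 V5 V6 V7 V8, Refer 36 V1 V2 V3 V4 V5 V6 V7 V8,
     Refer 36 V1 V2 V4 V3 V8 V7 V6 V5, Refer 30 V1 V2 V4 V3 V8 V7 V6 V5]"

section \<open>Edges of degree 5: patterns 15 to 19\<close>

definition pattern_15 :: "vertex list list" where
  "pattern_15 =
     [[V1, V2, V3, V4], [V1, V2, V4, V5], [V1, V2, V5, V6], [V1, V2, V6, V7],
     [V1, V2, V3, V7], [V2, V3, V4, V5], [V2, V5, V6, V8]]"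

text \<open>The many leaves \<open>Refer 37\<close> point to \<open>pattern_14\<close>: an edge of
  degree 6 has appeared, and that case is settled.\<close>

definition cert_15 :: cert where
  "cert_15 =
     Split V2 V3 V5 [Split V2 V5 V8 [Refer 37 V2 V5 V1 V4 V3 V7 V8 V6], Split V2 V3 V7
     [Split V2 V3 V8 [Refer 37 V2 V3 V1 V4 V5 V8 V6 V7], Split V2 V6 V7 [Cut V2 V4 V1 V3 V5
     V6, Split V1 V3 V4 [Refer 19 V1 V2 V3 V4 V5 V6 V7 V8, Split V1 V4 V5 [Split V1 V6 V7
     [Refer 21 V5 V4 V6 V7 V8 V3 V2 V1, Split V1 V3 V6 [Refer 37 V1 V6 V2 V5 V4 V3 V8 V7]],
     Split V1 V4 V6 [Split V1 V5 V6 [Split V1 V3 V7 [Refer 22 V2 V3 V1 V4 V6 V5 V8 V7, Split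
     V1 V5 V7 [Refer 37 V1 V7 V2 V6 V4 V5 V8 V3]], Split V1 V3 V6 [Refer 37 V1 V6 V2 V5 V8
     V3 V4 V7]], Split V1 V4 V7 [Refer 37 V1 V4 V2 V3 V6 V8 V7 V5]], Split V1 V4 V6 [Split
     V1 V4 V8 [Refer 37 V1 V4 V2 V3 V6 V7 V8 V5], Split V1 V5 V6 [Split V1 V6 V7 [Refer 37
     V1 V6 V2 V5 V3 V4 V8 V7], Cut V1 V6 V2 V5 V7 V3, Split V1 V6 V7 [Refer 37 V1 V6 V2 V5
     V8 V4 V3 V7]]]], Split V1 V4 V5 [Split V1 V4 V7 [Refer 21 V5 V6 V4 V3 V8 V7 V2 V1,
     Split V1 V4 V6 [Refer 37 V1 V4 V2 V3 V7 V8 V6 V5]], Split V1 V6 V7 [Refer 21 V3 V4 V7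
     V6 V8 V5 V2 V1, Split V1 V5 V7 [Refer 37 V1 V7 V2 V6 V8 V5 V4 V3]], Split V1 V4 V7
     [Split V1 V4 V8 [Refer 37 V1 V4 V2 V3 V7 V6 V8 V5], Split V1 V6 V7 [Split V1 V7 V8
     [Refer 37 V1 V7 V2 V6 V5 V8 V4 V3], Split V1 V5 V6 [Cut V1 V3 V2 V4 V7 V5, Refer 20 V1
     V5 V2 V6 V8 V7 V3 V4]]]], Split V1 V4 V5 [Split V1 V4 V8 [Split V1 V6 V7 [Split V1 V6
     V8 [Refer 37 V1 V6 V2 V5 V4 V8 V3 V7], Split V1 V3 V7 [Cut V1 V5 V2 V4 V6 V3, Refer 20
     V1 V6 V2 V7 V8 V3 V4 V5]], Split V1 V4 V6 [Refer 37 V1 V4 V2 V3 V8 V7 V6 V5]], Split V1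
     V4 V8 [Split V1 V4 V7 [Refer 37 V1 V4 V2 V3 V8 V6 V7 V5], Split V1 V6 V7 [Cut V1 V7 V2
     V3 V6 V4, Split V1 V3 V7 [Refer 37 V1 V7 V2 V6 V5 V4 V8 V3], Split V1 V3 V7 [Refer 37
     V1 V7 V2 V6 V8 V4 V5 V3]]], Split V3 V5 V8 [Split V1 V5 V6 [Split V1 V3 V7 [Refer 37 V1
     V3 V2 V4 V8 V5 V6 V7], Split V1 V3 V5 [Refer 37 V1 V5 V2 V4 V8 V3 V7 V6]], Refer 20 V1
     V2 V3 V4 V5 V8 V6 V7, Cut V5 V8 V2 V3 V6 V1, Cut V3 V8 V2 V5 V7 V1]]]]]]"

definition pattern_16 :: "vertex list list" where
  "pattern_16 =
     [[V1, V2, V3, V4], [V1, V2, V4, V5], [V1, V2, V5, V6], [V1, V2, V6, V7],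
     [V1, V2, V3, V7], [V2, V3, V4, V5]]"

definition cert_16 :: cert where
  "cert_16 =
     Split V2 V5 V6 [Split V2 V3 V7 [Refer 21 V4 V5 V3 V7 V8 V6 V1 V2, Split V2 V3 V6 [Refer
     37 V2 V3 V1 V4 V5 V6 V8 V7]], Split V2 V3 V5 [Refer 21 V4 V3 V5 V6 V8 V7 V1 V2, Split
     V2 V5 V7 [Refer 37 V2 V5 V1 V4 V3 V8 V7 V6]], Refer 38 V1 V2 V3 V4 V5 V6 V7 V8]"

text \<open>\<open>V8\<close> is the only vertex outside the link of the edge 12. In the link of
  \<open>V2\<close> it is coned here over the three consecutive pentagon edges 34, 45, 56, and in
  \<open>pattern_18\<close> over the first two.\<close>

definition pattern_17 :: "vertex list list" where
  "pattern_17 =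
     [[V1, V2, V3, V4], [V1, V2, V4, V5], [V1, V2, V5, V6], [V1, V2, V6, V7],
     [V1, V2, V3, V7], [V2, V3, V4, V8], [V2, V4, V5, V8], [V2, V5, V6, V8]]"

definition cert_17 :: cert where
  "cert_17 =
     Split V2 V3 V8 [Split V2 V3 V6 [Split V1 V3 V4 [Split V1 V5 V6 [Split V1 V3 V7 [Refer
     21 V4 V5 V3 V7 V8 V6 V2 V1, Split V1 V3 V6 [Refer 37 V1 V3 V2 V4 V5 V6 V8 V7]], Split
     V1 V3 V5 [Refer 21 V4 V3 V5 V6 V8 V7 V2 V1, Split V1 V5 V7 [Refer 37 V1 V5 V2 V4 V3 V8
     V7 V6]], Split V1 V3 V5 [Split V1 V5 V8 [Refer 37 V1 V5 V2 V4 V3 V7 V8 V6], Split V1 V3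
     V7 [Refer 19 V1 V2 V6 V7 V3 V4 V5 V8, Split V3 V6 V8 [Cut V3 V8 V2 V4 V6 V1, Split V3
     V4 V8 [Refer 37 V3 V8 V1 V5 V4 V2 V6 V7]]]]], Split V1 V4 V5 [Split V1 V6 V7 [Refer 21
     V5 V4 V6 V7 V8 V3 V2 V1, Split V1 V3 V6 [Refer 37 V1 V6 V2 V5 V4 V3 V8 V7]], Split V1
     V4 V6 [Split V1 V5 V6 [Split V1 V3 V7 [Refer 22 V2 V3 V1 V4 V6 V5 V8 V7, Split V1 V5 V7
     [Refer 37 V1 V7 V2 V6 V4 V5 V8 V3]], Split V1 V3 V6 [Refer 37 V1 V6 V2 V5 V8 V3 V4
     V7]], Split V1 V4 V7 [Refer 37 V1 V4 V2 V3 V6 V8 V7 V5]], Split V1 V4 V6 [Split V1 V4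
     V8 [Refer 37 V1 V4 V2 V3 V6 V7 V8 V5], Split V3 V6 V8 [Cut V1 V6 V3 V4 V8 V2, Refer 21
     V5 V2 V8 V6 V7 V3 V1 V4, Cut V6 V8 V2 V3 V5 V1, Cut V3 V6 V2 V7 V8 V1]]], Split V1 V4
     V5 [Split V1 V4 V7 [Refer 21 V5 V6 V4 V3 V8 V7 V2 V1, Split V1 V4 V6 [Refer 37 V1 V4 V2
     V3 V7 V8 V6 V5]], Split V1 V6 V7 [Refer 21 V3 V4 V7 V6 V8 V5 V2 V1, Split V1 V5 V7
     [Refer 37 V1 V7 V2 V6 V8 V5 V4 V3]], Split V1 V4 V7 [Split V1 V4 V8 [Refer 37 V1 V4 V2
     V3 V7 V6 V8 V5], Split V1 V6 V7 [Split V1 V7 V8 [Refer 37 V1 V7 V2 V6 V5 V8 V4 V3],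
     Split V1 V5 V6 [Cut V1 V3 V2 V4 V7 V5, Refer 20 V1 V4 V2 V5 V8 V6 V3 V7]]]], Split V1
     V4 V5 [Split V1 V4 V8 [Split V1 V6 V7 [Refer 19 V1 V2 V6 V7 V3 V4 V5 V8, Split V3 V6 V8
     [Cut V6 V8 V2 V3 V5 V1, Split V5 V6 V8 [Refer 37 V6 V8 V1 V4 V5 V2 V3 V7]]], Split V1
     V4 V6 [Refer 37 V1 V4 V2 V3 V8 V7 V6 V5]], Split V1 V4 V8 [Split V1 V4 V7 [Refer 37 V1
     V4 V2 V3 V8 V6 V7 V5], Split V4 V5 V8 [Split V4 V7 V8 [Refer 37 V4 V8 V1 V3 V2 V5 V6
     V7], Refer 21 V3 V2 V8 V7 V6 V5 V1 V4]], Refer 20 V1 V3 V2 V4 V8 V5 V6 V7]]], Split V2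
     V6 V8 [Split V1 V3 V4 [Split V1 V5 V6 [Split V1 V3 V7 [Refer 21 V4 V5 V3 V7 V8 V6 V2
     V1, Split V1 V3 V6 [Refer 37 V1 V3 V2 V4 V5 V6 V8 V7]], Split V1 V3 V5 [Refer 21 V4 V3
     V5 V6 V8 V7 V2 V1, Split V1 V5 V7 [Refer 37 V1 V5 V2 V4 V3 V8 V7 V6]], Split V1 V3 V5
     [Split V1 V5 V8 [Refer 37 V1 V5 V2 V4 V3 V7 V8 V6], Split V1 V3 V7 [Split V1 V3 V8
     [Refer 37 V1 V3 V2 V4 V5 V8 V6 V7], Split V3 V5 V8 [Refer 21 V7 V2 V8 V5 V6 V4 V1
     V3]]]], Split V1 V4 V5 [Split V1 V6 V7 [Refer 21 V5 V4 V6 V7 V8 V3 V2 V1, Split V1 V3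
     V6 [Refer 37 V1 V6 V2 V5 V4 V3 V8 V7]], Split V1 V4 V6 [Split V1 V5 V6 [Split V1 V3 V7
     [Refer 22 V2 V3 V1 V4 V6 V5 V8 V7, Split V1 V5 V7 [Refer 37 V1 V7 V2 V6 V4 V5 V8 V3]],
     Split V1 V3 V6 [Refer 37 V1 V6 V2 V5 V8 V3 V4 V7]], Split V1 V4 V7 [Refer 37 V1 V4 V2
     V3 V6 V8 V7 V5]], Split V1 V4 V6 [Split V1 V4 V8 [Refer 37 V1 V4 V2 V3 V6 V7 V8 V5],
     Split V3 V4 V8 [Refer 21 V5 V2 V8 V6 V7 V3 V1 V4, Split V4 V6 V8 [Refer 37 V4 V8 V1 V5
     V2 V3 V7 V6]]]], Split V1 V4 V5 [Split V1 V4 V7 [Refer 21 V5 V6 V4 V3 V8 V7 V2 V1,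
     Split V1 V4 V6 [Refer 37 V1 V4 V2 V3 V7 V8 V6 V5]], Split V1 V6 V7 [Refer 21 V3 V4 V7
     V6 V8 V5 V2 V1, Split V1 V5 V7 [Refer 37 V1 V7 V2 V6 V8 V5 V4 V3]], Split V1 V4 V7
     [Split V1 V4 V8 [Refer 37 V1 V4 V2 V3 V7 V6 V8 V5], Split V1 V6 V7 [Split V1 V7 V8
     [Refer 37 V1 V7 V2 V6 V5 V8 V4 V3], Split V4 V7 V8 [Refer 20 V2 V1 V4 V3 V7 V8 V5
     V6]]]], Split V1 V4 V5 [Split V1 V4 V8 [Split V1 V6 V7 [Split V1 V6 V8 [Refer 37 V1 V6
     V2 V5 V4 V8 V3 V7], Split V4 V6 V8 [Refer 21 V3 V2 V8 V6 V7 V5 V1 V4]], Split V1 V4 V6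
     [Refer 37 V1 V4 V2 V3 V8 V7 V6 V5]], Split V1 V4 V8 [Split V1 V4 V7 [Refer 37 V1 V4 V2
     V3 V8 V6 V7 V5], Split V4 V5 V8 [Split V4 V7 V8 [Refer 37 V4 V8 V1 V3 V2 V5 V6 V7],
     Refer 21 V3 V2 V8 V7 V6 V5 V1 V4]], Refer 20 V1 V3 V2 V4 V8 V5 V6 V7]]]]"

definition pattern_18 :: "vertex list list" where
  "pattern_18 =
     [[V1, V2, V3, V4], [V1, V2, V4, V5], [V1, V2, V5, V6], [V1, V2, V6, V7],
     [V1, V2, V3, V7], [V2, V3, V4, V8], [V2, V4, V5, V8]]"

definition cert_18 :: cert where
  "cert_18 =
     Split V2 V5 V6 [Split V2 V5 V8 [Split V2 V3 V7 [Refer 37 V2 V3 V1 V4 V8 V5 V6 V7],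
     Split V2 V3 V5 [Refer 37 V2 V5 V1 V4 V8 V7 V3 V6]], Split V2 V5 V8 [Split V2 V5 V7
     [Refer 37 V2 V5 V1 V4 V8 V3 V7 V6], Split V2 V3 V7 [Split V1 V3 V4 [Split V1 V5 V6
     [Split V1 V3 V7 [Refer 21 V4 V5 V3 V7 V8 V6 V2 V1, Split V1 V3 V6 [Refer 37 V1 V3 V2 V4
     V5 V6 V8 V7]], Refer 19 V1 V2 V5 V6 V7 V3 V4 V8, Split V1 V3 V5 [Split V1 V5 V8 [Refer
     37 V1 V5 V2 V4 V3 V7 V8 V6], Split V1 V3 V7 [Split V1 V3 V8 [Refer 37 V1 V3 V2 V4 V5 V8
     V6 V7], Split V5 V7 V8 [Cut V5 V8 V2 V4 V7 V1, Split V4 V5 V8 [Refer 37 V5 V8 V1 V6 V7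
     V2 V4 V3]]]]], Split V1 V4 V5 [Split V1 V6 V7 [Refer 21 V5 V4 V6 V7 V8 V3 V2 V1, Split
     V1 V3 V6 [Refer 37 V1 V6 V2 V5 V4 V3 V8 V7]], Split V1 V4 V6 [Split V1 V5 V6 [Split V1
     V3 V7 [Refer 22 V2 V3 V1 V4 V6 V5 V8 V7, Split V1 V5 V7 [Refer 37 V1 V7 V2 V6 V4 V5 V8
     V3]], Split V1 V3 V6 [Refer 37 V1 V6 V2 V5 V8 V3 V4 V7]], Split V1 V4 V7 [Refer 37 V1
     V4 V2 V3 V6 V8 V7 V5]], Split V1 V4 V6 [Split V1 V4 V8 [Refer 37 V1 V4 V2 V3 V6 V7 V8
     V5], Split V3 V4 V8 [Refer 21 V5 V2 V8 V6 V7 V3 V1 V4, Split V4 V6 V8 [Refer 37 V4 V8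
     V1 V5 V2 V3 V7 V6]]]], Split V1 V4 V5 [Split V1 V4 V7 [Refer 21 V5 V6 V4 V3 V8 V7 V2
     V1, Split V1 V4 V6 [Refer 37 V1 V4 V2 V3 V7 V8 V6 V5]], Split V1 V6 V7 [Refer 21 V3 V4
     V7 V6 V8 V5 V2 V1, Split V1 V5 V7 [Refer 37 V1 V7 V2 V6 V8 V5 V4 V3]], Split V1 V4 V7
     [Split V1 V4 V8 [Refer 37 V1 V4 V2 V3 V7 V6 V8 V5], Split V1 V6 V7 [Refer 19 V1 V2 V5
     V6 V7 V3 V4 V8, Split V5 V7 V8 [Cut V7 V8 V2 V3 V5 V1, Split V3 V7 V8 [Refer 37 V7 V8
     V1 V4 V3 V2 V5 V6]]]]], Split V1 V4 V5 [Split V1 V4 V8 [Split V1 V6 V7 [Split V1 V6 V8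
     [Refer 37 V1 V6 V2 V5 V4 V8 V3 V7], Split V1 V3 V7 [Cut V1 V5 V2 V4 V6 V3, Refer 20 V1
     V4 V2 V3 V8 V7 V5 V6]], Split V1 V4 V6 [Refer 37 V1 V4 V2 V3 V8 V7 V6 V5]], Split V1 V4
     V8 [Split V1 V4 V7 [Refer 37 V1 V4 V2 V3 V8 V6 V7 V5], Split V5 V7 V8 [Cut V1 V7 V4 V5
     V8 V2, Cut V7 V8 V2 V3 V5 V1, Refer 21 V3 V2 V8 V7 V6 V5 V1 V4, Cut V5 V7 V2 V6 V8
     V1]], Refer 20 V1 V3 V2 V4 V8 V5 V6 V7]]]], Refer 40 V1 V2 V3 V4 V5 V6 V7 V8]"

definition pattern_19 :: "vertex list list" where
  "pattern_19 =
     [[V1, V2, V3, V4], [V1, V2, V4, V5], [V1, V2, V5, V6], [V1, V2, V6, V7],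
     [V1, V2, V3, V7]]"

definition cert_19 :: cert where
  "cert_19 =
     Split V2 V3 V4 [Refer 39 V1 V2 V3 V4 V5 V6 V7 V8, Split V2 V4 V5 [Split V2 V6 V7 [Refer
     21 V5 V4 V6 V7 V8 V3 V1 V2, Split V2 V3 V6 [Refer 37 V2 V6 V1 V5 V4 V3 V8 V7]], Split
     V2 V4 V6 [Split V2 V5 V6 [Split V2 V3 V7 [Refer 22 V1 V3 V2 V4 V6 V5 V8 V7, Split V2 V5
     V7 [Refer 37 V2 V7 V1 V6 V4 V5 V8 V3]], Split V2 V3 V6 [Refer 37 V2 V6 V1 V5 V8 V3 V4
     V7]], Split V2 V4 V7 [Refer 37 V2 V4 V1 V3 V6 V8 V7 V5]], Split V2 V4 V6 [Split V2 V4
     V8 [Refer 37 V2 V4 V1 V3 V6 V7 V8 V5], Split V2 V5 V6 [Split V2 V6 V7 [Refer 37 V2 V6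
     V1 V5 V3 V4 V8 V7], Cut V2 V6 V1 V5 V7 V3, Split V2 V6 V7 [Refer 37 V2 V6 V1 V5 V8 V4
     V3 V7]]]], Refer 39 V1 V2 V4 V3 V7 V6 V5 V8, Split V2 V4 V5 [Refer 38 V1 V2 V6 V5 V4 V3
     V7 V8, Split V2 V4 V8 [Split V2 V4 V7 [Refer 37 V2 V4 V1 V3 V8 V6 V7 V5], Split V2 V6
     V7 [Cut V2 V7 V1 V3 V6 V4, Split V2 V3 V7 [Refer 37 V2 V7 V1 V6 V5 V4 V8 V3], Split V2
     V3 V7 [Refer 37 V2 V7 V1 V6 V8 V4 V5 V3]]], Refer 41 V1 V2 V3 V4 V5 V6 V7 V8]]"

section \<open>Edges of degree at most 4: patterns 20 to 22\<close>

definition pattern_20 :: "vertex list list" where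
  "pattern_20 =
     [[V1, V2, V3, V4], [V2, V3, V4, V5], [V1, V3, V4, V6]]"

text \<open>The link of the edge 34 contains the path 6, 1, 2, 5. Adding 3456 closes it to a
  4-cycle, which is the long first child. The other two children lengthen the path and end at once
  in an edge of degree 5 (\<open>Refer 42\<close>) or 6 (\<open>Refer 37\<close>).\<close>

definition cert_20 :: cert where
  "cert_20 =
     Split V3 V4 V5 [Split V1 V2 V4 [Split V1 V4 V6 [Refer 20 V1 V2 V3 V4 V5 V6 V7 V8, Split
     V1 V4 V5 [Refer 42 V1 V4 V2 V3 V6 V7 V5 V8, Split V1 V4 V7 [Refer 37 V1 V4 V2 V3 V6 V7
     V8 V5]], Split V1 V4 V5 [Split V1 V4 V8 [Refer 37 V1 V4 V2 V3 V6 V8 V7 V5], Refer 42 V1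
     V4 V2 V3 V6 V8 V5 V7]], Split V2 V4 V5 [Refer 20 V2 V1 V3 V4 V6 V5 V7 V8, Split V2 V4
     V6 [Refer 42 V2 V4 V1 V3 V5 V7 V6 V8, Split V2 V4 V7 [Refer 37 V2 V4 V1 V3 V5 V7 V8
     V6]], Split V2 V4 V6 [Split V2 V4 V8 [Refer 37 V2 V4 V1 V3 V5 V8 V7 V6], Refer 42 V2 V4
     V1 V3 V5 V8 V6 V7]], Split V2 V4 V5 [Split V2 V4 V7 [Refer 42 V2 V4 V1 V3 V5 V6 V7 V8,
     Split V2 V4 V6 [Refer 37 V2 V4 V1 V3 V5 V6 V8 V7]], Split V1 V4 V6 [Split V1 V4 V7
     [Refer 42 V1 V4 V2 V3 V6 V5 V7 V8, Split V1 V4 V5 [Refer 37 V1 V4 V2 V3 V6 V5 V8 V7]],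
     Split V4 V5 V6 [Refer 23 V1 V2 V5 V3 V4 V7 V6 V8, Split V4 V5 V7 [Refer 42 V4 V5 V2 V3
     V6 V8 V7 V1]], Split V1 V4 V7 [Split V1 V4 V8 [Refer 37 V1 V4 V2 V3 V6 V8 V5 V7], Refer
     40 V1 V4 V7 V2 V3 V6 V8 V5]], Split V2 V4 V7 [Split V2 V4 V8 [Refer 37 V2 V4 V1 V3 V5
     V8 V6 V7], Refer 41 V2 V4 V1 V3 V5 V8 V7 V6]], Split V2 V4 V5 [Split V2 V4 V8 [Refer 42
     V2 V4 V1 V3 V5 V6 V8 V7, Split V2 V4 V6 [Refer 37 V2 V4 V1 V3 V5 V6 V7 V8]], Split V2
     V4 V8 [Split V2 V4 V7 [Refer 37 V2 V4 V1 V3 V5 V7 V6 V8], Refer 41 V2 V4 V1 V3 V5 V7 V8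
     V6], Split V1 V4 V6 [Split V1 V4 V8 [Refer 42 V1 V4 V2 V3 V6 V5 V8 V7, Split V1 V4 V5
     [Refer 37 V1 V4 V2 V3 V6 V5 V7 V8]], Split V1 V4 V8 [Split V1 V4 V7 [Refer 37 V1 V4 V2
     V3 V6 V7 V5 V8], Refer 40 V1 V4 V8 V2 V3 V6 V7 V5], Split V4 V5 V6 [Split V4 V5 V8
     [Refer 42 V4 V5 V2 V3 V6 V7 V8 V1], Refer 23 V1 V2 V5 V3 V4 V8 V6 V7]]]], Split V3 V4
     V6 [Refer 42 V3 V4 V1 V2 V5 V7 V6 V8, Split V3 V4 V7 [Refer 37 V3 V4 V1 V2 V5 V7 V8
     V6]], Split V3 V4 V6 [Split V3 V4 V8 [Refer 37 V3 V4 V1 V2 V5 V8 V7 V6], Refer 42 V3 V4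
     V1 V2 V5 V8 V6 V7]]"

definition pattern_21 :: "vertex list list" where
  "pattern_21 =
     [[V1, V2, V3, V4], [V2, V3, V4, V5]]"

text \<open>Only the first child, where the link of the edge 34 closes up as a triangle 1, 2, 5, is
  treated here. In the others the link path has three edges, and they are copies of
  \<open>pattern_20\<close>.\<close>

definition cert_21 :: cert where
  "cert_21 =
     Split V1 V3 V4 [Split V1 V2 V4 [Refer 19 V1 V2 V3 V4 V5 V6 V7 V8, Split V2 V4 V5 [Split
     V1 V4 V5 [Refer 20 V1 V3 V2 V4 V5 V6 V7 V8, Split V1 V4 V6 [Refer 42 V1 V4 V2 V3 V5 V7
     V6 V8, Split V1 V4 V7 [Refer 37 V1 V4 V2 V3 V5 V7 V8 V6]], Split V1 V4 V6 [Split V1 V4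
     V8 [Refer 37 V1 V4 V2 V3 V5 V8 V7 V6], Refer 42 V1 V4 V2 V3 V5 V8 V6 V7]], Split V2 V4
     V6 [Refer 39 V2 V4 V1 V3 V5 V7 V6 V8, Split V2 V4 V7 [Refer 37 V2 V4 V1 V3 V5 V7 V8
     V6]], Split V2 V4 V6 [Split V2 V4 V8 [Refer 37 V2 V4 V1 V3 V5 V8 V7 V6], Refer 39 V2 V4
     V1 V3 V5 V8 V6 V7]], Split V2 V4 V5 [Split V2 V4 V7 [Refer 39 V2 V4 V1 V3 V5 V6 V7 V8,
     Split V2 V4 V6 [Refer 37 V2 V4 V1 V3 V5 V6 V8 V7]], Split V1 V4 V5 [Split V1 V4 V7
     [Refer 42 V1 V4 V2 V3 V5 V6 V7 V8, Split V1 V4 V6 [Refer 37 V1 V4 V2 V3 V5 V6 V8 V7]],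
     Refer 20 V1 V3 V2 V4 V5 V7 V6 V8, Split V1 V4 V7 [Split V1 V4 V8 [Refer 37 V1 V4 V2 V3
     V5 V8 V6 V7], Refer 42 V1 V4 V2 V3 V5 V8 V7 V6]], Split V2 V4 V7 [Split V2 V4 V8 [Refer
     37 V2 V4 V1 V3 V5 V8 V6 V7], Refer 39 V2 V4 V1 V3 V5 V8 V7 V6]], Split V2 V4 V5 [Split
     V2 V4 V8 [Refer 39 V2 V4 V1 V3 V5 V6 V8 V7, Split V2 V4 V6 [Refer 37 V2 V4 V1 V3 V5 V6
     V7 V8]], Split V2 V4 V8 [Split V2 V4 V7 [Refer 37 V2 V4 V1 V3 V5 V7 V6 V8], Refer 39 V2
     V4 V1 V3 V5 V7 V8 V6], Split V1 V4 V5 [Split V1 V4 V8 [Refer 42 V1 V4 V2 V3 V5 V6 V8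
     V7, Split V1 V4 V6 [Refer 37 V1 V4 V2 V3 V5 V6 V7 V8]], Split V1 V4 V8 [Split V1 V4 V7
     [Refer 37 V1 V4 V2 V3 V5 V7 V6 V8], Refer 42 V1 V4 V2 V3 V5 V7 V8 V6], Refer 20 V1 V3
     V2 V4 V5 V8 V6 V7]]], Refer 43 V1 V2 V3 V4 V5 V6 V7 V8, Refer 43 V1 V2 V3 V4 V5 V7 V6
     V8, Refer 43 V1 V2 V3 V4 V5 V8 V6 V7]"

definition pattern_22 :: "vertex list list" where
  "pattern_22 =
     [[V1, V2, V3, V4]]"

definition cert_22 :: cert where
  "cert_22 =
     Split V2 V3 V4 [Refer 44 V1 V2 V3 V4 V5 V6 V7 V8, Refer 44 V1 V2 V3 V4 V6 V5 V7 V8,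
     Refer 44 V1 V2 V3 V4 V7 V5 V6 V8, Refer 44 V1 V2 V3 V4 V8 V5 V6 V7]"

text \<open>
  Pattern 14 is an edge of degree 6, pattern 19 an edge of degree 5, and pattern 22 a single facet.
  The other patterns are partial complexes that occur repeatedly, up to relabelling, in the search.
\<close>

definition steps :: "(vertex list list \<times> cert) list" where
  "steps =
     [(pattern_1, cert_1), (pattern_2, cert_2), (pattern_3, cert_3), (pattern_4, cert_4),
     (pattern_5, cert_5), (pattern_6, cert_6), (pattern_7, cert_7), (pattern_8, cert_8),
     (pattern_9, cert_9), (pattern_10, cert_10), (pattern_11, cert_11), (pattern_12,
     cert_12), (pattern_13, cert_13), (pattern_14, cert_14), (pattern_15, cert_15),
     (pattern_16, cert_16), (pattern_17, cert_17), (pattern_18, cert_18), (pattern_19,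
     cert_19), (pattern_20, cert_20), (pattern_21, cert_21), (pattern_22, cert_22)]"

section \<open>Classification\<close>

lemma models_tetrahedra: "list_all (\<lambda>F. tetrahedra F \<and> distinct (map mask_list F)) models"
  by code_simp

lemma models_closed: "list_all closed_list models"
  by code_simp

text \<open>The source of all non-isomorphism statements: the nineteen values are pairwise
  different, which separates spheres from spheres, pseudomanifolds from each other, and the two
  families.\<close>

lemma models_invariant: "distinct (map list_invariant models)"
  by code_simp

lemma cones_dead: "list_all (\<lambda>(x, y, F). dead_cone x y F) cones"
  by code_simp

text \<open>This list fixes the numbers in \<open>Refer\<close>: the models have positions 0 to 18,
  the cones 19 to 23, and pattern number k has position 23 + k.\<close>

lemma steps_check: "check_seq (models @ map (snd \<circ> snd) cones) steps"
  by code_simp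

lemma not_iso_models:
  assumes "i < j" "j < length models"
    and K: "K = (`) digit ` list_complex (models ! i)" and L: "L = (`) digit ` list_complex (models ! j)"
  shows "\<not> iso_complex K L"
proof
  assume iso: "iso_complex K L"
  have model: "degree_invariant ((`) digit ` list_complex F) = list_invariant F" if "F \<in> set models" for F
  proof -
    have "inj_on digit (vertices (list_complex F))" using inj_digit by (rule inj_on_subset) simp
    then have "degree_invariant ((`) digit ` list_complex F) = degree_invariant (list_complex F)"
      by (intro degree_invariant_iso iso_complex_image)
    moreover have "tetrahedra F" "distinct (map mask_list F)"
      using models_tetrahedra that by (simp_all add: list_all_iff)
    moreover have "vertices (list_complex F) = UNIV"
    proof -
      have "closed_list F" using models_closed that by (simp add: list_all_iff)
      then have "\<exists>\<sigma>\<in>set F. x \<in> set \<sigma>" for x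
        by (simp add: closed_list_def list_all_iff list_ex_iff set_verts)
      then show ?thesis
        by (fastforce simp: vertices_def list_complex_def complex_of_facets_def)
    qed
    ultimately show ?thesis by (simp add: degree_invariant_list_complex)
  qed
  have "list_invariant (models ! i) = list_invariant (models ! j)"
    using degree_invariant_iso[OF iso] model[of "models ! i"] model[of "models ! j"] assms by simp
  then have "map list_invariant models ! i = map list_invariant models ! j" using assms by simp
  moreover have "i < length (map list_invariant models)" "j < length (map list_invariant models)"
    using assms(1,2) by simp_all
  ultimately have "i = j" using nth_eq_iff_index_eq[OF models_invariant] by blast
  then show False using assms(1) by simp
qed

text \<open>Some facet of \<open>M\<close> is sent to \<open>V1\<close>, \<open>V2\<close>,
  \<open>V3\<close>, \<open>V4\<close> and the remaining four vertices to the rest. The relabelled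
  complex contains the one-facet \<open>pattern_22\<close>, the last pattern settled, so its claim
  applies to every \<open>M\<close>.\<close>

lemma isomorphic_to_model:
  assumes M: "normal_pseudomanifold 3 M" "neighbourly M" and card: "card (vertices M) = 8"
  shows "isomorphic_to_some models M"
proof -
  interpret normal3 M using M(1) by unfold_locales
  have fin: "finite (vertices M)" using card by (metis card.infinite zero_neq_numeral)
  have "vertices M \<noteq> {}" using card by auto
  then obtain \<sigma> where "\<sigma> \<in> M" by (auto simp: vertices_def)
  then obtain \<tau> where \<tau>: "\<tau> \<in> M" "card \<tau> = 4" by (rule in_facet)
  have sub: "\<tau> \<subseteq> vertices M" using \<tau>(1) by (auto simp: vertices_def)
  have fin\<tau>: "finite \<tau>" using \<tau>(1) by (rule face_finite)
  obtain f where f: "bij_betw f \<tau> {V1, V2, V3, V4}"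
    using finite_same_card_bij[OF fin\<tau>, of "{V1, V2, V3, V4}"] \<tau>(2) by auto
  have "card (vertices M - \<tau>) = 4" using card_Diff_subset[OF fin\<tau> sub] card \<tau>(2) by simp
  then obtain g where g: "bij_betw g (vertices M - \<tau>) {V5, V6, V7, V8}"
    using finite_same_card_bij[of "vertices M - \<tau>" "{V5, V6, V7, V8}"] fin by auto
  define h where "h = (\<lambda>x. if x \<in> \<tau> then f x else g x)"
  have "bij_betw h (\<tau> \<union> (vertices M - \<tau>)) ({V1, V2, V3, V4} \<union> {V5, V6, V7, V8})"
    unfolding h_def by (rule bij_betw_disjoint_Un[OF f g]) auto
  moreover have "\<tau> \<union> (vertices M - \<tau>) = vertices M" using sub by blast
  moreover have "{V1, V2, V3, V4} \<union> {V5, V6, V7, V8} = UNIV" by (auto simp: UNIV_vertex)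
  ultimately have h: "bij_betw h (vertices M) UNIV" by simp
  then have inj: "inj_on h (vertices M)" by (rule bij_betw_imp_inj_on)
  have "valid ((`) h ` M)"
    using normal_pseudomanifold_image[OF inj M(1)] neighbourly_image[OF M(2)] h
    by (simp add: valid_def vertices_image bij_betw_def)
  moreover have "h ` \<tau> = {V1, V2, V3, V4}" using f by (auto simp: h_def bij_betw_def)
  then have "{V1, V2, V3, V4} \<in> (`) h ` M" using \<tau>(1) by (metis imageI)
  moreover have "claim models [[V1, V2, V3, V4]]"
  proof -
    have "\<forall>F\<in>set models. claim models F"
      using models_closed claim_closed_list by (simp add: list_all_iff)
    moreover have "\<forall>F\<in>set (map (snd \<circ> snd) cones). claim models F"
      using cones_dead claim_dead_cone by (fastforce simp: list_all_iff)
    ultimately have "\<forall>F\<in>set (models @ map (snd \<circ> snd) cones). claim models F"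
      by (simp add: ball_Un)
    then have "\<forall>(F, c)\<in>set steps. claim models F"
      by (rule check_seq_sound[OF steps_check])
    moreover have "(pattern_22, cert_22) \<in> set steps" by (simp add: steps_def)
    ultimately show ?thesis by (auto simp: pattern_22_def)
  qed
  ultimately have "isomorphic_to_some models ((`) h ` M)" by (simp add: claim_def)
  then show ?thesis
    unfolding isomorphic_to_some_def using iso_complex_image[OF inj] iso_complex_trans by blast
qed

lemma sphere8_eq:
  assumes "35 \<le> i" "i \<le> 38"
  shows "sphere8 i = (`) digit ` list_complex (models ! (i - 35))"
proof -
  have "i = 35 \<or> i = 36 \<or> i = 37 \<or> i = 38" using assms by presburger
  then show ?thesis
    by (elim disjE) (simp_all add: sphere8_def models_def S8_35_eq S8_36_eq S8_37_eq S8_38_eq)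
qed

text \<open>The offset 3 is 4 - 1: four spheres precede in \<open>models\<close>, and the
  pseudomanifolds are counted from 1.\<close>

lemma pseudo8_eq:
  assumes "1 \<le> k" "k \<le> 15"
  shows "pseudo8 k = (`) digit ` list_complex (models ! (k + 3))"
proof -
  have "k = 1 \<or> k = 2 \<or> k = 3 \<or> k = 4 \<or> k = 5 \<or> k = 6 \<or> k = 7 \<or> k = 8 \<or> k = 9 \<or> k = 10 \<or>
      k = 11 \<or> k = 12 \<or> k = 13 \<or> k = 14 \<or> k = 15"
    using assms by presburger
  then show ?thesis
    by (elim disjE) (simp_all add: pseudo8_def models_def N8_1_eq N8_2_eq N8_3_eq N8_4_eq N8_5_eq
        N8_6_eq N8_7_eq N8_8_eq N8_9_eq N8_10_eq N8_11_eq N8_12_eq N8_13_eq N8_14_eq N8_15_eq)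
qed

lemma length_models: "length models = 19"
  by (simp add: models_def)

theorem theorem2:
  shows "(\<forall>i j. 35 \<le> i \<and> i < j \<and> j \<le> 38 \<longrightarrow> \<not> iso_complex (sphere8 i) (sphere8 j)) \<and>
         (\<forall>k l. 1 \<le> k \<and> k < l \<and> l \<le> 15 \<longrightarrow> \<not> iso_complex (pseudo8 k) (pseudo8 l)) \<and>
         (\<forall>m n. 35 \<le> m \<and> m \<le> 38 \<and> 1 \<le> n \<and> n \<le> 15 \<longrightarrow>
            \<not> iso_complex (sphere8 m) (pseudo8 n)) \<and>
         (\<forall>M :: 'a set set.
            normal_pseudomanifold 3 M \<and> neighbourly M \<and> card (vertices M) = 8 \<longrightarrow>
            (\<exists>i\<in>{35..38}. iso_complex M (sphere8 i)) \<or>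
            (\<exists>k\<in>{1..15}. iso_complex M (pseudo8 k)))"
proof (intro conjI allI impI)
  fix i j :: nat assume "35 \<le> i \<and> i < j \<and> j \<le> 38"
  then show "\<not> iso_complex (sphere8 i) (sphere8 j)"
    by (intro not_iso_models[OF _ _ sphere8_eq sphere8_eq]) (auto simp: length_models)
next
  fix k l :: nat assume "1 \<le> k \<and> k < l \<and> l \<le> 15"
  then show "\<not> iso_complex (pseudo8 k) (pseudo8 l)"
    by (intro not_iso_models[OF _ _ pseudo8_eq pseudo8_eq]) (auto simp: length_models)
next
  fix m n :: nat assume "35 \<le> m \<and> m \<le> 38 \<and> 1 \<le> n \<and> n \<le> 15"
  then show "\<not> iso_complex (sphere8 m) (pseudo8 n)"
    by (intro not_iso_models[OF _ _ sphere8_eq pseudo8_eq]) (auto simp: length_models)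
next
  fix M :: "'a set set"
  assume M: "normal_pseudomanifold 3 M \<and> neighbourly M \<and> card (vertices M) = 8"
  then have "isomorphic_to_some models M" by (simp add: isomorphic_to_model)
  then obtain r where r: "r < 19" "iso_complex M (list_complex (models ! r))"
    by (auto simp: isomorphic_to_some_def in_set_conv_nth length_models)
  have "inj_on digit (vertices (list_complex (models ! r)))" using inj_digit by (rule inj_on_subset) simp
  then have iso: "iso_complex M ((`) digit ` list_complex (models ! r))"
    using r(2) iso_complex_image iso_complex_trans by blast
  show "(\<exists>i\<in>{35..38}. iso_complex M (sphere8 i)) \<or> (\<exists>k\<in>{1..15}. iso_complex M (pseudo8 k))"
  proof (cases "r < 4")
    case True
    then have "iso_complex M (sphere8 (r + 35))" "r + 35 \<in> {35..38}"
      using iso by (simp_all add: sphere8_eq)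
    then show ?thesis by blast
  next
    case False
    then have "iso_complex M (pseudo8 (r - 3))" "r - 3 \<in> {1..15}"
      using iso r(1) by (auto simp: pseudo8_eq)
    then show ?thesis by blast
  qed
qed

end
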